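(* Let $\Omega\subset\mathbb{R}^d$ be a convex polytope with $|\Omega|>0$ that is not (centrally) symmetric. Then $\Omega$ is not a Gabor orthonormal basis set; that is, there is no discrete set $\Lambda\subset\mathbb{R}^{d}\times\mathbb{R}^{d}$ such that the Gabor system $$\mathcal{G}(|\Omega|^{-1/2}\chi_\Omega,\Lambda)=\{\,e^{2\pi i\langle\lambda,x\rangle}\,|\Omega|^{-1/2}\chi_\Omega(x-t) : (t,\lambda)\in\Lambda\,\}$$ is an orthonormal basis of $L^2(\mathbb{R}^d)$.
   Context: $|\cdot|$ applied to a set denotes Lebesgue measure on $\mathbb{R}^d$, and $\chi_\Omega$ is the characteristic function of $\Omega$. A convex polytope is the convex hull of finitely many points of $\mathbb{R}^d$ (equivalently, a bounded finite intersection of closed half-spaces). A convex polytope $\Omega$ is (centrally) symmetric if there exists $x\in\mathbb{R}^d$ with $x-\Omega=\Omega-x$; otherwise it is non-symmetric. For $g\in L^2(\mathbb{R}^d)$, $g\ne0$, and a discrete set $\Lambda\subset\mathbb{R}^{2d}$ of pairs $(t,\lambda)$, $t,\lambda\in\mathbb{R}^d$, the Gabor system is $\mathcal{G}(g,\Lambda)=\{e^{2\pi i\langle\lambda,x\rangle}g(x-t):(t,\lambda)\in\Lambda\}$. A measurable set $\Omega\subset\mathbb{R}^d$ of positive measure is a Gabor orthonormal basis set if $\mathcal{G}(|\Omega|^{-1/2}\chi_\Omega,\Lambda)$ is an orthonormal basis of $L^2(\mathbb{R}^d)$ for some discrete $\Lambda\subset\mathbb{R}^{2d}$. *)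

theory Defs
  imports "HOL-Analysis.Analysis"
begin

definition centrally_symmetric :: "'a::real_vector set \<Rightarrow> bool" where
  "centrally_symmetric \<Omega> \<longleftrightarrow> (\<exists>x. (\<lambda>y. x - y) ` \<Omega> = (\<lambda>y. y - x) ` \<Omega>)"

text \<open>
  Elements of \<open>L\<^sup>2\<close> are represented by functions, not by classes modulo null sets:
  \<open>L2_functions\<close> collects the representatives, and the inner product and the norm depend
  only on the classes.
\<close>

definition L2_functions :: "('a::euclidean_space \<Rightarrow> complex) set" where
  "L2_functions = {f. f \<in> borel_measurable lebesgue \<and> integrable lebesgue (\<lambda>x. (cmod (f x))\<^sup>2)}"

definition L2_inner :: "('a::euclidean_space \<Rightarrow> complex) \<Rightarrow> ('a \<Rightarrow> complex) \<Rightarrow> complex" where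
  "L2_inner f g = (LINT x|lebesgue. f x * cnj (g x))"

definition L2_norm :: "('a::euclidean_space \<Rightarrow> complex) \<Rightarrow> real" where
  "L2_norm f = sqrt (LINT x|lebesgue. (cmod (f x))\<^sup>2)"

text \<open>
  A complete orthonormal system: the finite complex linear combinations are dense.
  Two different functions in \<open>B\<close> that agree almost everywhere would violate orthogonality,
  so distinct elements of \<open>B\<close> represent distinct elements of \<open>L\<^sup>2\<close>.
\<close>

definition L2_orthonormal_basis :: "('a::euclidean_space \<Rightarrow> complex) set \<Rightarrow> bool" where
  "L2_orthonormal_basis B \<longleftrightarrow>
     B \<subseteq> L2_functions \<and>
     (\<forall>f\<in>B. L2_norm f = 1) \<and>
     (\<forall>f\<in>B. \<forall>g\<in>B. f \<noteq> g \<longrightarrow> L2_inner f g = 0) \<and>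
     (\<forall>f\<in>L2_functions. \<forall>e>0. \<exists>F c. finite F \<and> F \<subseteq> B \<and>
        L2_norm (\<lambda>x. f x - (\<Sum>h\<in>F. c h * h x)) < e)"

definition gabor_system ::
    "('a::euclidean_space \<Rightarrow> complex) \<Rightarrow> ('a \<times> 'a) set \<Rightarrow> ('a \<Rightarrow> complex) set" where
  "gabor_system g \<Lambda> =
     {\<lambda>x. exp (2 * of_real pi * \<i> * of_real (l \<bullet> x)) * g (x - t) | t l. (t, l) \<in> \<Lambda>}"

definition normalized_indicator :: "'a::euclidean_space set \<Rightarrow> 'a \<Rightarrow> complex" where
  "normalized_indicator \<Omega> x = of_real (measure lebesgue \<Omega> powr (- 1 / 2)) * indicator \<Omega> x"

text \<open>
  Discreteness is meant in the topological sense (every point is isolated); accumulation points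
  outside \<open>\<Lambda>\<close> are not excluded.
\<close>

definition gabor_orthonormal_basis_set :: "'a::euclidean_space set \<Rightarrow> bool" where
  "gabor_orthonormal_basis_set \<Omega> \<longleftrightarrow>
     \<Omega> \<in> sets lebesgue \<and> emeasure lebesgue \<Omega> > 0 \<and>
     (\<exists>\<Lambda>. discrete \<Lambda> \<and> L2_orthonormal_basis (gabor_system (normalized_indicator \<Omega>) \<Lambda>))"

end

theory Submission
  imports Defs
begin

text \<open>
  Orthogonality of two Gabor atoms says that the ambiguity function \<open>(t, l) \<mapsto> FT (P \<inter> (P + t)) (l)\<close>
  of \<open>P\<close> vanishes at the difference of their parameters. By Minkowski's uniqueness theorem a polytope that is not
  symmetric has a normal \<open>u\<close> whose two facets differ in area; on these two facets the Fourier transform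
  in direction \<open>u\<close> has leading terms that cannot cancel. Hence the ambiguity function has no zero in a tube
  around the half-line spanned by \<open>u\<close>, uniformly for small \<open>t\<close>, and by the pigeonhole principle \<open>\<Lambda>\<close> has
  arbitrarily large holes. In a large hole the Parseval identity for Gabor atoms fails, because the ambiguity
  function is square integrable and has small tails.

  Minkowski's theorem for \<open>P\<close> and \<open>- P\<close> follows from the Brunn-Minkowski inequality: if opposite facets have the
  same area, the volume of \<open>(1 - e) P + e D\<close> with \<open>D = (P - P) / 2\<close> does not grow to first order in \<open>e\<close>,
  so \<open>|D| = |P|\<close>, which is the equality case. Areas of facets and boundary terms are only ever measured by the
  volumes of thin caps, so no lower dimensional measures occur.
\<close>

section \<open>Slabs\<close>

text \<open>Orthogonality yields zeros of the ambiguity function and nothing more, so a region that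
  is unbounded in frequency and free of zeros has to be found. On the ray along a normal
  \<open>u\<close> the facets at \<open>u\<close> and \<open>- u\<close> contribute oscillating
  terms of the same order; if their areas agree, these can cancel, as for a cube, which does
  generate Gabor bases. The estimates have to hold for P \<inter> (P + t) with small t because the
  pigeonhole argument matches time parameters only approximately.

  To see the leading terms without integrating by parts, the body is shifted along \<open>u\<close>
  by a small fraction \<open>\<eta>\<close> of a wavelength. The phase is almost constant on the
  shells exposed at the two facets, while the shell at any other facet cancels within itself.

  A Gabor system is a set of functions, and two parameters may define the same atom. The ambiguity
  function at their difference then has modulus |P| instead of 0, so the tube has to exclude both
  values.\<close>

abbreviation vol :: "'a::euclidean_space set \<Rightarrow> real" where
  "vol \<equiv> measure lebesgue"

text \<open>Plays the part of Fubini in the slab estimates: a thin set has many disjoint translates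
  within a fixed ball, so its volume is at most that of the ball divided by their number.\<close>

lemma packing_measure_le:
  fixes X :: "'a::euclidean_space set" and s :: "'b \<Rightarrow> 'a"
  assumes X: "X \<in> lmeasurable" "X \<subseteq> cball 0 R" and I: "finite I"
    and s: "\<And>i. i \<in> I \<Longrightarrow> norm (s i) \<le> \<rho>"
    and disj: "disjoint_family_on (\<lambda>i. (+) (s i) ` X) I"
  shows "real (card I) * vol X \<le> vol (cball (0::'a) (R + \<rho>))"
proof -
  have "vol (\<Union>i\<in>I. (+) (s i) ` X) = (\<Sum>i\<in>I. vol ((+) (s i) ` X))"
    using X(1) by (intro measure_UNION' I disj[unfolded disjoint_family_on_def pairwise_def disjnt_def, simplified])
      (auto simp: measurable_translation pairwise_def disjnt_def disj[unfolded disjoint_family_on_def, rule_format])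
  also have "\<dots> = real (card I) * vol X"
    by (simp add: measure_translation)
  finally have eq: "vol (\<Union>i\<in>I. (+) (s i) ` X) = real (card I) * vol X" .
  have "vol (\<Union>i\<in>I. (+) (s i) ` X) \<le> vol (cball (0::'a) (R + \<rho>))"
  proof (rule measure_mono_fmeasurable)
    show "(\<Union>i\<in>I. (+) (s i) ` X) \<subseteq> cball 0 (R + \<rho>)"
    proof clarsimp
      fix i x assume "i \<in> I" "x \<in> X"
      then have "norm (s i) \<le> \<rho>" "norm x \<le> R" using s X(2) by auto
      then show "norm (s i + x) \<le> R + \<rho>" using norm_triangle_ineq[of "s i" x] by linarith
    qed
    show "(\<Union>i\<in>I. (+) (s i) ` X) \<in> sets lebesgue"
      using X(1) I by (intro sets.finite_UN) (auto intro: fmeasurableD measurable_translation)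
  qed auto
  with eq show ?thesis by simp
qed

lemma lmeasurable_slab:
  fixes u :: "'a::euclidean_space"
  shows "{x \<in> cball 0 R. p < u \<bullet> x \<and> u \<bullet> x \<le> q} \<in> lmeasurable"
proof (rule bounded_set_imp_lmeasurable)
  show "bounded {x \<in> cball 0 R. p < u \<bullet> x \<and> u \<bullet> x \<le> q}"
    by (rule bounded_subset[of "cball 0 R"]) auto
  have "{x. norm x \<le> R \<and> p < u \<bullet> x \<and> u \<bullet> x \<le> q} \<in> sets borel" by measurable
  then show "{x \<in> cball 0 R. p < u \<bullet> x \<and> u \<bullet> x \<le> q} \<in> sets lebesgue"
    by (simp add: dist_norm)
qed

text \<open>Fixes the number of translates: rounding up gives at least \<open>1 / \<alpha>\<close>
  of them, and since indices start at 0 the largest shift still has length at most 1.\<close>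

lemma nat_ceiling_inverse:
  fixes \<alpha> :: real assumes "\<alpha> > 0"
  shows "1 / \<alpha> \<le> real (nat \<lceil>1 / \<alpha>\<rceil>)" "j < nat \<lceil>1 / \<alpha>\<rceil> \<Longrightarrow> real j * \<alpha> \<le> 1"
proof -
  show "1 / \<alpha> \<le> real (nat \<lceil>1 / \<alpha>\<rceil>)" using assms by linarith
  assume "j < nat \<lceil>1 / \<alpha>\<rceil>"
  then have "real j < 1 / \<alpha>" using assms by linarith
  then show "real j * \<alpha> \<le> 1" using assms by (simp add: field_simps)
qed

lemma slab_index_unique:
  fixes \<alpha> :: real
  assumes "\<alpha> > 0" "p + real j * \<alpha> < y" "y \<le> p + \<alpha> + real j * \<alpha>"
    "p + real k * \<alpha> < y" "y \<le> p + \<alpha> + real k * \<alpha>"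
  shows "j = k"
proof -
  have "real j * \<alpha> < (real k + 1) * \<alpha>" "real k * \<alpha> < (real j + 1) * \<alpha>"
    using assms by (auto simp: algebra_simps)
  then have "real j < real k + 1" "real k < real j + 1" using assms(1) by auto
  then show ?thesis by linarith
qed

text \<open>Multiples of \<open>\<alpha>\<close> along \<open>u\<close> move the half-open slab to
  disjoint slabs, and shifts of length at most 1 stay in the ball of radius
  \<open>R + 1\<close>.\<close>

lemma measure_slab_le:
  fixes u :: "'a::euclidean_space"
  assumes u: "norm u = 1" and "\<alpha> \<ge> 0"
  shows "vol {x \<in> cball 0 R. p < u \<bullet> x \<and> u \<bullet> x \<le> p + \<alpha>}
    \<le> vol (cball (0::'a) (R + 1)) * \<alpha>"
proof (cases "\<alpha> = 0")
  case True
  then have "{x \<in> cball 0 R. p < u \<bullet> x \<and> u \<bullet> x \<le> p + \<alpha>} = {}" by auto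
  then show ?thesis using True by (metis measure_empty mult_zero_right order_refl)
next
  case False
  then have a: "\<alpha> > 0" using assms by simp
  let ?X = "{x \<in> cball 0 R. p < u \<bullet> x \<and> u \<bullet> x \<le> p + \<alpha>}" and ?n = "nat \<lceil>1 / \<alpha>\<rceil>"
  have uu: "u \<bullet> u = 1" using u by (simp add: dot_square_norm)
  have "real (card {..<?n}) * vol ?X \<le> vol (cball (0::'a) (R + 1))"
  proof (rule packing_measure_le[where s = "\<lambda>j. (real j * \<alpha>) *\<^sub>R u"])
    show "disjoint_family_on (\<lambda>i. (+) ((real i * \<alpha>) *\<^sub>R u) ` ?X) {..<?n}"
      unfolding disjoint_family_on_def
    proof (intro ballI impI equals0I)
      fix j k y assume "j \<noteq> k" "y \<in> (+) ((real j * \<alpha>) *\<^sub>R u) ` ?X \<inter> (+) ((real k * \<alpha>) *\<^sub>R u) ` ?X"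
      moreover have "p + real l * \<alpha> < u \<bullet> y \<and> u \<bullet> y \<le> p + \<alpha> + real l * \<alpha>"
        if "y \<in> (+) ((real l * \<alpha>) *\<^sub>R u) ` ?X" for l
        using that by (auto simp: inner_add_right uu)
      ultimately show False using slab_index_unique[OF a, of p j "u \<bullet> y" k] by blast
    qed
    show "?X \<in> lmeasurable" by (rule lmeasurable_slab)
  qed (use nat_ceiling_inverse(2)[OF a] a u in auto)
  moreover have "1 / \<alpha> * vol ?X \<le> real (card {..<?n}) * vol ?X"
    using nat_ceiling_inverse(1)[OF a] by (intro mult_right_mono) auto
  ultimately have "1 / \<alpha> * vol ?X \<le> vol (cball (0::'a) (R + 1))" by linarith
  then show ?thesis using a by (simp add: divide_simps mult.commute)
qed

lemma unit_inner_square_less_1: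
  fixes u v :: "'a::real_inner"
  assumes "norm u = 1" "norm v = 1" "u \<noteq> v" "u \<noteq> - v"
  shows "(u \<bullet> v)\<^sup>2 < 1"
proof -
  have uv: "u \<bullet> u = 1" "v \<bullet> v = 1" using assms by (simp_all add: dot_square_norm)
  have "(u - v) \<bullet> (u - v) > 0" "(u + v) \<bullet> (u + v) > 0"
    using assms by (auto simp: eq_neg_iff_add_eq_0)
  then have "u \<bullet> v < 1" "u \<bullet> v > -1"
    by (auto simp: inner_diff inner_add uv inner_commute[of v u])
  then show ?thesis by (simp add: abs_square_less_1)
qed

text \<open>The product bound makes everything near a face of codimension two a second-order
  quantity. \<open>C\<close> depends on \<open>R\<close> and on the angle between \<open>u\<close>
  and \<open>v\<close>, but not on the position or the thickness of the slabs.\<close>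

lemma measure_two_slabs_le:
  fixes u v :: "'a::euclidean_space"
  assumes u: "norm u = 1" and v: "norm v = 1" and uv: "u \<noteq> v" "u \<noteq> - v"
  obtains C where "C \<ge> 0" "\<And>p q \<alpha> \<beta>. \<alpha> \<ge> 0 \<Longrightarrow> \<beta> \<ge> 0 \<Longrightarrow>
    vol {x \<in> cball 0 R. p < u \<bullet> x \<and> u \<bullet> x \<le> p + \<alpha> \<and> q < v \<bullet> x \<and> v \<bullet> x \<le> q + \<beta>} \<le> C * (\<alpha> * \<beta>)"
proof -
  define c where "c = u \<bullet> v"
  have uu: "u \<bullet> u = 1" "v \<bullet> v = 1" using u v by (simp_all add: dot_square_norm)
  have c1: "1 - c\<^sup>2 > 0" using unit_inner_square_less_1[OF u v uv] by (simp add: c_def)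
  \<comment> \<open>\<open>v'\<close> and \<open>w'\<close> form the basis dual to \<open>u\<close>,
    \<open>v\<close> in the plane spanned by them: a shift along \<open>v'\<close> preserves the
    slab of \<open>v\<close>, one along \<open>w'\<close> preserves the slab of
    \<open>u\<close>.\<close>
  define v' where "v' = (1 / (1 - c\<^sup>2)) *\<^sub>R (u - c *\<^sub>R v)"
  define w' where "w' = (1 / (1 - c\<^sup>2)) *\<^sub>R (v - c *\<^sub>R u)"
  have dual: "u \<bullet> v' = 1" "v \<bullet> v' = 0" "u \<bullet> w' = 0" "v \<bullet> w' = 1"
    using c1 by (auto simp: v'_def w'_def inner_diff_right uu c_def[symmetric] inner_commute[of v u] power2_eq_square)
  define \<rho> where "\<rho> = norm v' + norm w'"
  define C where "C = vol (cball (0::'a) (R + \<rho>))"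
  show thesis
  proof (rule that[of C])
    show "C \<ge> 0" by (simp add: C_def)
    fix p q \<alpha> \<beta> :: real assume ab: "\<alpha> \<ge> 0" "\<beta> \<ge> 0"
    let ?X = "{x \<in> cball 0 R. p < u \<bullet> x \<and> u \<bullet> x \<le> p + \<alpha> \<and> q < v \<bullet> x \<and> v \<bullet> x \<le> q + \<beta>}"
    have X: "?X \<in> lmeasurable"
    proof -
      have "?X = {x \<in> cball 0 R. p < u \<bullet> x \<and> u \<bullet> x \<le> p + \<alpha>} \<inter> {x \<in> cball 0 R. q < v \<bullet> x \<and> v \<bullet> x \<le> q + \<beta>}"
        by auto
      then show ?thesis by (simp only: fmeasurable.Int[OF lmeasurable_slab lmeasurable_slab])
    qed
    show "vol ?X \<le> C * (\<alpha> * \<beta>)"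
    proof (cases "\<alpha> = 0 \<or> \<beta> = 0")
      case True
      then have "?X = {}" by auto
      then show ?thesis using True by (metis measure_empty mult_zero_left mult_zero_right order_refl)
    next
      case False
      then have a: "\<alpha> > 0" and b: "\<beta> > 0" using ab by auto
      let ?n = "nat \<lceil>1 / \<alpha>\<rceil>" and ?m = "nat \<lceil>1 / \<beta>\<rceil>"
      have "real (card ({..<?n} \<times> {..<?m})) * vol ?X \<le> C"
        unfolding C_def
      proof (rule packing_measure_le[where s = "\<lambda>(j, k). (real j * \<alpha>) *\<^sub>R v' + (real k * \<beta>) *\<^sub>R w'"])
        show "disjoint_family_on (\<lambda>i. (+) (case i of (j, k) \<Rightarrow> (real j * \<alpha>) *\<^sub>R v' + (real k * \<beta>) *\<^sub>R w') ` ?X) ({..<?n} \<times> {..<?m})"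
          unfolding disjoint_family_on_def
        proof (intro ballI impI equals0I)
          fix i i' y assume ne: "i \<noteq> i'" and y: "y \<in> (+) (case i of (j, k) \<Rightarrow> (real j * \<alpha>) *\<^sub>R v' + (real k * \<beta>) *\<^sub>R w') ` ?X \<inter> (+) (case i' of (j, k) \<Rightarrow> (real j * \<alpha>) *\<^sub>R v' + (real k * \<beta>) *\<^sub>R w') ` ?X"
          obtain j k j' k' where i: "i = (j, k)" "i' = (j', k')" by fastforce
          have mem: "p + real l * \<alpha> < u \<bullet> y \<and> u \<bullet> y \<le> p + \<alpha> + real l * \<alpha> \<and>
              q + real r * \<beta> < v \<bullet> y \<and> v \<bullet> y \<le> q + \<beta> + real r * \<beta>"
            if "y \<in> (+) ((real l * \<alpha>) *\<^sub>R v' + (real r * \<beta>) *\<^sub>R w') ` ?X" for l r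
            using that by (auto simp: inner_add_right dual)
          have y1: "y \<in> (+) ((real j * \<alpha>) *\<^sub>R v' + (real k * \<beta>) *\<^sub>R w') ` ?X"
            and y2: "y \<in> (+) ((real j' * \<alpha>) *\<^sub>R v' + (real k' * \<beta>) *\<^sub>R w') ` ?X"
            using y unfolding i by simp_all
          note mem1 = mem[OF y1] mem[OF y2]
          have "j = j'" using slab_index_unique[OF a, of p j "u \<bullet> y" j'] mem1 by simp
          moreover have "k = k'" using slab_index_unique[OF b, of q k "v \<bullet> y" k'] mem1 by simp
          ultimately show False using ne i by simp
        qed
        fix i assume "i \<in> {..<?n} \<times> {..<?m}"
        then obtain j k where i: "i = (j, k)" "j < ?n" "k < ?m" by auto
        have "real j * \<alpha> * norm v' \<le> 1 * norm v'" "real k * \<beta> * norm w' \<le> 1 * norm w'"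
          using nat_ceiling_inverse(2)[OF a i(2)] nat_ceiling_inverse(2)[OF b i(3)]
          by (intro mult_right_mono norm_ge_zero; simp)+
        then have "norm ((real j * \<alpha>) *\<^sub>R v') \<le> norm v'" "norm ((real k * \<beta>) *\<^sub>R w') \<le> norm w'"
          using a b by simp_all
        then show "norm (case i of (j, k) \<Rightarrow> (real j * \<alpha>) *\<^sub>R v' + (real k * \<beta>) *\<^sub>R w') \<le> \<rho>"
          unfolding \<rho>_def i using norm_triangle_ineq[of "(real j * \<alpha>) *\<^sub>R v'" "(real k * \<beta>) *\<^sub>R w'"] by simp
      qed (use X in auto)
      moreover have "1 / \<alpha> * (1 / \<beta>) \<le> real ?n * real ?m"
        using a b by (intro mult_mono nat_ceiling_inverse(1) of_nat_0_le_iff) simp_all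
      then have "(1 / \<alpha> * (1 / \<beta>)) * vol ?X \<le> real (card ({..<?n} \<times> {..<?m})) * vol ?X"
        unfolding card_cartesian_product card_lessThan of_nat_mult
        by (rule mult_right_mono) simp
      ultimately have "(1 / \<alpha> * (1 / \<beta>)) * vol ?X \<le> C" by linarith
      then show ?thesis using a b by (simp add: divide_simps mult.commute)
    qed
  qed
qed

section \<open>The Brunn-Minkowski inequality\<close>

text \<open>This is Brunn-Minkowski for boxes with side lengths \<open>p\<close> and
  \<open>q\<close>. With \<open>c\<close> the root of the product on the right, the inequality of
  arithmetic and geometric means bounds \<open>a / c\<close> and \<open>b / c\<close> by the means
  of \<open>p i / (p i + q i)\<close> and \<open>q i / (p i + q i)\<close>, which add up to
  1.\<close>

lemma power_add_le_prod_add: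
  fixes p q :: "'b \<Rightarrow> real"
  assumes S: "finite S" "S \<noteq> {}" and p: "\<And>i. i \<in> S \<Longrightarrow> p i > 0" and q: "\<And>i. i \<in> S \<Longrightarrow> q i > 0"
    and ab: "a \<ge> 0" "b \<ge> 0" and a: "a ^ card S = prod p S" and b: "b ^ card S = prod q S"
  shows "(a + b) ^ card S \<le> (\<Prod>i\<in>S. p i + q i)"
proof -
  define n where "n = card S"
  have n: "n > 0" using S by (simp add: n_def card_gt_0_iff)
  define Z where "Z = (\<Prod>i\<in>S. p i + q i)"
  have Z: "Z > 0" unfolding Z_def using p q by (intro prod_pos) (simp add: add_pos_pos)
  define c where "c = root n Z"
  have c: "c > 0" "c ^ n = Z" using Z n by (simp_all add: c_def)
  have key: "a' / c \<le> (\<Sum>i\<in>S. r i / (p i + q i) / n)"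
    if r: "\<And>i. i \<in> S \<Longrightarrow> r i > 0" and a': "a' \<ge> 0" "a' ^ n = prod r S" for r :: "'b \<Rightarrow> real" and a'
  proof -
    have "(\<Prod>i\<in>S. r i / (p i + q i)) = (a' / c) ^ n"
      using c a' by (simp add: prod_dividef Z_def power_divide)
    moreover have "(\<Prod>i\<in>S. r i / (p i + q i)) > 0"
      using r p q by (intro prod_pos) (simp add: add_pos_pos)
    ultimately have "(\<Prod>i\<in>S. r i / (p i + q i)) powr (1 / n) = a' / c"
      using n c a' by (simp add: real_root_power_cancel flip: root_powr_inverse)
    then show ?thesis
      using arith_geom_mean[OF S, of "\<lambda>i. r i / (p i + q i)"] r p q
      by (simp add: n_def add_pos_pos less_imp_le)
  qed
  have "a / c + b / c \<le> (\<Sum>i\<in>S. p i / (p i + q i) / n) + (\<Sum>i\<in>S. q i / (p i + q i) / n)"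
    using key[of p a] key[of q b] p q ab a b by (simp add: n_def)
  also have "\<dots> = (\<Sum>i\<in>S. 1 / n)"
    unfolding sum.distrib[symmetric]
  proof (rule sum.cong[OF refl])
    fix i assume i: "i \<in> S"
    have "p i + q i \<noteq> 0" using p[OF i] q[OF i] by linarith
    then show "p i / (p i + q i) / n + q i / (p i + q i) / n = 1 / n"
      by (simp add: add_divide_distrib[symmetric])
  qed
  also have "\<dots> = 1" using n by (simp add: n_def)
  finally have "a + b \<le> c" using c(1) by (simp add: field_simps)
  then have "(a + b) ^ n \<le> c ^ n" using ab by (intro power_mono) auto
  then show ?thesis using c(2) by (simp add: n_def Z_def)
qed

section \<open>Minkowski sums and families of boxes\<close>

definition minkowski_sum :: "'a::euclidean_space set \<Rightarrow> 'a set \<Rightarrow> 'a set" where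
  "minkowski_sum A B = {x + y |x y. x \<in> A \<and> y \<in> B}"

lemma minkowski_sumI: "x \<in> A \<Longrightarrow> y \<in> B \<Longrightarrow> x + y \<in> minkowski_sum A B"
  unfolding minkowski_sum_def by blast

lemma minkowski_sumE:
  assumes "z \<in> minkowski_sum A B" obtains x y where "x \<in> A" "y \<in> B" "z = x + y"
  using assms unfolding minkowski_sum_def by blast

lemma minkowski_sum_commute: "minkowski_sum A B = minkowski_sum B A"
  unfolding minkowski_sum_def by (metis (opaque_lifting) add.commute)

lemma minkowski_sum_mono: "A \<subseteq> A' \<Longrightarrow> B \<subseteq> B' \<Longrightarrow> minkowski_sum A B \<subseteq> minkowski_sum A' B'"
  unfolding minkowski_sum_def by blast

lemma open_minkowski_sum: "open A \<Longrightarrow> open (minkowski_sum A B)"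
proof -
  assume A: "open A"
  have "minkowski_sum A B = (\<Union>y\<in>B. (+) y ` A)"
    unfolding minkowski_sum_def by (auto simp: add.commute image_iff) (metis add.commute)+
  then show ?thesis using A by (auto intro: open_translation)
qed

lemma bounded_minkowski_sum: "bounded A \<Longrightarrow> bounded B \<Longrightarrow> bounded (minkowski_sum A B)"
  unfolding minkowski_sum_def using bounded_plus[of A B]
  by (rule bounded_subset) (auto simp: set_plus_def)

lemma lmeasurable_minkowski_sum_open:
  "open A \<Longrightarrow> bounded A \<Longrightarrow> bounded B \<Longrightarrow> minkowski_sum A B \<in> lmeasurable"
  by (intro lmeasurable_open bounded_minkowski_sum open_minkowski_sum)

lemma measure_box_eq_prod:
  assumes "box a b \<noteq> {}"
  shows "vol (box a b) = (\<Prod>i\<in>Basis. (b - a) \<bullet> i)"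
  using assms by (simp add: box_ne_empty less_imp_le inner_diff_left measure_def emeasure_lborel_box_eq prod_nonneg)

lemma box_add_subset_minkowski_sum:
  fixes a b c d :: "'a::euclidean_space"
  assumes "box a b \<noteq> {}" "box c d \<noteq> {}"
  shows "box (a + c) (b + d) \<subseteq> minkowski_sum (box a b) (box c d)"
proof
  fix z assume z: "z \<in> box (a + c) (b + d)"
  \<comment> \<open>\<open>s i\<close> is the relative position of \<open>z\<close> in coordinate
    \<open>i\<close>; \<open>x\<close> takes the same relative position in the first box and leaves
    \<open>z - x\<close> with it in the second.\<close>
  define s where "s i = (z \<bullet> i - a \<bullet> i - c \<bullet> i) / (b \<bullet> i - a \<bullet> i + (d \<bullet> i - c \<bullet> i))" for i
  define x where "x = (\<Sum>i\<in>Basis. (a \<bullet> i + s i * (b \<bullet> i - a \<bullet> i)) *\<^sub>R i)"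
  have x: "x \<bullet> i = a \<bullet> i + s i * (b \<bullet> i - a \<bullet> i)" if "i \<in> Basis" for i
    using that by (simp add: x_def)
  have pos: "b \<bullet> i - a \<bullet> i > 0" "d \<bullet> i - c \<bullet> i > 0" if "i \<in> Basis" for i
    using assms that by (auto simp: box_ne_empty)
  have s: "0 < s i" "s i < 1" "s i * (b \<bullet> i - a \<bullet> i + (d \<bullet> i - c \<bullet> i)) = z \<bullet> i - a \<bullet> i - c \<bullet> i" if i: "i \<in> Basis" for i
    using pos[OF i] z i by (auto simp: s_def mem_box inner_add_left field_simps)
  have zx: "(z - x) \<bullet> i = c \<bullet> i + s i * (d \<bullet> i - c \<bullet> i)" if i: "i \<in> Basis" for i
    using s(3)[OF i] x[OF i] by (simp add: inner_diff_left algebra_simps)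
  have aux: "p < p + t * (q - p) \<and> p + t * (q - p) < q" if "0 < t" "t < 1" "q - p > 0" for p q t :: real
  proof -
    have "t * (q - p) > 0" "(1 - t) * (q - p) > 0" using that by auto
    then show ?thesis by (simp add: algebra_simps)
  qed
  have "x \<in> box a b" using aux s pos by (auto simp: mem_box x)
  moreover have "z - x \<in> box c d" using aux s pos by (auto simp: mem_box zx)
  ultimately show "z \<in> minkowski_sum (box a b) (box c d)"
    using minkowski_sumI[of x "box a b" "z - x" "box c d"] by simp
qed

lemma brunn_minkowski_boxes:
  fixes a b c d :: "'a::euclidean_space"
  assumes ne: "box a b \<noteq> {}" "box c d \<noteq> {}" and xy: "x \<ge> 0" "y \<ge> 0"
    and x: "vol (box a b) = x ^ DIM('a)" and y: "vol (box c d) = y ^ DIM('a)"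
  shows "(x + y) ^ DIM('a) \<le> vol (minkowski_sum (box a b) (box c d))"
proof -
  have "(x + y) ^ DIM('a) \<le> (\<Prod>i\<in>Basis. (b - a) \<bullet> i + (d - c) \<bullet> i)"
    using ne xy x[symmetric] y[symmetric] measure_box_eq_prod[OF ne(1)] measure_box_eq_prod[OF ne(2)]
    by (intro power_add_le_prod_add) (auto simp: box_ne_empty inner_diff_left)
  also have "\<dots> = (\<Prod>i\<in>Basis. ((b + d) - (a + c)) \<bullet> i)"
    by (intro prod.cong) (auto simp: inner_diff_left inner_add_left)
  also have "\<dots> = vol (box (a + c) (b + d))"
    using ne by (subst measure_box_eq_prod) (auto simp: box_ne_empty inner_add_left add_strict_mono)
  also have "\<dots> \<le> vol (minkowski_sum (box a b) (box c d))"
    by (intro measure_mono_fmeasurable box_add_subset_minkowski_sum ne lmeasurable_minkowski_sum_open) auto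
  finally show ?thesis .
qed

text \<open>Open boxes are cut by a coordinate hyperplane into open boxes, at the cost of a null
  set. Empty boxes are excluded so that the number of boxes drops as soon as one of them lies beyond
  the cut; the induction runs on this number.\<close>

definition box_family :: "'a::euclidean_space set set \<Rightarrow> bool" where
  "box_family \<A> \<longleftrightarrow> finite \<A> \<and> (\<forall>X\<in>\<A>. X \<noteq> {} \<and> (\<exists>a b. X = box a b)) \<and> disjoint \<A>"

lemma box_family_open: "box_family \<A> \<Longrightarrow> open (\<Union>\<A>)"
  unfolding box_family_def by (auto intro!: open_Union)

lemma box_family_bounded: "box_family \<A> \<Longrightarrow> bounded (\<Union>\<A>)"
  unfolding box_family_def by (auto intro!: bounded_Union)

lemma box_family_restrict:
  fixes H :: "'a::euclidean_space set"
  assumes A: "box_family \<A>" and H: "\<And>a b. \<exists>c d. box a b \<inter> H = box c d"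
  shows "box_family ((\<lambda>X. X \<inter> H) ` \<A> - {{}})"
    "\<Union>((\<lambda>X. X \<inter> H) ` \<A> - {{}}) = \<Union>\<A> \<inter> H"
    "card ((\<lambda>X. X \<inter> H) ` \<A> - {{}}) \<le> card \<A>"
    "\<And>X. X \<in> \<A> \<Longrightarrow> X \<inter> H = {} \<Longrightarrow> card ((\<lambda>X. X \<inter> H) ` \<A> - {{}}) < card \<A>"
proof -
  have fin: "finite \<A>" using A by (simp add: box_family_def)
  show "box_family ((\<lambda>X. X \<inter> H) ` \<A> - {{}})"
    unfolding box_family_def
  proof (intro conjI ballI)
    show "finite ((\<lambda>X. X \<inter> H) ` \<A> - {{}})" using fin by simp
    show "disjoint ((\<lambda>X. X \<inter> H) ` \<A> - {{}})"
    proof (rule disjointI)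
      fix Y Z assume "Y \<in> (\<lambda>X. X \<inter> H) ` \<A> - {{}}" "Z \<in> (\<lambda>X. X \<inter> H) ` \<A> - {{}}" "Y \<noteq> Z"
      then obtain Y' Z' where "Y' \<in> \<A>" "Z' \<in> \<A>" "Y' \<noteq> Z'" "Y = Y' \<inter> H" "Z = Z' \<inter> H" by auto
      moreover have "disjoint \<A>" using A by (simp add: box_family_def)
      ultimately show "Y \<inter> Z = {}" using disjointD[of \<A> Y' Z'] by auto
    qed
    fix Y assume Y: "Y \<in> (\<lambda>X. X \<inter> H) ` \<A> - {{}}"
    then show "Y \<noteq> {}" by simp
    obtain X where "X \<in> \<A>" "Y = X \<inter> H" using Y by auto
    moreover then obtain a b where "X = box a b" using A unfolding box_family_def by blast
    ultimately show "\<exists>a b. Y = box a b" using H by simp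
  qed
  show "\<Union>((\<lambda>X. X \<inter> H) ` \<A> - {{}}) = \<Union>\<A> \<inter> H" by auto
  show "card ((\<lambda>X. X \<inter> H) ` \<A> - {{}}) \<le> card \<A>"
    by (meson card_Diff1_le card_image_le fin finite_imageI le_trans)
  fix X assume X: "X \<in> \<A>" "X \<inter> H = {}"
  have "(\<lambda>X. X \<inter> H) ` \<A> - {{}} \<subseteq> (\<lambda>X. X \<inter> H) ` (\<A> - {X})" using X by auto
  then have "card ((\<lambda>X. X \<inter> H) ` \<A> - {{}}) \<le> card (\<A> - {X})"
    by (meson card_image_le card_mono fin finite_Diff finite_imageI le_trans)
  then show "card ((\<lambda>X. X \<inter> H) ` \<A> - {{}}) < card \<A>"
    using X fin by (metis card_Diff1_less order.strict_trans1)
qed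

lemma box_Int_open_halfspace:
  fixes i :: "'a::euclidean_space"
  assumes i: "i \<in> Basis"
  shows "\<exists>c d. box a b \<inter> {x. x \<bullet> i < t} = box c d" "\<exists>c d. box a b \<inter> {x. t < x \<bullet> i} = box c d"
proof -
  have "box a b \<inter> {x. x \<bullet> i < t} = box a (b + (min (b \<bullet> i) t - b \<bullet> i) *\<^sub>R i)"
    using i by (auto simp: mem_box inner_add_left inner_Basis split: if_splits)
  then show "\<exists>c d. box a b \<inter> {x. x \<bullet> i < t} = box c d" by blast
  have "box a b \<inter> {x. t < x \<bullet> i} = box (a + (max (a \<bullet> i) t - a \<bullet> i) *\<^sub>R i) b"
    using i by (auto simp: mem_box inner_add_left inner_Basis split: if_splits)
  then show "\<exists>c d. box a b \<inter> {x. t < x \<bullet> i} = box c d" by blast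
qed

lemma disjoint_boxes_separated:
  fixes a b c d :: "'a::euclidean_space"
  assumes "box a b \<noteq> {}" "box c d \<noteq> {}" "box a b \<inter> box c d = {}"
  obtains i where "i \<in> Basis" "b \<bullet> i \<le> c \<bullet> i \<or> d \<bullet> i \<le> a \<bullet> i"
  using assms disjoint_interval(4)[of a b c d] by (auto simp: box_ne_empty not_less)

text \<open>The slab estimate makes the volume below level \<open>t\<close> Lipschitz in
  \<open>t\<close>, which allows cuts in a prescribed ratio by the intermediate value
  theorem.\<close>

lemma measure_Int_halfspace_continuous:
  fixes u :: "'a::euclidean_space"
  assumes u: "norm u = 1" and W: "W \<in> lmeasurable" "W \<subseteq> cball 0 R"
  shows "continuous_on UNIV (\<lambda>t. vol (W \<inter> {x. u \<bullet> x \<le> t}))"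
proof -
  define C where "C = vol (cball (0::'a) (R + 1))"
  have H: "W \<inter> {x. u \<bullet> x \<le> t} \<in> lmeasurable" for t
    using W(1) by (intro fmeasurable_Int_fmeasurable) (auto intro: borel_closed closed_halfspace_le)
  have step: "\<bar>vol (W \<inter> {x. u \<bullet> x \<le> t}) - vol (W \<inter> {x. u \<bullet> x \<le> s})\<bar> \<le> C * (t - s)"
    if "s \<le> t" for s t
  proof -
    have "vol (W \<inter> {x. u \<bullet> x \<le> s}) \<le> vol (W \<inter> {x. u \<bullet> x \<le> t})"
      using that by (intro measure_mono_fmeasurable H fmeasurableD) auto
    moreover have "vol (W \<inter> {x. u \<bullet> x \<le> t}) \<le> vol (W \<inter> {x. u \<bullet> x \<le> s} \<union> {x \<in> cball 0 R. s < u \<bullet> x \<and> u \<bullet> x \<le> s + (t - s)})"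
      using W(2) by (intro measure_mono_fmeasurable fmeasurableD H fmeasurable.Un lmeasurable_slab) auto
    moreover have "\<dots> \<le> vol (W \<inter> {x. u \<bullet> x \<le> s}) + vol {x \<in> cball 0 R. s < u \<bullet> x \<and> u \<bullet> x \<le> s + (t - s)}"
      by (intro measure_Un_le fmeasurableD H lmeasurable_slab)
    moreover have "vol {x \<in> cball 0 R. s < u \<bullet> x \<and> u \<bullet> x \<le> s + (t - s)} \<le> C * (t - s)"
      unfolding C_def using that by (intro measure_slab_le u) simp
    ultimately show ?thesis by linarith
  qed
  have "dist (vol (W \<inter> {x. u \<bullet> x \<le> s})) (vol (W \<inter> {x. u \<bullet> x \<le> t})) \<le> C * dist s t" for s t
    using step[of s t] step[of t s] by (cases "s \<le> t") (auto simp: dist_real_def abs_minus_commute)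
  moreover have "C \<ge> 0" by (simp add: C_def)
  ultimately have "C-lipschitz_on UNIV (\<lambda>t. vol (W \<inter> {x. u \<bullet> x \<le> t}))"
    by (intro lipschitz_onI) auto
  then show ?thesis by (rule lipschitz_on_continuous_on)
qed

lemma measure_Int_halfspace_attains:
  fixes u :: "'a::euclidean_space"
  assumes u: "norm u = 1" and W: "W \<in> lmeasurable" "bounded W"
    and c: "0 \<le> c" "c \<le> vol W"
  obtains t where "vol (W \<inter> {x. u \<bullet> x \<le> t}) = c"
proof -
  obtain R where R: "R > 0" "W \<subseteq> cball 0 R" using W(2) by (auto simp: bounded_pos subset_eq)
  let ?f = "\<lambda>t. vol (W \<inter> {x. u \<bullet> x \<le> t})"
  have ux: "-R \<le> u \<bullet> x" "u \<bullet> x \<le> R" if "x \<in> W" for x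
    using subsetD[OF R(2) that] Cauchy_Schwarz_ineq2[of u x] u by auto
  have "W \<inter> {x. u \<bullet> x \<le> -R - 1} = {}" "W \<inter> {x. u \<bullet> x \<le> R} = W" using ux by force+
  then have "?f (-R - 1) = 0" "?f R = vol W" by (metis measure_empty, metis)
  then obtain t where "?f t = c"
    using IVT'[of ?f "-R - 1" c R] c R(1) continuous_on_subset[OF measure_Int_halfspace_continuous[OF u W(1) R(2)]] by auto
  then show thesis by (rule that)
qed

lemma measure_split_hyperplane:
  fixes u :: "'a::euclidean_space"
  assumes u: "u \<noteq> 0" and W: "W \<in> lmeasurable"
  shows "vol (W \<inter> {x. u \<bullet> x < t}) = vol (W \<inter> {x. u \<bullet> x \<le> t})" (is ?A)
    "vol (W \<inter> {x. t < u \<bullet> x}) = vol W - vol (W \<inter> {x. u \<bullet> x \<le> t})" (is ?B)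
    "vol (W \<inter> {x. t \<le> u \<bullet> x}) = vol W - vol (W \<inter> {x. u \<bullet> x \<le> t})" (is ?C)
proof -
  have neg: "negligible {x. u \<bullet> x = t}" using u by (intro negligible_hyperplane) simp
  have L: "W \<inter> {x. u \<bullet> x < t} \<in> lmeasurable" "W \<inter> {x. u \<bullet> x \<le> t} \<in> lmeasurable" "W \<inter> {x. t < u \<bullet> x} \<in> lmeasurable"
    using W by (auto intro!: fmeasurable_Int_fmeasurable intro: borel_closed closed_halfspace_le borel_open open_halfspace_lt open_halfspace_gt)
  show ?A
    by (rule measure_negligible_symdiff[OF L(2)]) (rule negligible_subset[OF neg], auto)
  have "vol W = vol ((W \<inter> {x. u \<bullet> x \<le> t}) \<union> (W \<inter> {x. t < u \<bullet> x}))"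
    by (rule arg_cong[where f = "vol"]) auto
  also have "\<dots> = vol (W \<inter> {x. u \<bullet> x \<le> t}) + vol (W \<inter> {x. t < u \<bullet> x})"
    using L by (intro measure_Un2[THEN trans]) (auto simp: fmeasurable_def intro!: arg_cong[where f = "vol"])
  finally show B: ?B by simp
  have "vol (W \<inter> {x. t \<le> u \<bullet> x}) = vol (W \<inter> {x. t < u \<bullet> x})"
    by (rule measure_negligible_symdiff[OF L(3)]) (rule negligible_subset[OF neg], auto)
  with B show ?C by simp
qed

lemma power_root_exists:
  fixes c :: real assumes "c \<ge> 0" "n > 0" obtains a where "a \<ge> 0" "a ^ n = c"
  using assms real_root_ge_zero real_root_pow_pos2 by metis

text \<open>Sums of the lower parts lie below level \<open>s + t\<close> and sums of the upper parts
  above it, so the two Minkowski sums are disjoint.\<close>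

lemma measure_minkowski_sum_split:
  fixes u :: "'a::euclidean_space"
  assumes A: "open A" "bounded A" and B: "open B" "bounded B"
  shows "vol (minkowski_sum (A \<inter> {x. u \<bullet> x < s}) (B \<inter> {x. u \<bullet> x < t}))
       + vol (minkowski_sum (A \<inter> {x. s < u \<bullet> x}) (B \<inter> {x. t < u \<bullet> x}))
       \<le> vol (minkowski_sum A B)"
proof -
  let ?L = "minkowski_sum (A \<inter> {x. u \<bullet> x < s}) (B \<inter> {x. u \<bullet> x < t})"
  let ?U = "minkowski_sum (A \<inter> {x. s < u \<bullet> x}) (B \<inter> {x. t < u \<bullet> x})"
  have L: "?L \<in> lmeasurable" "?U \<in> lmeasurable" "minkowski_sum A B \<in> lmeasurable"
    using A B by (auto intro!: lmeasurable_minkowski_sum_open open_Int open_halfspace_lt open_halfspace_gt bounded_Int)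
  have "?L \<inter> ?U = {}" 
  proof (rule equals0I)
    fix z assume z: "z \<in> ?L \<inter> ?U"
    obtain x y where "u \<bullet> x < s" "u \<bullet> y < t" "z = x + y" using z by (auto elim!: minkowski_sumE)
    then have "u \<bullet> z < s + t" by (simp add: inner_add_right)
    moreover obtain x y where "s < u \<bullet> x" "t < u \<bullet> y" "z = x + y" using z by (auto elim!: minkowski_sumE)
    then have "s + t < u \<bullet> z" by (simp add: inner_add_right)
    ultimately show False by simp
  qed
  then have "vol ?L + vol ?U = vol (?L \<union> ?U)"
    using L by (simp add: measure_Un3)
  also have "\<dots> \<le> vol (minkowski_sum A B)"
    using L by (intro measure_mono_fmeasurable fmeasurableD fmeasurable.Un) (auto intro: subsetD[OF minkowski_sum_mono, rotated 2])
  finally show ?thesis .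
qed

text \<open>The induction step in asymmetric form: both parts of \<open>\<A>\<close> have fewer
  boxes, since each loses a box on the far side of the cut, and the parts of \<open>\<B>\<close>
  have no more than \<open>\<B>\<close>. As a separate lemma it can be applied with the two families
  exchanged.\<close>

lemma brunn_minkowski_cut:
  fixes \<A> \<B> :: "'a::euclidean_space set set"
  assumes IH: "\<And>(\<A>'::'a set set) \<B>' x y. card \<A>' < card \<A> \<Longrightarrow> card \<B>' \<le> card \<B> \<Longrightarrow> box_family \<A>' \<Longrightarrow> box_family \<B>' \<Longrightarrow>
      \<A>' \<noteq> {} \<Longrightarrow> \<B>' \<noteq> {} \<Longrightarrow> x \<ge> 0 \<Longrightarrow> y \<ge> 0 \<Longrightarrow>
      vol (\<Union>\<A>') = x ^ DIM('a) \<Longrightarrow> vol (\<Union>\<B>') = y ^ DIM('a) \<Longrightarrow>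
      (x + y) ^ DIM('a) \<le> vol (minkowski_sum (\<Union>\<A>') (\<Union>\<B>'))"
    and A: "box_family \<A>" and B: "box_family \<B>" "\<B> \<noteq> {}" and xy: "x \<ge> 0" "y \<ge> 0"
    and x: "vol (\<Union>\<A>) = x ^ DIM('a)" and y: "vol (\<Union>\<B>) = y ^ DIM('a)"
    and XY: "X \<in> \<A>" "Y \<in> \<A>" "X \<noteq> Y"
  shows "(x + y) ^ DIM('a) \<le> vol (minkowski_sum (\<Union>\<A>) (\<Union>\<B>))"
proof -
  let ?n = "DIM('a)"
  have n: "?n > 0" by simp
  obtain a b c d where box: "X = box a b" "Y = box c d" "X \<noteq> {}" "Y \<noteq> {}"
    using A XY unfolding box_family_def by meson
  have "X \<inter> Y = {}" using A XY unfolding box_family_def by (meson disjointD)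
  then obtain i where i: "i \<in> Basis" "b \<bullet> i \<le> c \<bullet> i \<or> d \<bullet> i \<le> a \<bullet> i"
    using disjoint_boxes_separated box by metis
  have "\<exists>s X Y. X \<in> \<A> \<and> Y \<in> \<A> \<and> X \<subseteq> {x. i \<bullet> x < s} \<and> Y \<subseteq> {x. s < i \<bullet> x}"
    using i(2)
  proof
    assume "b \<bullet> i \<le> c \<bullet> i"
    then have "X \<subseteq> {x. i \<bullet> x < b \<bullet> i} \<and> Y \<subseteq> {x. b \<bullet> i < i \<bullet> x}"
      using i(1) unfolding box by (fastforce simp: mem_box inner_commute)
    then show ?thesis using XY by blast
  next
    assume "d \<bullet> i \<le> a \<bullet> i"
    then have "Y \<subseteq> {x. i \<bullet> x < d \<bullet> i} \<and> X \<subseteq> {x. d \<bullet> i < i \<bullet> x}"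
      using i(1) unfolding box by (fastforce simp: mem_box inner_commute)
    then show ?thesis using XY by blast
  qed
  then obtain s X Y where s: "X \<in> \<A>" "Y \<in> \<A>" "X \<subseteq> {x. i \<bullet> x < s}" "Y \<subseteq> {x. s < i \<bullet> x}" by blast
  have hs: "\<exists>c d. box a b \<inter> {x. i \<bullet> x < t} = box c d" "\<exists>c d. box a b \<inter> {x. t < i \<bullet> x} = box c d" for t a b
    using box_Int_open_halfspace[OF i(1)] by (simp_all add: inner_commute[of i])
  have ne: "\<And>X. X \<in> \<A> \<Longrightarrow> X \<noteq> {}" using A by (simp add: box_family_def)
  let ?lo = "\<lambda>\<C> t. (\<lambda>X. X \<inter> {x. i \<bullet> x < t}) ` \<C> - {{}}" and ?hi = "\<lambda>\<C> t. (\<lambda>X. X \<inter> {x. t < i \<bullet> x}) ` \<C> - {{}}"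
  note lo = box_family_restrict[OF _ hs(1)] and hi = box_family_restrict[OF _ hs(2)]
  have i1: "norm i = 1" "i \<noteq> 0" using i(1) by auto
  have meas: "\<Union>\<C> \<in> lmeasurable" if "box_family \<C>" for \<C> :: "'a set set"
    using that by (intro lmeasurable_open box_family_open box_family_bounded)
  have pos: "vol (\<Union>\<C>) > 0" if "box_family \<C>" "\<C> \<noteq> {}" for \<C> :: "'a set set"
  proof -
    have "open (\<Union>\<C>)" "\<Union>\<C> \<noteq> {}" using that box_family_open by (auto simp: box_family_def)
    then have "\<not> negligible (\<Union>\<C>)" using open_not_negligible by blast
    then show ?thesis using meas[OF that(1)] by (simp add: negligible_iff_measure0 zero_less_measure_iff)
  qed
  have neL: "?lo \<A> s \<noteq> {}" "?hi \<A> s \<noteq> {}" using s ne by blast+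
  have cardL: "card (?lo \<A> s) < card \<A>" by (rule lo(4)[OF A s(2)]) (use s(4) in force)
  have cardU: "card (?hi \<A> s) < card \<A>" by (rule hi(4)[OF A s(1)]) (use s(3) in force)
  obtain xl where xl: "xl \<ge> 0" "xl ^ ?n = vol (\<Union>(?lo \<A> s))"
    using power_root_exists[OF measure_nonneg n] by metis
  obtain xu where xu: "xu \<ge> 0" "xu ^ ?n = vol (\<Union>(?hi \<A> s))"
    using power_root_exists[OF measure_nonneg n] by metis
  have sum: "xl ^ ?n + xu ^ ?n = x ^ ?n"
    unfolding xl(2) xu(2) lo(2)[OF A] hi(2)[OF A] measure_split_hyperplane(1,2)[OF i1(2) meas[OF A]] x by simp
  have pow: "x ^ ?n > 0" "y ^ ?n > 0" "xl ^ ?n > 0" "xu ^ ?n > 0"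
    using pos[OF A] pos[OF B] pos[OF lo(1)[OF A] neL(1)] pos[OF hi(1)[OF A] neL(2)] XY x y xl xu by auto
  then have gt: "x > 0" "y > 0" "xl > 0" "xu > 0"
    using xy xl(1) xu(1) n by (metis less_eq_real_def power_0_left less_irrefl neq0_conv)+
  have "xl ^ ?n \<le> x ^ ?n" using sum pow by linarith
  then have le: "(y * xl / x) ^ ?n \<le> y ^ ?n"
    using pow by (simp add: power_mult_distrib power_divide divide_simps)
  \<comment> \<open>The cut of \<open>\<B>\<close> is placed so that the same fraction
    \<open>(xl / x) ^ ?n\<close> of the volume lies below it as for \<open>\<A>\<close>.\<close>
  obtain t where t: "vol (\<Union>\<B> \<inter> {x. i \<bullet> x \<le> t}) = (y * xl / x) ^ ?n"
    using measure_Int_halfspace_attains[OF i1(1) meas[OF B(1)] box_family_bounded[OF B(1)], of "(y * xl / x) ^ ?n"] le gt y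
    by auto
  have ml: "vol (\<Union>(?lo \<B> t)) = (y * xl / x) ^ ?n"
    unfolding lo(2)[OF B(1)] measure_split_hyperplane(1)[OF i1(2) meas[OF B(1)]] t ..
  have mu: "vol (\<Union>(?hi \<B> t)) = (y * xu / x) ^ ?n"
  proof -
    have "x ^ ?n - xl ^ ?n = xu ^ ?n" using sum by simp
    then have "y ^ ?n * x ^ ?n - y ^ ?n * xl ^ ?n = y ^ ?n * xu ^ ?n" by (simp add: right_diff_distrib[symmetric])
    then have "y ^ ?n - y ^ ?n * xl ^ ?n / x ^ ?n = y ^ ?n * xu ^ ?n / x ^ ?n"
      using pow(1) by (metis diff_divide_distrib less_irrefl nonzero_mult_div_cancel_right)
    then show ?thesis
      unfolding hi(2)[OF B(1)] measure_split_hyperplane(2)[OF i1(2) meas[OF B(1)]] t y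
      by (simp add: power_mult_distrib power_divide)
  qed
  have neB: "?lo \<B> t \<noteq> {}" "?hi \<B> t \<noteq> {}"
  proof -
    have "vol (\<Union>(?lo \<B> t)) > 0" "vol (\<Union>(?hi \<B> t)) > 0"
      unfolding ml mu using gt by simp_all
    then show "?lo \<B> t \<noteq> {}" "?hi \<B> t \<noteq> {}" by (metis Union_empty less_irrefl measure_empty)+
  qed
  \<comment> \<open>With equal ratios both pairs of roots are scaled by the same factor
    \<open>1 + y / x\<close>, so the two lower bounds add up to exactly
    \<open>(x + y) ^ ?n\<close>.\<close>
  have sc: "(z + y * z / x) ^ ?n = z ^ ?n * (1 + y / x) ^ ?n" for z
    by (simp add: power_mult_distrib[symmetric] algebra_simps)
  have "(x + y) ^ ?n = x ^ ?n * (1 + y / x) ^ ?n"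
    using gt by (simp add: power_mult_distrib[symmetric] algebra_simps)
  also have "\<dots> = (xl + y * xl / x) ^ ?n + (xu + y * xu / x) ^ ?n"
    unfolding sc sum[symmetric] by (simp add: algebra_simps)
  also have "\<dots> \<le> vol (minkowski_sum (\<Union>(?lo \<A> s)) (\<Union>(?lo \<B> t))) + vol (minkowski_sum (\<Union>(?hi \<A> s)) (\<Union>(?hi \<B> t)))"
    by (intro add_mono IH cardL cardU lo(1)[OF A] lo(1)[OF B(1)] hi(1)[OF A] hi(1)[OF B(1)] lo(3)[OF B(1)] hi(3)[OF B(1)] neL neB xl(1) xu(1) ml mu xl(2)[symmetric] xu(2)[symmetric])
      (use gt in auto)
  also have "\<dots> \<le> vol (minkowski_sum (\<Union>\<A>) (\<Union>\<B>))"
    unfolding lo(2)[OF A] hi(2)[OF A] lo(2)[OF B(1)] hi(2)[OF B(1)]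
    by (intro measure_minkowski_sum_split box_family_open box_family_bounded A B)
  finally show ?thesis .
qed

text \<open>
  Hadwiger and Ohmann: cut one family by a coordinate hyperplane separating two of its boxes and
  the other one by a parallel hyperplane in the same volume ratio.
\<close>

lemma brunn_minkowski_box_families:
  fixes \<A> \<B> :: "'a::euclidean_space set set"
  assumes "box_family \<A>" "box_family \<B>" "\<A> \<noteq> {}" "\<B> \<noteq> {}" "x \<ge> 0" "y \<ge> 0"
    and "vol (\<Union>\<A>) = x ^ DIM('a)" "vol (\<Union>\<B>) = y ^ DIM('a)"
  shows "(x + y) ^ DIM('a) \<le> vol (minkowski_sum (\<Union>\<A>) (\<Union>\<B>))"
  using assms
proof (induction "card \<A> + card \<B>" arbitrary: \<A> \<B> x y rule: less_induct)
  case less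
  consider X Y where "X \<in> \<A>" "Y \<in> \<A>" "X \<noteq> Y" | X Y where "X \<in> \<B>" "Y \<in> \<B>" "X \<noteq> Y"
    | X Y where "\<A> = {X}" "\<B> = {Y}"
    using less.prems(3,4) by (metis insertI1 is_singletonI' is_singleton_the_elem)
  then show ?case
  proof cases
    case 1
    show ?thesis by (rule brunn_minkowski_cut[OF _ less.prems(1,2,4-8) 1]) (rule less.hyps; simp)
  next
    case 2
    have "(y + x) ^ DIM('a) \<le> vol (minkowski_sum (\<Union>\<B>) (\<Union>\<A>))"
    proof (rule brunn_minkowski_cut[OF _ less.prems(2,1,3,6,5,8,7) 2])
      fix \<A>' \<B>' :: "'a set set" and x y :: real
      assume "card \<A>' < card \<B>" "card \<B>' \<le> card \<A>" "box_family \<A>'" "box_family \<B>'" "\<A>' \<noteq> {}" "\<B>' \<noteq> {}" "x \<ge> 0" "y \<ge> 0"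
        "vol (\<Union>\<A>') = x ^ DIM('a)" "vol (\<Union>\<B>') = y ^ DIM('a)"
      then show "(x + y) ^ DIM('a) \<le> vol (minkowski_sum (\<Union>\<A>') (\<Union>\<B>'))"
        by (intro less.hyps) simp_all
    qed
    then show ?thesis by (simp add: add.commute minkowski_sum_commute)
  next
    case 3
    have "\<exists>a b c d. X = box a b \<and> Y = box c d \<and> X \<noteq> {} \<and> Y \<noteq> {}"
      using less.prems(1,2) unfolding 3 box_family_def by auto
    then show ?thesis
      using less.prems(5-8) unfolding 3 by (auto intro!: brunn_minkowski_boxes)
  qed
qed

section \<open>From boxes to open sets and convex bodies\<close>

lemma open_box_family_approx:
  fixes U :: "'a::euclidean_space set"
  assumes U: "open U" "bounded U" "U \<noteq> {}" and e: "e > 0"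
  obtains \<A> where "box_family \<A>" "\<A> \<noteq> {}" "\<Union>\<A> \<subseteq> U" "vol U - e < vol (\<Union>\<A>)"
proof -
  obtain a where a: "U \<subseteq> cbox (-a) a" using bounded_subset_cbox_symmetric[OF U(2)] by blast
  have ne: "box (-a) a \<noteq> {}" 
  proof -
    have "interior U \<subseteq> interior (cbox (-a) a)" using a by (rule interior_mono)
    then show ?thesis using U by (auto simp: interior_open)
  qed
  \<comment> \<open>A gauge whose neighbourhoods of points of \<open>U\<close> stay inside
    \<open>U\<close>: the covering lemma then yields countably many non-overlapping closed boxes
    with union \<open>U\<close>.\<close>
  have "\<forall>x. \<exists>V. x \<in> V \<and> open V \<and> (x \<in> U \<longrightarrow> V \<subseteq> U)" using U(1) by blast
  then obtain g where g: "\<And>x. x \<in> g x" "\<And>x. open (g x)" "\<And>x. x \<in> U \<Longrightarrow> g x \<subseteq> U" by metis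
  obtain \<D> where D: "countable \<D>" "\<And>K. K \<in> \<D> \<Longrightarrow> interior K \<noteq> {} \<and> (\<exists>c d. K = cbox c d)"
    "pairwise (\<lambda>A B. interior A \<inter> interior B = {}) \<D>"
    "\<And>K. K \<in> \<D> \<Longrightarrow> \<exists>x \<in> U \<inter> K. K \<subseteq> g x" "U \<subseteq> \<Union>\<D>"
    by (rule covering_lemma[OF a ne, of g]) (auto simp: gauge_def g intro: that)
  have DU: "K \<subseteq> U" if "K \<in> \<D>" for K using D(4)[OF that] g(3) by blast
  have UD: "U = \<Union>\<D>" using D(5) DU by blast
  have Dne: "\<D> \<noteq> {}" using UD U(3) by auto
  define f where "f = from_nat_into \<D>"
  have f: "range f = \<D>" unfolding f_def using Dne D(1) by (rule range_from_nat_into)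
  have Kl: "K \<in> lmeasurable" if "K \<in> \<D>" for K using D(2)[OF that] by auto
  have "(\<lambda>n. vol (\<Union>k\<le>n. f k)) \<longlonglongrightarrow> vol (\<Union>n. \<Union>k\<le>n. f k)"
  proof (rule Lim_measure_incseq)
    show "range (\<lambda>n. \<Union>k\<le>n. f k) \<subseteq> sets lebesgue"
      using f Kl by (auto intro!: sets.finite_UN fmeasurableD)
    show "incseq (\<lambda>n. \<Union>k\<le>n. f k)" by (force simp: incseq_def)
    have "emeasure lebesgue (\<Union>n. \<Union>k\<le>n. f k) \<le> emeasure lebesgue U"
      using f DU U by (intro emeasure_mono fmeasurableD lmeasurable_open) auto
    also have "\<dots> < \<infinity>" using lmeasurable_open[OF U(2,1)] by (metis fmeasurableD2 infinity_ennreal_def less_top)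
    finally show "emeasure lebesgue (\<Union>n. \<Union>k\<le>n. f k) \<noteq> \<infinity>" by simp
  qed
  moreover have "(\<Union>n. \<Union>k\<le>n. f k) = U" using f UD by auto
  ultimately obtain n where n: "vol U - e < vol (\<Union>k\<le>n. f k)"
    using order_tendstoD(1)[of _ "vol U" sequentially "vol U - e"] e
    by (auto simp: eventually_sequentially)
  define \<A> where "\<A> = interior ` f ` {..n}"
  have fD: "f k \<in> \<D>" for k using f by auto
  have ibox: "\<exists>c d. f k = cbox c d \<and> interior (f k) = box c d \<and> interior (f k) \<noteq> {}" for k
    using D(2)[OF fD[of k]] interior_cbox by metis
  show thesis
  proof (rule that[of \<A>])
    show "box_family \<A>" unfolding box_family_def
    proof (intro conjI ballI disjointI)
      show "finite \<A>" by (simp add: \<A>_def)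
      fix X assume X: "X \<in> \<A>"
      then obtain j where j: "X = interior (f j)" by (auto simp: \<A>_def)
      obtain c d where "f j = cbox c d" "interior (f j) = box c d" "interior (f j) \<noteq> {}" using ibox[of j] by blast
      then show "X \<noteq> {}" "\<exists>a b. X = box a b" unfolding j by blast+
      fix Y assume Y: "Y \<in> \<A>" "X \<noteq> Y"
      then obtain j k where jk: "X = interior (f j)" "Y = interior (f k)" using X by (auto simp: \<A>_def)
      then have "f j \<noteq> f k" using Y(2) by auto
      then show "X \<inter> Y = {}" using pairwiseD[OF D(3) fD fD] jk by simp
    qed
    show "\<A> \<noteq> {}" by (auto simp: \<A>_def)
    show "\<Union>\<A> \<subseteq> U" using fD DU interior_subset by (fastforce simp: \<A>_def)
    have "vol (\<Union>k\<le>n. f k) = vol (\<Union>\<A>)"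
    proof (rule measure_negligible_symdiff[symmetric])
      show "(\<Union>k\<le>n. f k) \<in> lmeasurable" using Kl fD by auto
      have "(\<Union>k\<le>n. f k) - \<Union>\<A> \<union> (\<Union>\<A> - (\<Union>k\<le>n. f k)) \<subseteq> (\<Union>k\<le>n. f k - interior (f k))"
        unfolding \<A>_def using interior_subset by blast
      moreover have "negligible (f k - interior (f k))" for k
        using ibox[of k] by (metis interior_cbox negligible_frontier_interval)
      then have "negligible (\<Union>k\<le>n. f k - interior (f k))" by (intro negligible_Union) auto
      ultimately show "negligible ((\<Union>k\<le>n. f k) - \<Union>\<A> \<union> (\<Union>\<A> - (\<Union>k\<le>n. f k)))"
        by (rule negligible_subset[rotated])
    qed
    then show "vol U - e < vol (\<Union>\<A>)" using n by simp
  qed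
qed

lemma brunn_minkowski_open:
  fixes U W :: "'a::euclidean_space set"
  assumes U: "open U" "bounded U" "U \<noteq> {}" and W: "open W" "bounded W" "W \<noteq> {}"
    and xy: "x \<ge> 0" "y \<ge> 0" "vol U = x ^ DIM('a)" "vol W = y ^ DIM('a)"
  shows "(x + y) ^ DIM('a) \<le> vol (minkowski_sum U W)"
proof -
  let ?n = "DIM('a)" let ?M = "vol (minkowski_sum U W)"
  \<comment> \<open>\<open>a\<close> and \<open>b\<close> may be negative: \<open>root\<close> is
    increasing on the whole line, so the limit from below needs no case distinction for small
    volumes.\<close>
  have root: "root ?n a + root ?n b \<le> root ?n ?M"
    if ab: "a < vol U" "b < vol W" for a b
  proof -
    obtain \<A> where A: "box_family \<A>" "\<A> \<noteq> {}" "\<Union>\<A> \<subseteq> U" "a < vol (\<Union>\<A>)"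
      using open_box_family_approx[OF U, of "vol U - a"] ab by auto
    obtain \<B> where B: "box_family \<B>" "\<B> \<noteq> {}" "\<Union>\<B> \<subseteq> W" "b < vol (\<Union>\<B>)"
      using open_box_family_approx[OF W, of "vol W - b"] ab by auto
    define p q where "p = root ?n (vol (\<Union>\<A>))" and "q = root ?n (vol (\<Union>\<B>))"
    have "(p + q) ^ ?n \<le> vol (minkowski_sum (\<Union>\<A>) (\<Union>\<B>))"
      by (rule brunn_minkowski_box_families[OF A(1) B(1) A(2) B(2)]) (simp_all add: p_def q_def)
    also have "\<dots> \<le> ?M"
      by (intro measure_mono_fmeasurable minkowski_sum_mono A B fmeasurableD lmeasurable_minkowski_sum_open
        box_family_open box_family_bounded U W)
    finally have "root ?n ((p + q) ^ ?n) \<le> root ?n ?M" by simp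
    then have "p + q \<le> root ?n ?M" by (simp add: real_root_power_cancel p_def q_def)
    moreover have "root ?n a \<le> p" "root ?n b \<le> q" using A B by (auto simp: p_def q_def)
    ultimately show ?thesis by linarith
  qed
  have "x + y \<le> root ?n ?M"
  proof (rule tendsto_upperbound)
    show "((\<lambda>e. root ?n (x ^ ?n - e) + root ?n (y ^ ?n - e)) \<longlongrightarrow> x + y) (at_right 0)"
    proof -
      have "((\<lambda>e. root ?n (x ^ ?n - e) + root ?n (y ^ ?n - e)) \<longlongrightarrow> root ?n (x ^ ?n - 0) + root ?n (y ^ ?n - 0)) (at_right 0)"
        by (intro tendsto_intros)
      then show ?thesis using xy by (simp add: real_root_power_cancel)
    qed
    show "\<forall>\<^sub>F e in at_right 0. root ?n (x ^ ?n - e) + root ?n (y ^ ?n - e) \<le> root ?n ?M"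
      unfolding eventually_at_right_field using root xy by (intro exI[of _ 1]) auto
  qed simp
  then have "(x + y) ^ ?n \<le> root ?n ?M ^ ?n" using xy by (intro power_mono) auto
  then show ?thesis by simp
qed

lemma measure_pos_interior_nonempty:
  fixes A :: "'a::euclidean_space set"
  assumes "convex A" "vol A > 0" shows "interior A \<noteq> {}"
  using assms negligible_convex_interior[of A] negligible_imp_measure0[of A] by auto

lemma measure_minkowski_sum_ge:
  fixes A B :: "'a::euclidean_space set"
  assumes "a \<in> A" "B \<in> lmeasurable" "minkowski_sum A B \<in> lmeasurable"
  shows "vol B \<le> vol (minkowski_sum A B)"
proof -
  have "vol B = vol ((+) a ` B)" by (simp add: measure_translation)
  also have "\<dots> \<le> vol (minkowski_sum A B)"
    using assms by (intro measure_mono_fmeasurable) (auto intro: minkowski_sumI fmeasurableD measurable_translation)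
  finally show ?thesis .
qed

lemma compact_minkowski_sum: "compact A \<Longrightarrow> compact B \<Longrightarrow> compact (minkowski_sum A B)"
  unfolding minkowski_sum_def by (rule compact_sums)

text \<open>The frontier of a convex body is null, so the open case applies to the interiors; if one
  volume is zero, the sum contains a translate of the other body. Writing the volumes as powers
  keeps roots out of the statement.\<close>

theorem brunn_minkowski_convex:
  fixes A B :: "'a::euclidean_space set"
  assumes A: "compact A" "convex A" "A \<noteq> {}" and B: "compact B" "convex B" "B \<noteq> {}"
    and xy: "x \<ge> 0" "y \<ge> 0" "vol A = x ^ DIM('a)" "vol B = y ^ DIM('a)"
  shows "(x + y) ^ DIM('a) \<le> vol (minkowski_sum A B)"
proof -
  let ?n = "DIM('a)"
  have L: "A \<in> lmeasurable" "B \<in> lmeasurable" "minkowski_sum A B \<in> lmeasurable" "minkowski_sum B A \<in> lmeasurable"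
    using A B by (auto intro: lmeasurable_compact compact_minkowski_sum)
  consider "x = 0" | "y = 0" | "x > 0" "y > 0" using xy by linarith
  then show ?thesis
  proof cases
    case 1
    then show ?thesis using A(3) measure_minkowski_sum_ge L xy by (metis add_0 equals0I)
  next
    case 2
    then show ?thesis using B(3) measure_minkowski_sum_ge L xy by (metis add.right_neutral equals0I minkowski_sum_commute)
  next
    case 3
    have int: "vol (interior S) = vol S" if "compact S" "convex S" for S :: "'a set"
      using that by (intro measure_interior negligible_convex_frontier compact_imp_bounded)
    have pos: "vol A > 0" "vol B > 0" using 3 xy by simp_all
    have "(x + y) ^ ?n \<le> vol (minkowski_sum (interior A) (interior B))"
    proof (rule brunn_minkowski_open)
      show "interior A \<noteq> {}" "interior B \<noteq> {}"
        by (rule measure_pos_interior_nonempty[OF A(2) pos(1)], rule measure_pos_interior_nonempty[OF B(2) pos(2)])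
      show "vol (interior A) = x ^ ?n" "vol (interior B) = y ^ ?n"
        using int[OF A(1,2)] int[OF B(1,2)] xy(3,4) by simp_all
    qed (simp_all add: xy A B bounded_interior compact_imp_bounded)
    also have "\<dots> \<le> vol (minkowski_sum A B)"
    proof (rule measure_mono_fmeasurable)
      show "minkowski_sum (interior A) (interior B) \<in> sets lebesgue"
        using A B by (intro fmeasurableD lmeasurable_minkowski_sum_open open_interior bounded_interior compact_imp_bounded)
    qed (intro minkowski_sum_mono interior_subset, rule L(3))
    finally show ?thesis .
  qed
qed

section \<open>Convex bodies with minimal difference body\<close>

lemma lmeasurable_Int_halfspace:
  fixes A :: "'a::euclidean_space set"
  assumes "A \<in> lmeasurable" shows "A \<inter> {x. u \<bullet> x \<le> t} \<in> lmeasurable" "A \<inter> {x. t \<le> u \<bullet> x} \<in> lmeasurable"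
  using assms
  by (auto intro!: fmeasurable_Int_fmeasurable intro: borel_closed closed_halfspace_le closed_halfspace_ge)

text \<open>The segment from \<open>x0\<close> to \<open>x1\<close> passes through the open slab
  between the two levels. Interior points are dense in a convex body of positive volume, so the slab
  contains an open piece of \<open>A\<close>.\<close>

lemma measure_Int_halfspace_strict_mono:
  fixes A :: "'a::euclidean_space set"
  assumes A: "compact A" "convex A" "vol A > 0"
    and x: "x0 \<in> A" "x1 \<in> A" "u \<bullet> x0 \<le> s" "s < t" "t \<le> u \<bullet> x1"
  shows "vol (A \<inter> {x. u \<bullet> x \<le> s}) < vol (A \<inter> {x. u \<bullet> x \<le> t})"
proof -
  have L: "A \<in> lmeasurable" using A(1) by (rule lmeasurable_compact)
  note H = lmeasurable_Int_halfspace(1)[OF L]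
  define O' where "O' = interior A \<inter> {x. s < u \<bullet> x} \<inter> {x. u \<bullet> x < t}"
  have op: "open O'" unfolding O'_def by (intro open_Int open_halfspace_lt open_halfspace_gt open_interior)
  have "O' \<noteq> {}"
  proof -
    define \<theta> where "\<theta> = ((s + t) / 2 - u \<bullet> x0) / (u \<bullet> x1 - u \<bullet> x0)"
    have th: "0 \<le> \<theta>" "\<theta> \<le> 1" "\<theta> * (u \<bullet> x1 - u \<bullet> x0) = (s + t) / 2 - u \<bullet> x0"
      using x by (auto simp: \<theta>_def divide_simps)
    define z where "z = (1 - \<theta>) *\<^sub>R x0 + \<theta> *\<^sub>R x1"
    have zA: "z \<in> A" unfolding z_def using th by (intro convexD[OF A(2)] x) auto
    have "u \<bullet> z = u \<bullet> x0 + \<theta> * (u \<bullet> x1 - u \<bullet> x0)" by (simp add: z_def inner_add_right algebra_simps)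
    then have uz: "u \<bullet> z = (s + t) / 2" using th by simp
    have "closure (interior A) = closure A"
      using A measure_pos_interior_nonempty by (intro convex_closure_interior)
    then have "z \<in> closure (interior A)" using zA closure_subset by blast
    moreover have "open ({x. s < u \<bullet> x} \<inter> {x. u \<bullet> x < t})" "z \<in> {x. s < u \<bullet> x} \<inter> {x. u \<bullet> x < t}"
      using uz x by (auto intro!: open_halfspace_lt open_halfspace_gt)
    ultimately have "interior A \<inter> ({x. s < u \<bullet> x} \<inter> {x. u \<bullet> x < t}) \<noteq> {}"
      using closure_iff_nhds_not_empty[of z "interior A"] by blast
    then show ?thesis by (simp add: O'_def Int_assoc)
  qed
  moreover have OL: "O' \<in> lmeasurable"
    using op A(1) by (intro lmeasurable_open) (auto simp: O'_def intro: bounded_interior compact_imp_bounded bounded_Int)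
  ultimately have "vol O' > 0"
    using op open_not_negligible by (metis negligible_iff_measure0 zero_less_measure_iff)
  moreover have "vol (A \<inter> {x. u \<bullet> x \<le> s}) + vol O' = vol (A \<inter> {x. u \<bullet> x \<le> s} \<union> O')"
  proof -
    have "A \<inter> {x. u \<bullet> x \<le> s} \<inter> O' = {}" by (auto simp: O'_def)
    then show ?thesis using H OL by (simp add: measure_Un3)
  qed
  moreover have "\<dots> \<le> vol (A \<inter> {x. u \<bullet> x \<le> t})"
    using x interior_subset by (intro measure_mono_fmeasurable H fmeasurableD fmeasurable.Un OL) (auto simp: O'_def)
  ultimately show ?thesis by linarith
qed

text \<open>\<open>\<Phi>\<close> inverts the distribution function of the height. Its parameter is
  the root of the volume fraction, not the fraction itself, because Brunn-Minkowski adds roots of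
  volumes.\<close>

lemma convex_body_quantile:
  fixes A :: "'a::euclidean_space set"
  assumes A: "compact A" "convex A" "vol A > 0" and u: "norm u = 1"
    and x: "x0 \<in> A" "x1 \<in> A" "\<forall>x\<in>A. u \<bullet> x0 \<le> u \<bullet> x \<and> u \<bullet> x \<le> u \<bullet> x1"
  obtains \<Phi> :: "real \<Rightarrow> real" where "continuous_on {0..1} \<Phi>" "\<Phi> ` {0..1} = {u \<bullet> x0..u \<bullet> x1}"
    "\<Phi> 0 = u \<bullet> x0" "\<Phi> 1 = u \<bullet> x1"
    "\<And>y. 0 \<le> y \<Longrightarrow> y \<le> 1 \<Longrightarrow> vol (A \<inter> {x. u \<bullet> x \<le> \<Phi> y}) = vol A * y ^ DIM('a)"
proof -
  let ?n = "DIM('a)" and ?V = "vol A" and ?\<alpha> = "u \<bullet> x0" and ?\<beta> = "u \<bullet> x1"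
  have L: "A \<in> lmeasurable" using A(1) by (rule lmeasurable_compact)
  have u0: "u \<noteq> 0" using u by auto
  define F where "F t = vol (A \<inter> {x. u \<bullet> x \<le> t})" for t
  obtain R where R: "A \<subseteq> cball 0 R" using compact_imp_bounded[OF A(1)] by (auto simp: bounded_pos subset_eq)
  have contF: "continuous_on UNIV F" unfolding F_def by (rule measure_Int_halfspace_continuous[OF u L R])
  have F0: "F ?\<alpha> = 0"
  proof -
    have "negligible {x. u \<bullet> x = ?\<alpha>}" using u0 by (intro negligible_hyperplane) simp
    moreover have "A \<inter> {x. u \<bullet> x \<le> ?\<alpha>} \<subseteq> {x. u \<bullet> x = ?\<alpha>}" using x(3) by force
    ultimately show ?thesis unfolding F_def by (metis negligible_subset negligible_imp_measure0)
  qed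
  have F1: "F ?\<beta> = ?V"
  proof -
    have "A \<inter> {x. u \<bullet> x \<le> ?\<beta>} = A" using x(3) by force
    then show ?thesis by (simp add: F_def)
  qed
  define f where "f t = root ?n (F t / ?V)" for t
  have f: "f ?\<alpha> = 0" "f ?\<beta> = 1" using F0 F1 A(3) by (auto simp: f_def)
  have fn: "F t = ?V * f t ^ ?n" for t using A(3) by (simp add: f_def F_def)
  have contf: "continuous_on S f" for S
    unfolding f_def using continuous_on_subset[OF contF, of S] A(3) by (intro continuous_intros) auto
  have mono: "f s < f t" if "?\<alpha> \<le> s" "s < t" "t \<le> ?\<beta>" for s t
    using measure_Int_halfspace_strict_mono[OF A x(1,2) that] A(3) by (simp add: f_def F_def divide_strict_right_mono)
  have inj: "inj_on f {?\<alpha>..?\<beta>}"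
    using mono by (intro linorder_inj_onI) (auto, metis less_irrefl)
  have le: "?\<alpha> \<le> ?\<beta>" using x by blast
  have img: "f ` {?\<alpha>..?\<beta>} = {0..1}"
  proof
    show "f ` {?\<alpha>..?\<beta>} \<subseteq> {0..1}"
    proof
      fix y assume "y \<in> f ` {?\<alpha>..?\<beta>}"
      then obtain t where t: "?\<alpha> \<le> t" "t \<le> ?\<beta>" "y = f t" by auto
      then show "y \<in> {0..1}" using mono[of ?\<alpha> t] mono[of t ?\<beta>] f by (cases "t = ?\<alpha>"; cases "t = ?\<beta>") auto
    qed
    show "{0..1} \<subseteq> f ` {?\<alpha>..?\<beta>}"
    proof
      fix y :: real assume "y \<in> {0..1}"
      then obtain t where "?\<alpha> \<le> t" "t \<le> ?\<beta>" "f t = y"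
        using IVT'[of f ?\<alpha> y ?\<beta>] f le contf by auto
      then show "y \<in> f ` {?\<alpha>..?\<beta>}" by auto
    qed
  qed
  define \<Phi> where "\<Phi> = the_inv_into {?\<alpha>..?\<beta>} f"
  have \<Phi>: "\<Phi> (f t) = t" if "t \<in> {?\<alpha>..?\<beta>}" for t unfolding \<Phi>_def using that by (rule the_inv_into_f_f[OF inj])
  have f\<Phi>: "f (\<Phi> y) = y" if "y \<in> {0..1}" for y unfolding \<Phi>_def using that img by (intro f_the_inv_into_f[OF inj]) auto
  show thesis
  proof (rule that[of \<Phi>])
    show "continuous_on {0..1} \<Phi>"
      using continuous_on_inv[OF contf compact_Icc, of ?\<alpha> ?\<beta> \<Phi>] \<Phi> img by auto
    show "\<Phi> ` {0..1} = {?\<alpha>..?\<beta>}" unfolding img[symmetric] image_image using \<Phi> by force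
    show "\<Phi> 0 = ?\<alpha>" "\<Phi> 1 = ?\<beta>" using \<Phi>[of ?\<alpha>] \<Phi>[of ?\<beta>] f le by auto
    show "vol (A \<inter> {x. u \<bullet> x \<le> \<Phi> y}) = ?V * y ^ ?n" if "0 \<le> y" "y \<le> 1" for y
      using fn[of "\<Phi> y"] f\<Phi>[of y] that by (simp add: F_def)
  qed
qed

text \<open>At the points \<open>k * h\<close> and \<open>(k + 2) * h\<close> the inequality
  compares the increment of \<open>f\<close> over one step with that of \<open>g\<close> over the
  next. The sum telescopes, and the lag of one step vanishes as \<open>h\<close> tends to 0.\<close>

lemma midpoint_inequality_imp_increment_le:
  fixes f g :: "real \<Rightarrow> real"
  assumes f: "continuous_on {0..1} f" and g: "continuous_on {0..1} g"
    and ineq: "\<And>x y. x \<in> {0..1} \<Longrightarrow> y \<in> {0..1} \<Longrightarrow> f ((x + y) / 2) + g ((x + y) / 2) \<le> f x + g y"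
    and b: "0 < b" "b \<le> 1"
  shows "f b - f 0 \<le> g b - g 0"
proof -
  define h where "h n = b / real (Suc n)" for n
  have step: "f (real k * h n) - f 0 \<le> g (real (Suc k) * h n) - g (h n)" if "k \<le> n" for k n
    using that
  proof (induction k)
    case 0 then show ?case by simp
  next
    case (Suc k)
    have h: "h n > 0" "real (Suc (Suc k)) * h n \<le> 1"
    proof -
      show "h n > 0" using b by (simp add: h_def)
      have "real (Suc (Suc k)) * h n \<le> real (Suc n) * h n" using Suc.prems \<open>h n > 0\<close> by (intro mult_right_mono) auto
      also have "\<dots> = b" by (simp add: h_def)
      finally show "real (Suc (Suc k)) * h n \<le> 1" using b by simp
    qed
    have mid: "(real k * h n + real (Suc (Suc k)) * h n) / 2 = real (Suc k) * h n" by (simp add: field_simps)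
    have "real k * h n \<le> real (Suc (Suc k)) * h n" using h(1) by (intro mult_right_mono) auto
    then have "real k * h n \<le> 1" using h(2) by (rule order_trans)
    moreover have "0 \<le> real k * h n" "0 \<le> real (Suc (Suc k)) * h n" using h(1) by simp_all
    ultimately have "real k * h n \<in> {0..1}" "real (Suc (Suc k)) * h n \<in> {0..1}" using h(2) by simp_all
    from ineq[OF this] have "f (real (Suc k) * h n) - f (real k * h n) \<le> g (real (Suc (Suc k)) * h n) - g (real (Suc k) * h n)"
      unfolding mid by simp
    then show ?case using Suc by simp
  qed
  have h0: "h \<longlonglongrightarrow> 0" unfolding h_def by (rule lim_const_over_n[THEN LIMSEQ_Suc])
  have hb: "h n \<in> {0..1}" "b - h n \<in> {0..1}" for n
  proof -
    have "0 \<le> h n" "h n \<le> b" using b by (auto simp: h_def divide_simps)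
    then show "h n \<in> {0..1}" "b - h n \<in> {0..1}" using b by auto
  qed
  have "(\<lambda>n. f (b - h n) - f 0) \<longlonglongrightarrow> f (b - 0) - f 0"
    by (intro tendsto_diff tendsto_const continuous_on_tendsto_compose[OF f] h0) (use hb b in auto)
  moreover have "(\<lambda>n. g b - g (h n)) \<longlonglongrightarrow> g b - g 0"
    by (intro tendsto_diff tendsto_const continuous_on_tendsto_compose[OF g] h0) (use hb in auto)
  moreover have "f (b - h n) - f 0 \<le> g b - g (h n)" for n
  proof -
    have "real n * h n = b - h n" "real (Suc n) * h n = b" by (simp_all add: h_def field_simps)
    then show ?thesis using step[of n n] by simp
  qed
  ultimately show ?thesis by (intro LIMSEQ_le[of "\<lambda>n. f (b - h n) - f 0" _ "\<lambda>n. g b - g (h n)"]) auto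
qed

lemma measure_uminus_image:
  fixes S :: "'a::euclidean_space set"
  shows "vol (uminus ` S) = vol S"
  using measure_lebesgue_affine[of "-1" 0 S] by simp

text \<open>By \<open>sym\<close> the functions \<open>f\<close> and \<open>- f\<close> have the
  same distribution, hence the same mean.\<close>

lemma integral_symmetric_distribution:
  fixes f :: "'a \<Rightarrow> real"
  assumes M: "finite_measure M" and f: "integrable M f"
    and sym: "\<And>s. measure M {x \<in> space M. s < f x} = measure M {x \<in> space M. s < - f x}"
  shows "integral\<^sup>L M f = 0"
proof -
  interpret finite_measure M by (rule M)
  have [measurable]: "f \<in> borel_measurable M" using f by auto
  have "distr M borel f = distr M borel (\<lambda>x. - f x)"
  proof (rule measure_eqI_lessThan)
    have em: "emeasure (distr M borel g) {s<..} = ennreal (measure M {x \<in> space M. s < g x})"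
      if [measurable]: "g \<in> borel_measurable M" for g :: "'a \<Rightarrow> real" and s
    proof -
      have "g -` {s<..} \<inter> space M = {x \<in> space M. s < g x}" by auto
      then show ?thesis by (simp add: emeasure_distr emeasure_eq_measure)
    qed
    show "emeasure (distr M borel f) {s<..} = emeasure (distr M borel (\<lambda>x. - f x)) {s<..}" for s
      by (subst (1 2) em) (simp_all add: sym)
    show "emeasure (distr M borel f) {s<..} < \<infinity>" for s by (subst em) simp_all
  qed simp_all
  then have "integral\<^sup>L (distr M borel f) (\<lambda>y. y) = integral\<^sup>L (distr M borel (\<lambda>x. - f x)) (\<lambda>y. y)" by simp
  then have "integral\<^sup>L M f = integral\<^sup>L M (\<lambda>x. - f x)"
    by (subst (asm) (1 2) integral_distr) simp_all
  then show ?thesis by simp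
qed

text \<open>
  The Brunn-Minkowski inequality for halfspace sections shows that a convex body \<open>K\<close> and \<open>- K\<close>
  have the same quantiles in direction \<open>u\<close> up to an additive constant, as soon as \<open>K - K\<close> has the
  smallest possible volume. Comparing mean values identifies the constant by means of the centroid.
\<close>

lemma difference_body_equality:
  fixes K :: "'a::euclidean_space set"
  assumes K: "compact K" "convex K" "vol K > 0" and u: "norm u = 1"
    and x: "x0 \<in> K" "x1 \<in> K" "\<And>x. x \<in> K \<Longrightarrow> u \<bullet> x0 \<le> u \<bullet> x \<and> u \<bullet> x \<le> u \<bullet> x1"
    and eq: "vol (minkowski_sum K (uminus ` K)) \<le> 2 ^ DIM('a) * vol K"
  shows "(u \<bullet> x0 + u \<bullet> x1) * vol K = 2 * (u \<bullet> integral\<^sup>L (lebesgue_on K) (\<lambda>x. x))"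
proof -
  let ?n = "DIM('a)"
  define L where "L = uminus ` K"
  define M where "M = minkowski_sum K L"
  define V where "V = vol K"
  define \<alpha> \<beta> c where "\<alpha> = u \<bullet> x0" and "\<beta> = u \<bullet> x1" and "c = \<alpha> + \<beta>"
  have V: "V > 0" using K by (simp add: V_def)
  have L: "compact L" "convex L" unfolding L_def using K by (auto intro: compact_negations convex_negations)
  have mL: "vol L = V" by (simp add: L_def V_def measure_uminus_image)
  have "M = (\<Union>x\<in>K. \<Union>y\<in>L. {x + y})" unfolding M_def minkowski_sum_def by blast
  then have "convex M" using convex_sums[OF K(2) L(2)] by (rule ssubst)
  moreover have "compact M" unfolding M_def by (rule compact_minkowski_sum[OF K(1) L(1)])
  ultimately have M: "compact M" "convex M" by blast+
  have meas: "K \<in> lmeasurable" "L \<in> lmeasurable" "M \<in> lmeasurable" using K L M by (auto intro: lmeasurable_compact)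
  have xL: "- x1 \<in> L" "- x0 \<in> L" "\<And>x. x \<in> L \<Longrightarrow> u \<bullet> (- x1) \<le> u \<bullet> x \<and> u \<bullet> x \<le> u \<bullet> (- x0)"
    using x by (auto simp: L_def)
  have xb: "\<forall>x\<in>K. u \<bullet> x0 \<le> u \<bullet> x \<and> u \<bullet> x \<le> u \<bullet> x1" using x(3) by blast
  have xLb: "\<forall>x\<in>L. u \<bullet> (- x1) \<le> u \<bullet> x \<and> u \<bullet> x \<le> u \<bullet> (- x0)" using xL(3) by blast
  have xM: "x0 - x1 \<in> M" "x1 - x0 \<in> M" using x(1,2) minkowski_sumI[of _ K _ L] xL unfolding M_def by fastforce+
  obtain f where f: "continuous_on {0..1} f" "f ` {0..1} = {\<alpha>..\<beta>}" "f 0 = \<alpha>" "f 1 = \<beta>"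
    "\<And>y. 0 \<le> y \<Longrightarrow> y \<le> 1 \<Longrightarrow> vol (K \<inter> {x. u \<bullet> x \<le> f y}) = V * y ^ ?n"
    apply (rule convex_body_quantile[OF K u x(1,2) xb, folded V_def \<alpha>_def \<beta>_def])
    subgoal premises p for f by (rule that[of f]) (use p in simp_all)
    done
  have Lpos: "vol L > 0" using mL V by simp
  obtain g where g: "continuous_on {0..1} g" "g ` {0..1} = {-\<beta>..-\<alpha>}" "g 0 = -\<beta>" "g 1 = -\<alpha>"
    "\<And>y. 0 \<le> y \<Longrightarrow> y \<le> 1 \<Longrightarrow> vol (L \<inter> {x. u \<bullet> x \<le> g y}) = V * y ^ ?n"
    apply (rule convex_body_quantile[OF L Lpos u xL(1,2) xLb, unfolded mL inner_minus_right, folded \<alpha>_def \<beta>_def])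
    subgoal premises p for g by (rule that[of g]) (use p in simp_all)
    done
  have rng: "\<alpha> \<le> f y" "f y \<le> \<beta>" "-\<beta> \<le> g y" "g y \<le> -\<alpha>" if "y \<in> {0..1}" for y
    using that f(2) g(2) by (metis atLeastAtMost_iff image_eqI)+
  define r where "r = root ?n V"
  have r: "r \<ge> 0" "r ^ ?n = V" using V by (simp_all add: r_def)
  \<comment> \<open>Brunn-Minkowski with \<open>V\<close> as the unit of volume, so that quantile
    parameters take the place of the roots.\<close>
  have bm: "V * (a + b) ^ ?n \<le> vol (minkowski_sum A B)"
    if "compact A" "convex A" "A \<noteq> {}" "compact B" "convex B" "B \<noteq> {}" "a \<ge> 0" "b \<ge> 0"
      "vol A = V * a ^ ?n" "vol B = V * b ^ ?n" for A B :: "'a set" and a b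
    using brunn_minkowski_convex[OF that(1-6), of "r * a" "r * b"] that(7-) r
    by (simp add: power_mult_distrib distrib_left[symmetric] del: distrib_left_numeral)
  have hs: "convex {x. u \<bullet> x \<le> t}" "closed {x. u \<bullet> x \<le> t}" "convex {x. t \<le> u \<bullet> x}" "closed {x. t \<le> u \<bullet> x}" for t
    by (auto simp: convex_halfspace_le closed_halfspace_le convex_halfspace_ge closed_halfspace_ge)
  have lower: "V * (y + z) ^ ?n \<le> vol (M \<inter> {x. u \<bullet> x \<le> f y + g z})"
    if "y \<in> {0..1}" "z \<in> {0..1}" for y z
  proof -
    let ?A = "K \<inter> {x. u \<bullet> x \<le> f y}" and ?B = "L \<inter> {x. u \<bullet> x \<le> g z}"
    have ne: "x0 \<in> ?A" "- x1 \<in> ?B" using x xL rng that by (auto simp: \<alpha>_def \<beta>_def)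
    have "V * (y + z) ^ ?n \<le> vol (minkowski_sum ?A ?B)"
      using ne that f(5)[of y] g(5)[of z] K L
      by (intro bm) (auto intro: hs compact_Int_closed convex_Int)
    also have "\<dots> \<le> vol (M \<inter> {x. u \<bullet> x \<le> f y + g z})"
    proof (rule measure_mono_fmeasurable)
      show "minkowski_sum ?A ?B \<subseteq> M \<inter> {x. u \<bullet> x \<le> f y + g z}"
        by (auto elim!: minkowski_sumE simp: M_def inner_add_right intro: minkowski_sumI)
      show "minkowski_sum ?A ?B \<in> sets lebesgue"
        by (intro fmeasurableD lmeasurable_compact compact_minkowski_sum compact_Int_closed hs K L)
    qed (intro lmeasurable_Int_halfspace meas)
    finally show ?thesis .
  qed
  \<comment> \<open>Passage to complements: above the quantile \<open>y\<close> both bodies keep the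
    fraction \<open>1 - y ^ ?n = b ^ ?n\<close>, so the sum of these parts has volume at least
    \<open>V * (2 * b) ^ ?n\<close>. The assumption on \<open>M\<close> then leaves at most
    \<open>V * (2 * y) ^ ?n\<close> below.\<close>
  have upper: "vol (M \<inter> {x. u \<bullet> x \<le> f y + g y}) \<le> V * (2 * y) ^ ?n" if y: "y \<in> {0..1}" for y
  proof -
    let ?A = "K \<inter> {x. f y \<le> u \<bullet> x}" and ?B = "L \<inter> {x. g y \<le> u \<bullet> x}"
    have ne: "x1 \<in> ?A" "- x0 \<in> ?B" using x xL rng y by (auto simp: \<alpha>_def \<beta>_def)
    have u0: "u \<noteq> 0" using u by auto
    have "y ^ ?n \<le> 1" using y by (auto intro: power_le_one)
    then obtain b where b: "b \<ge> 0" "b ^ ?n = 1 - y ^ ?n" using power_root_exists[of "1 - y ^ ?n" ?n] by auto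
    have "V * b ^ ?n = V - V * y ^ ?n" unfolding b(2) by (simp add: right_diff_distrib)
    then have "vol ?A = V * b ^ ?n" "vol ?B = V * b ^ ?n"
      using f(5)[of y] g(5)[of y] y mL
      by (simp_all add: measure_split_hyperplane(3)[OF u0] meas V_def[symmetric])
    then have "V * (b + b) ^ ?n \<le> vol (minkowski_sum ?A ?B)"
      using ne b K L by (intro bm) (auto intro: hs compact_Int_closed convex_Int)
    also have "\<dots> \<le> vol (M \<inter> {x. f y + g y \<le> u \<bullet> x})"
    proof (rule measure_mono_fmeasurable)
      show "minkowski_sum ?A ?B \<subseteq> M \<inter> {x. f y + g y \<le> u \<bullet> x}"
        by (auto elim!: minkowski_sumE simp: M_def inner_add_right intro: minkowski_sumI)
      show "minkowski_sum ?A ?B \<in> sets lebesgue"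
        by (intro fmeasurableD lmeasurable_compact compact_minkowski_sum compact_Int_closed hs K L)
    qed (intro lmeasurable_Int_halfspace meas)
    also have "\<dots> = vol M - vol (M \<inter> {x. u \<bullet> x \<le> f y + g y})"
      by (rule measure_split_hyperplane(3)[OF u0 meas(3)])
    finally have "vol (M \<inter> {x. u \<bullet> x \<le> f y + g y}) \<le> vol M - V * (b + b) ^ ?n" by linarith
    moreover have "vol M \<le> 2 ^ ?n * V" using eq by (simp add: M_def L_def V_def)
    moreover have "V * (b + b) ^ ?n = 2 ^ ?n * V - V * (2 * y) ^ ?n"
      unfolding mult_2[symmetric] power_mult_distrib b(2) by (simp add: algebra_simps)
    ultimately show ?thesis by linarith
  qed
  have mM: "vol M > 0"
  proof -
    have "0 < V * (1 + 1) ^ ?n" using V by simp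
    also have "\<dots> \<le> vol (M \<inter> {x. u \<bullet> x \<le> f 1 + g 1})" by (rule lower) auto
    also have "\<dots> \<le> vol M"
      using meas(3) by (intro measure_mono_fmeasurable fmeasurableD lmeasurable_Int_halfspace) auto
    finally show ?thesis .
  qed
  \<comment> \<open>A failure would squeeze a strict increase of the sections of \<open>M\<close>
    between \<open>lower\<close> at \<open>y\<close>, \<open>z\<close> and \<open>upper\<close> at
    the midpoint, whose bounds are the same number.\<close>
  have ineq: "f ((y + z) / 2) + g ((y + z) / 2) \<le> f y + g z" if yz: "y \<in> {0..1}" "z \<in> {0..1}" for y z
  proof (rule ccontr)
    let ?m = "(y + z) / 2"
    assume "\<not> ?thesis"
    then have lt: "f y + g z < f ?m + g ?m" by simp
    have m: "?m \<in> {0..1}" using yz by auto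
    have "vol (M \<inter> {x. u \<bullet> x \<le> f y + g z}) < vol (M \<inter> {x. u \<bullet> x \<le> f ?m + g ?m})"
      using rng[OF yz(1)] rng[OF yz(2)] rng[OF m]
      by (intro measure_Int_halfspace_strict_mono[OF M mM xM _ lt]) (auto simp: inner_diff_right \<alpha>_def \<beta>_def)
    also have "\<dots> \<le> V * (2 * ?m) ^ ?n" by (rule upper[OF m])
    also have "2 * ?m = y + z" by simp
    finally show False using lower[OF yz] by linarith
  qed
  have ineq': "g ((y + z) / 2) + f ((y + z) / 2) \<le> g y + f z" if yz: "y \<in> {0..1}" "z \<in> {0..1}" for y z
    using ineq[OF yz(2,1)] by (simp add: add.commute)
  \<comment> \<open>Used in both orders, the midpoint inequality equates the increments of
    \<open>f\<close> and \<open>g\<close>; the constant \<open>c\<close> is read off at 0.\<close>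
  have fg: "f y = g y + c" if "y \<in> {0..1}" for y
  proof (cases "y = 0")
    case True then show ?thesis using f g by (simp add: c_def)
  next
    case False
    then show ?thesis
      using midpoint_inequality_imp_increment_le[OF f(1) g(1) ineq, of y]
        midpoint_inequality_imp_increment_le[OF g(1) f(1) ineq', of y] that f(3) g(3)
      by (simp add: c_def)
  qed
  have FK: "vol (K \<inter> {x. u \<bullet> x \<le> t + c}) = vol (L \<inter> {x. u \<bullet> x \<le> t})" for t
  proof -
    consider "t < -\<beta>" | "t > -\<alpha>" | "t \<in> {-\<beta>..-\<alpha>}" by fastforce
    then show ?thesis
    proof cases
      case 1
      then have "K \<inter> {x. u \<bullet> x \<le> t + c} = {}" "L \<inter> {x. u \<bullet> x \<le> t} = {}"
        using x(3) xL(3) by (force simp: c_def \<alpha>_def \<beta>_def)+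
      then show ?thesis by metis
    next
      case 2
      then have "K \<inter> {x. u \<bullet> x \<le> t + c} = K" "L \<inter> {x. u \<bullet> x \<le> t} = L"
        using x(3) xL(3) by (force simp: c_def \<alpha>_def \<beta>_def)+
      then show ?thesis using mL V_def by metis
    next
      case 3
      then obtain y where "y \<in> {0..1}" "t = g y" using g(2) by blast
      then show ?thesis using f(5)[of y] g(5)[of y] fg[of y] by simp
    qed
  qed
  have u0: "u \<noteq> 0" using u by auto
  \<comment> \<open>\<open>K\<close> and \<open>- K\<close> have equal quantiles up to the shift
    \<open>c\<close>, which means that \<open>u \<bullet> x - c / 2\<close> is symmetrically
    distributed on \<open>K\<close>.\<close>
  have up: "vol (K \<inter> {x. s < u \<bullet> x - c / 2}) = vol (K \<inter> {x. s < - (u \<bullet> x - c / 2)})" for s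
  proof -
    have "vol (K \<inter> {x. s < u \<bullet> x - c / 2}) = vol (K \<inter> {x. (s - c / 2) + c < u \<bullet> x})"
      by (rule arg_cong[where f = "vol"]) (auto simp: field_simps)
    also have "\<dots> = V - vol (L \<inter> {x. u \<bullet> x \<le> s - c / 2})"
      unfolding measure_split_hyperplane(2)[OF u0 meas(1)] FK V_def ..
    also have "\<dots> = vol (L \<inter> {x. s - c / 2 < u \<bullet> x})"
      unfolding measure_split_hyperplane(2)[OF u0 meas(2)] mL ..
    also have "L \<inter> {x. s - c / 2 < u \<bullet> x} = uminus ` (K \<inter> {x. s < - (u \<bullet> x - c / 2)})"
      by (auto simp: L_def image_iff algebra_simps)
    finally show ?thesis by (simp add: measure_uminus_image)
  qed
  have fin: "finite_measure (lebesgue_on K)" by (rule finite_measure_lebesgue_on[OF meas(1)])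
  interpret K: finite_measure "lebesgue_on K" by (rule fin)
  have int: "integrable (lebesgue_on K) (\<lambda>x. x)"
  proof -
    obtain R where "\<And>x. x \<in> K \<Longrightarrow> norm x \<le> R" using compact_imp_bounded[OF K(1)] by (auto simp: bounded_iff)
    moreover have "(\<lambda>x. x) \<in> borel_measurable (lebesgue_on K)"
      using id_borel_measurable_lebesgue_on[of K] by (simp add: id_def)
    ultimately show ?thesis by (intro K.integrable_const_bound[of _ R]) (auto intro!: AE_I2)
  qed
  have "integral\<^sup>L (lebesgue_on K) (\<lambda>x. u \<bullet> x - c / 2) = 0"
  proof (rule integral_symmetric_distribution[OF fin])
    show "integrable (lebesgue_on K) (\<lambda>x. u \<bullet> x - c / 2)" using int by auto
    have set: "measure (lebesgue_on K) {x \<in> space (lebesgue_on K). P x} = vol (K \<inter> {x. P x})" for P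
      using meas(1) by (subst measure_restrict_space) (auto simp: fmeasurable_def Int_def conj_commute)
    show "measure (lebesgue_on K) {x \<in> space (lebesgue_on K). s < u \<bullet> x - c / 2}
      = measure (lebesgue_on K) {x \<in> space (lebesgue_on K). s < - (u \<bullet> x - c / 2)}" for s
      unfolding set by (rule up)
  qed
  moreover have "integral\<^sup>L (lebesgue_on K) (\<lambda>x. u \<bullet> x - c / 2) = u \<bullet> integral\<^sup>L (lebesgue_on K) (\<lambda>x. x) - c / 2 * V"
    using int meas(1) by (simp add: V_def measure_restrict_space fmeasurable_def)
  ultimately show ?thesis by (simp add: c_def V_def \<alpha>_def \<beta>_def)
qed

section \<open>Facets of a polytope\<close>

lemma borel_bounded_lmeasurable: "S \<in> sets borel \<Longrightarrow> bounded S \<Longrightarrow> S \<in> lmeasurable"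
  for S :: "'a::euclidean_space set"
  by (intro bounded_set_imp_lmeasurable) auto

lemma measure_le_translation_Un:
  fixes A B E :: "'a::euclidean_space set"
  assumes "A \<in> lmeasurable" "B \<in> lmeasurable" "E \<in> lmeasurable" "A \<subseteq> (+) s ` B \<union> E"
  shows "vol A \<le> vol B + vol E"
proof -
  have "vol A \<le> vol ((+) s ` B \<union> E)"
    using assms by (intro measure_mono_fmeasurable fmeasurableD fmeasurable.Un measurable_translation)
  also have "\<dots> \<le> vol ((+) s ` B) + vol E"
    using assms by (intro measure_Un_le fmeasurableD measurable_translation)
  finally show ?thesis by (simp add: measure_translation)
qed

text \<open>One alternative is a linear lower bound for \<open>\<bar>D\<bar>\<close> near 0;
  \<open>small\<close> is its failure, and the conclusion is the other alternative. At a small scale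
  \<open>\<sigma>\<close> where \<open>D\<close> is flat, quasi-additivity carries the flatness to
  the multiples of \<open>\<sigma>\<close> with a quadratic error, and \<open>\<tau>\<close> is
  within \<open>\<sigma>\<close> of such a multiple.\<close>

lemma quasi_additive_dichotomy:
  fixes D :: "real \<Rightarrow> real"
  assumes C: "C \<ge> 0" and t0: "\<tau>0 > 0"
    and add: "\<And>\<tau> \<sigma>. \<tau> > 0 \<Longrightarrow> \<sigma> > 0 \<Longrightarrow> \<tau> + \<sigma> < \<tau>0 \<Longrightarrow> \<bar>D (\<tau> + \<sigma>) - D \<tau> - D \<sigma>\<bar> \<le> C * (\<tau> * \<sigma>)"
    and bd: "\<And>\<tau>. \<tau> > 0 \<Longrightarrow> \<bar>D \<tau>\<bar> \<le> C * \<tau>"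
    and small: "\<And>c \<tau>1. c > 0 \<Longrightarrow> \<tau>1 > 0 \<Longrightarrow> \<exists>\<sigma>. 0 < \<sigma> \<and> \<sigma> < \<tau>1 \<and> \<bar>D \<sigma>\<bar> < c * \<sigma>"
    and t: "0 < \<tau>" "\<tau> < \<tau>0"
  shows "\<bar>D \<tau>\<bar> \<le> C * \<tau>\<^sup>2"
proof (rule field_le_epsilon)
  fix e :: real assume e: "e > 0"
  define c where "c = e / (2 * \<tau>)"
  have c: "c > 0" using e t by (simp add: c_def)
  \<comment> \<open>The second entry makes the error of replacing \<open>\<tau>\<close> by a
    multiple of \<open>\<sigma>\<close> at most \<open>e / 2\<close>; the other half of
    \<open>e\<close> is spent on the slope \<open>c\<close>.\<close>
  define \<tau>1 where "\<tau>1 = min \<tau> (e / (2 * (C * \<tau> + C + 1)))"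
  have dpos: "C * \<tau> + C + 1 > 0" using C t by (simp add: add_nonneg_pos)
  then have "\<tau>1 > 0" using t e by (simp add: \<tau>1_def)
  then obtain \<sigma> where s: "0 < \<sigma>" "\<sigma> < \<tau>1" "\<bar>D \<sigma>\<bar> < c * \<sigma>" using small[OF c] by blast
  have st: "\<sigma> < \<tau>" "\<sigma> * (C * \<tau> + C + 1) \<le> e / 2"
    using s dpos by (auto simp: \<tau>1_def field_simps)
  have mult: "\<bar>D (real k * \<sigma>) - real k * D \<sigma>\<bar> \<le> C * (real k * \<sigma>)\<^sup>2" if "k \<ge> 1" "real k * \<sigma> < \<tau>0" for k
    using that
  proof (induction k rule: nat_induct_at_least)
    case base then show ?case using C by simp
  next
    case (Suc k)
    have k: "real k * \<sigma> > 0" "real k * \<sigma> + \<sigma> < \<tau>0" using Suc s by (auto simp: algebra_simps)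
    have IH: "\<bar>D (real k * \<sigma>) - real k * D \<sigma>\<bar> \<le> C * (real k * \<sigma>)\<^sup>2" using Suc k s by auto
    have "\<bar>D (real (Suc k) * \<sigma>) - D (real k * \<sigma>) - D \<sigma>\<bar> \<le> C * ((real k * \<sigma>) * \<sigma>)"
      using add[OF k(1) s(1) k(2)] by (simp add: algebra_simps)
    moreover have "real (Suc k) * D \<sigma> = real k * D \<sigma> + D \<sigma>" by (simp add: algebra_simps)
    ultimately have "\<bar>D (real (Suc k) * \<sigma>) - real (Suc k) * D \<sigma>\<bar> \<le> C * (real k * \<sigma>)\<^sup>2 + C * ((real k * \<sigma>) * \<sigma>)"
      using IH by linarith
    also have "\<dots> = C * ((real k * \<sigma>)\<^sup>2 + (real k * \<sigma>) * \<sigma>)" by (simp add: algebra_simps)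
    also have "\<dots> \<le> C * (real (Suc k) * \<sigma>)\<^sup>2"
      using C s(1) by (intro mult_left_mono) (auto simp: power2_eq_square algebra_simps)
    finally show ?case .
  qed
  define k where "k = nat \<lfloor>\<tau> / \<sigma>\<rfloor>"
  define \<rho> where "\<rho> = \<tau> - real k * \<sigma>"
  have "1 \<le> \<tau> / \<sigma>" using s st by simp
  then have k: "k \<ge> 1" "real k \<le> \<tau> / \<sigma>" "\<tau> / \<sigma> < real k + 1" unfolding k_def by linarith+
  then have kr: "real k * \<sigma> \<le> \<tau>" "0 \<le> \<rho>" "\<rho> < \<sigma>" using s by (auto simp: \<rho>_def field_simps)
  have "C * (real k * \<sigma>)\<^sup>2 \<le> C * (real k * \<sigma> * \<tau>)"
    unfolding power2_eq_square using C kr s by (intro mult_left_mono) auto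
  then have D1: "\<bar>D (real k * \<sigma>)\<bar> \<le> real k * \<bar>D \<sigma>\<bar> + C * (real k * \<sigma> * \<tau>)"
    using mult[OF k(1)] kr t abs_mult[of "real k" "D \<sigma>"] by auto
  have "real k * \<bar>D \<sigma>\<bar> \<le> real k * (c * \<sigma>)" using s by (intro mult_left_mono) auto
  also have "\<dots> = c * (real k * \<sigma>)" by simp
  also have "\<dots> \<le> c * \<tau>" using c kr by (intro mult_left_mono) auto
  also have "\<dots> = e / 2" using t by (simp add: c_def)
  finally have D2: "real k * \<bar>D \<sigma>\<bar> \<le> e / 2" .
  have D3: "C * (real k * \<sigma> * \<tau>) \<le> C * \<tau>\<^sup>2"
    unfolding power2_eq_square using C kr t by (intro mult_left_mono mult_right_mono) auto
  have D4: "\<bar>D \<tau> - D (real k * \<sigma>)\<bar> \<le> \<sigma> * (C * \<tau> + C + 1)"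
  proof (cases "\<rho> = 0")
    case True
    then have "\<tau> = real k * \<sigma>" by (simp add: \<rho>_def)
    then have "D \<tau> = D (real k * \<sigma>)" by simp
    then show ?thesis using s dpos by simp
  next
    case False
    then have r: "\<rho> > 0" using kr by simp
    have "real k * \<sigma> > 0" using k s by simp
    from add[OF this r] have "\<bar>D \<tau> - D (real k * \<sigma>) - D \<rho>\<bar> \<le> C * ((real k * \<sigma>) * \<rho>)"
      using t by (simp add: \<rho>_def)
    also have "\<dots> \<le> C * (\<tau> * \<sigma>)" using C kr t by (intro mult_left_mono mult_mono) auto
    finally have "\<bar>D \<tau> - D (real k * \<sigma>)\<bar> \<le> C * (\<tau> * \<sigma>) + \<bar>D \<rho>\<bar>" by linarith
    moreover have "\<bar>D \<rho>\<bar> \<le> C * \<rho>" by (rule bd[OF r])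
    moreover have "C * \<rho> \<le> C * \<sigma>" using C kr by (intro mult_left_mono) auto
    ultimately show ?thesis using s by (simp add: algebra_simps)
  qed
  from D1 D2 D3 D4 st show "\<bar>D \<tau>\<bar> \<le> C * \<tau>\<^sup>2 + e" by linarith
qed

text \<open>Closing \<open>U\<close> under negation makes opposite caps comparable for every normal:
  a direction that supports only a lower dimensional face counts as a facet of area zero.\<close>

locale facet_normals =
  fixes U :: "'a::euclidean_space set" and h :: "'a \<Rightarrow> real" and R :: real
  assumes finite_U: "finite U" and norm_U: "\<And>u. u \<in> U \<Longrightarrow> norm u = 1"
    and uminus_U: "\<And>u. u \<in> U \<Longrightarrow> - u \<in> U"
    and bounded_h: "{x. \<forall>u\<in>U. u \<bullet> x \<le> h u} \<subseteq> cball 0 R"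
    and interior_h: "interior {x. \<forall>u\<in>U. u \<bullet> x \<le> h u} \<noteq> {}"
begin

definition poly :: "('a \<Rightarrow> real) \<Rightarrow> 'a set" where
  "poly k = {x. \<forall>u\<in>U. u \<bullet> x \<le> k u}"

definition cap :: "('a \<Rightarrow> real) \<Rightarrow> 'a \<Rightarrow> real \<Rightarrow> 'a set" where
  "cap k u \<tau> = {x \<in> poly k. k u - \<tau> < u \<bullet> x}"

text \<open>Neighbourhood of the lower dimensional faces of the facet with normal \<open>u\<close>.\<close>

definition rim :: "'a \<Rightarrow> real \<Rightarrow> real \<Rightarrow> ('a \<Rightarrow> real) \<Rightarrow> real \<Rightarrow> 'a set" where
  "rim u p \<alpha> q \<beta> = {x \<in> cball 0 R. p < u \<bullet> x \<and> u \<bullet> x \<le> p + \<alpha> \<and>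
     (\<exists>v\<in>U - {u, -u}. q v < v \<bullet> x \<and> v \<bullet> x \<le> q v + \<beta>)}"

lemma inner_U: "u \<in> U \<Longrightarrow> u \<bullet> u = 1"
  using norm_U by (simp add: dot_square_norm)

lemma abs_inner_U: "u \<in> U \<Longrightarrow> v \<in> U \<Longrightarrow> \<bar>u \<bullet> v\<bar> \<le> 1"
  using Cauchy_Schwarz_ineq2[of u v] norm_U by simp

lemma closed_poly: "closed (poly k)"
proof -
  have "poly k = (\<Inter>u\<in>U. {x. u \<bullet> x \<le> k u})" by (auto simp: poly_def)
  then show ?thesis by (auto intro: closed_halfspace_le)
qed

lemma convex_poly: "convex (poly k)"
proof -
  have "poly k = (\<Inter>u\<in>U. {x. u \<bullet> x \<le> k u})" by (auto simp: poly_def)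
  then show ?thesis by (auto intro!: convex_INT convex_halfspace_le)
qed

lemma poly_h_subset: "poly h \<subseteq> cball 0 R"
  using bounded_h by (simp add: poly_def)

lemma norm_poly_h: "x \<in> poly h \<Longrightarrow> norm x \<le> R"
  using poly_h_subset by auto

lemma compact_poly_h: "compact (poly h)"
  using closed_poly poly_h_subset by (meson bounded_cball bounded_subset compact_eq_bounded_closed)

lemma cap_borel: "cap k u \<tau> \<in> sets borel"
proof -
  have "cap k u \<tau> = poly k \<inter> {x. k u - \<tau> < u \<bullet> x}" by (auto simp: cap_def)
  then show ?thesis by (auto intro: borel_closed closed_poly borel_open open_halfspace_gt)
qed

lemma cap_lmeasurable: "poly k \<subseteq> cball 0 R \<Longrightarrow> cap k u \<tau> \<in> lmeasurable"
  by (intro borel_bounded_lmeasurable cap_borel bounded_subset[OF bounded_cball, of _ 0 R]) (auto simp: cap_def)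

lemma poly_h_measure_pos: "vol (poly h) > 0"
proof -
  have "\<not> negligible (poly h)" using interior_h unfolding poly_def[symmetric]
    by (metis interior_subset negligible_subset open_interior open_not_negligible)
  then show ?thesis using compact_poly_h lmeasurable_compact negligible_iff_measure0 zero_less_measure_iff by metis
qed

lemma rim_eq: "rim u p \<alpha> q \<beta> = (\<Union>v\<in>U - {u, -u}. {x \<in> cball 0 R. p < u \<bullet> x \<and> u \<bullet> x \<le> p + \<alpha> \<and> q v < v \<bullet> x \<and> v \<bullet> x \<le> q v + \<beta>})"
  by (auto simp: rim_def)

lemma two_slabs_lmeasurable:
  "{x \<in> cball 0 R. p < u \<bullet> x \<and> u \<bullet> x \<le> p + \<alpha> \<and> q < v \<bullet> x \<and> v \<bullet> x \<le> q + \<beta>} \<in> lmeasurable" for u v :: 'a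
proof -
  have "{x \<in> cball 0 R. p < u \<bullet> x \<and> u \<bullet> x \<le> p + \<alpha> \<and> q < v \<bullet> x \<and> v \<bullet> x \<le> q + \<beta>}
    = {x \<in> cball 0 R. p < u \<bullet> x \<and> u \<bullet> x \<le> p + \<alpha>} \<inter> {x \<in> cball 0 R. q < v \<bullet> x \<and> v \<bullet> x \<le> q + \<beta>}" by auto
  then show ?thesis by (simp only: fmeasurable.Int[OF lmeasurable_slab lmeasurable_slab])
qed

lemma rim_lmeasurable: "rim u p \<alpha> q \<beta> \<in> lmeasurable"
  unfolding rim_eq using finite_U two_slabs_lmeasurable by (intro fmeasurable.finite_UN) auto

lemma rim_measure_le:
  obtains C where "C \<ge> 0"
    "\<And>u p \<alpha> q \<beta>. u \<in> U \<Longrightarrow> \<alpha> \<ge> 0 \<Longrightarrow> \<beta> \<ge> 0 \<Longrightarrow> vol (rim u p \<alpha> q \<beta>) \<le> C * (\<alpha> * \<beta>)"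
    "\<And>u p \<alpha>. u \<in> U \<Longrightarrow> \<alpha> \<ge> 0 \<Longrightarrow> vol {x \<in> cball 0 R. p < u \<bullet> x \<and> u \<bullet> x \<le> p + \<alpha>} \<le> C * \<alpha>"
proof -
  let ?Q = "\<lambda>u v C. C \<ge> 0 \<and> (\<forall>p q \<alpha> \<beta>. \<alpha> \<ge> 0 \<longrightarrow> \<beta> \<ge> 0 \<longrightarrow>
    vol {x \<in> cball 0 R. p < u \<bullet> x \<and> u \<bullet> x \<le> p + \<alpha> \<and> q < v \<bullet> x \<and> v \<bullet> x \<le> q + \<beta>} \<le> C * (\<alpha> * \<beta>))"
  have ex: "\<exists>C. u \<in> U \<longrightarrow> v \<in> U - {u, -u} \<longrightarrow> ?Q u v C" for u v
  proof (cases "u \<in> U \<and> v \<in> U - {u, -u}")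
    case True
    then have "norm u = 1" "norm v = 1" "u \<noteq> v" "u \<noteq> - v" using norm_U by auto
    then obtain C where "C \<ge> 0" "\<And>p q \<alpha> \<beta>. \<alpha> \<ge> 0 \<Longrightarrow> \<beta> \<ge> 0 \<Longrightarrow>
      vol {x \<in> cball 0 R. p < u \<bullet> x \<and> u \<bullet> x \<le> p + \<alpha> \<and> q < v \<bullet> x \<and> v \<bullet> x \<le> q + \<beta>} \<le> C * (\<alpha> * \<beta>)"
      by (rule measure_two_slabs_le[of u v R]) blast
    then show ?thesis by blast
  qed auto
  define f where "f u v = (SOME C. u \<in> U \<longrightarrow> v \<in> U - {u, -u} \<longrightarrow> ?Q u v C)" for u v
  have f: "?Q u v (f u v)" if "u \<in> U" "v \<in> U - {u, -u}" for u v
    using someI_ex[OF ex[of u v]] that unfolding f_def by blast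
  \<comment> \<open>The constants depend on the pair of normals; as \<open>U\<close> is finite,
    their sum serves all pairs at once.\<close>
  define C0 where "C0 = (\<Sum>u\<in>U. \<Sum>v\<in>U - {u, -u}. f u v)"
  define C1 where "C1 = vol (cball (0::'a) (R + 1))"
  have C0: "C0 \<ge> 0" unfolding C0_def using f by (intro sum_nonneg) auto
  have C1: "C1 \<ge> 0" by (simp add: C1_def)
  show thesis
  proof (rule that[of "C0 + C1"])
    show "C0 + C1 \<ge> 0" using C0 C1 by simp
    fix u :: 'a and p \<alpha> :: real assume u: "u \<in> U" and a: "\<alpha> \<ge> 0"
    have "vol {x \<in> cball 0 R. p < u \<bullet> x \<and> u \<bullet> x \<le> p + \<alpha>} \<le> C1 * \<alpha>"
      unfolding C1_def by (rule measure_slab_le[OF norm_U[OF u] a])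
    also have "\<dots> \<le> (C0 + C1) * \<alpha>" using C0 a by (intro mult_right_mono) auto
    finally show "vol {x \<in> cball 0 R. p < u \<bullet> x \<and> u \<bullet> x \<le> p + \<alpha>} \<le> (C0 + C1) * \<alpha>" .
    fix q :: "'a \<Rightarrow> real" and \<beta> :: real assume b: "\<beta> \<ge> 0"
    have "vol (rim u p \<alpha> q \<beta>) \<le> (\<Sum>v\<in>U - {u, -u}. vol {x \<in> cball 0 R. p < u \<bullet> x \<and> u \<bullet> x \<le> p + \<alpha> \<and> q v < v \<bullet> x \<and> v \<bullet> x \<le> q v + \<beta>})"
      unfolding rim_eq using finite_U two_slabs_lmeasurable by (intro measure_UNION_le) (auto dest: fmeasurableD)
    also have "\<dots> \<le> (\<Sum>v\<in>U - {u, -u}. f u v * (\<alpha> * \<beta>))"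
      using f[OF u] a b by (intro sum_mono) blast
    also have "\<dots> = (\<Sum>v\<in>U - {u, -u}. f u v) * (\<alpha> * \<beta>)" by (simp add: sum_distrib_right)
    also have "\<dots> \<le> C0 * (\<alpha> * \<beta>)"
      unfolding C0_def using f a b finite_U u
      by (intro mult_right_mono member_le_sum[of u U "\<lambda>u. \<Sum>v\<in>U - {u, -u}. f u v"] sum_nonneg) auto
    also have "\<dots> \<le> (C0 + C1) * (\<alpha> * \<beta>)" using C1 a b by (intro mult_right_mono) auto
    finally show "vol (rim u p \<alpha> q \<beta>) \<le> (C0 + C1) * (\<alpha> * \<beta>)" .
  qed
qed

text \<open>A ball inside the polytope keeps opposite bounding hyperplanes apart by its diameter.
  This width prevents a short shift along \<open>u\<close> from reaching the side of
  \<open>- u\<close>.\<close>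

lemma width_pos:
  obtains \<omega> where "\<omega> > 0" "\<And>u. u \<in> U \<Longrightarrow> h u + h (- u) \<ge> \<omega>"
proof -
  obtain x e where xe: "e > 0" "cball x e \<subseteq> poly h"
    using interior_h unfolding poly_def[symmetric] by (metis all_not_in_conv mem_interior_cball)
  show thesis
  proof (rule that[of "2 * e"])
    fix u assume u: "u \<in> U"
    have "x + e *\<^sub>R u \<in> cball x e" "x - e *\<^sub>R u \<in> cball x e" using norm_U[OF u] xe(1) by (auto simp: dist_norm)
    then have "u \<bullet> (x + e *\<^sub>R u) \<le> h u" "(- u) \<bullet> (x - e *\<^sub>R u) \<le> h (- u)"
      using xe(2) u uminus_U unfolding poly_def by blast+
    then show "h u + h (- u) \<ge> 2 * e" using inner_U[OF u] by (simp add: inner_add_right inner_diff_right)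
  qed (use xe in simp)
qed

lemma cap_measure_le:
  assumes "u \<in> U" "\<tau> \<ge> 0" "poly k \<subseteq> cball 0 R"
    and C: "\<And>u p \<alpha>. u \<in> U \<Longrightarrow> \<alpha> \<ge> 0 \<Longrightarrow> vol {x \<in> cball 0 R. p < u \<bullet> x \<and> u \<bullet> x \<le> p + \<alpha>} \<le> C * \<alpha>"
  shows "vol (cap k u \<tau>) \<le> C * \<tau>"
proof -
  have "vol (cap k u \<tau>) \<le> vol {x \<in> cball 0 R. k u - \<tau> < u \<bullet> x \<and> u \<bullet> x \<le> (k u - \<tau>) + \<tau>}"
    using assms by (intro measure_mono_fmeasurable lmeasurable_slab fmeasurableD cap_lmeasurable) (auto simp: cap_def poly_def)
  also have "\<dots> \<le> C * \<tau>" by (rule C[OF assms(1,2)])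
  finally show ?thesis .
qed

text \<open>A shift by \<open>\<tau>\<close> along \<open>u\<close> takes the layer between the
  depths \<open>\<tau>\<close> and \<open>\<tau> + \<sigma>\<close> to the cap of depth
  \<open>\<sigma>\<close>, except for points close to the hyperplane of another normal, which lie in
  a rim. Condition \<open>w\<close> keeps the hyperplane of \<open>- u\<close> out of reach.\<close>

lemma cap_quasi_additive:
  assumes u: "u \<in> U" and \<tau>: "\<tau> > 0" and \<sigma>: "\<sigma> > 0" and w: "\<tau> + \<sigma> < h u + h (- u)"
    and C: "\<And>u p \<alpha> q \<beta>. u \<in> U \<Longrightarrow> \<alpha> \<ge> 0 \<Longrightarrow> \<beta> \<ge> 0 \<Longrightarrow> vol (rim u p \<alpha> q \<beta>) \<le> C * (\<alpha> * \<beta>)"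
  shows "\<bar>vol (cap h u (\<tau> + \<sigma>)) - vol (cap h u \<tau>) - vol (cap h u \<sigma>)\<bar> \<le> C * (\<tau> * \<sigma>)"
proof -
  define S where "S = {x \<in> poly h. h u - (\<tau> + \<sigma>) < u \<bullet> x \<and> u \<bullet> x \<le> h u - \<tau>}"
  note capL = cap_lmeasurable[OF poly_h_subset]
  have "S = poly h \<inter> ({x. h u - (\<tau> + \<sigma>) < u \<bullet> x} \<inter> {x. u \<bullet> x \<le> h u - \<tau>})" by (auto simp: S_def)
  then have "S \<in> sets borel"
    by (auto intro: borel_closed closed_poly borel_open open_halfspace_gt closed_halfspace_le)
  then have SL: "S \<in> lmeasurable"
    by (rule borel_bounded_lmeasurable) (rule bounded_subset[OF compact_imp_bounded[OF compact_poly_h]], auto simp: S_def)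
  have "cap h u (\<tau> + \<sigma>) = cap h u \<tau> \<union> S" "cap h u \<tau> \<inter> S = {}"
    using \<tau> \<sigma> by (auto simp: cap_def S_def)
  then have eq: "vol (cap h u (\<tau> + \<sigma>)) = vol (cap h u \<tau>) + vol S"
    using capL SL by (simp add: measure_Un3)
  note uu = inner_U[OF u]
  have vu: "v \<bullet> u \<le> 1" "- (v \<bullet> u) \<le> 1" if "v \<in> U" for v using abs_inner_U[OF that u] by auto
  have vt: "\<tau> * (v \<bullet> u) \<le> \<tau>" "- (\<tau> * (v \<bullet> u)) \<le> \<tau>" if "v \<in> U" for v
    using mult_left_mono[OF vu(1)[OF that], of \<tau>] mult_left_mono[OF vu(2)[OF that], of \<tau>] \<tau> by auto
  have 1: "S \<subseteq> (+) (- (\<tau> *\<^sub>R u)) ` cap h u \<sigma> \<union> rim u (h u - (\<tau> + \<sigma>)) \<sigma> (\<lambda>v. h v - \<tau>) \<tau>"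
  proof
    fix y assume y: "y \<in> S"
    show "y \<in> (+) (- (\<tau> *\<^sub>R u)) ` cap h u \<sigma> \<union> rim u (h u - (\<tau> + \<sigma>)) \<sigma> (\<lambda>v. h v - \<tau>) \<tau>"
    proof (cases "\<forall>v\<in>U - {u, -u}. v \<bullet> (y + \<tau> *\<^sub>R u) \<le> h v")
      case True
      have "v \<bullet> (y + \<tau> *\<^sub>R u) \<le> h v" if "v \<in> U" for v
        using y True that \<tau> uu by (cases "v = u"; cases "v = - u") (auto simp: S_def poly_def inner_add_right)
      then have "y + \<tau> *\<^sub>R u \<in> cap h u \<sigma>" using y uu by (simp add: cap_def S_def poly_def inner_add_right)
      then show ?thesis by (intro UnI1 image_eqI[of _ _ "y + \<tau> *\<^sub>R u"]) auto
    next
      case False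
      then obtain v where v: "v \<in> U - {u, -u}" "h v < v \<bullet> y + \<tau> * (v \<bullet> u)" by (auto simp: inner_add_right not_le)
      then have "h v - \<tau> < v \<bullet> y" "v \<bullet> y \<le> h v" using vt[of v] y by (auto simp: S_def poly_def)
      then have "y \<in> rim u (h u - (\<tau> + \<sigma>)) \<sigma> (\<lambda>v. h v - \<tau>) \<tau>"
        using v y norm_poly_h[of y] by (auto simp: rim_def S_def intro!: bexI[of _ v])
      then show ?thesis by blast
    qed
  qed
  have 2: "cap h u \<sigma> \<subseteq> (+) (\<tau> *\<^sub>R u) ` S \<union> rim u (h u - \<sigma>) \<sigma> (\<lambda>v. h v - \<tau>) \<tau>"
  proof
    fix y assume y: "y \<in> cap h u \<sigma>"
    show "y \<in> (+) (\<tau> *\<^sub>R u) ` S \<union> rim u (h u - \<sigma>) \<sigma> (\<lambda>v. h v - \<tau>) \<tau>"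
    proof (cases "\<forall>v\<in>U - {u, -u}. v \<bullet> (y - \<tau> *\<^sub>R u) \<le> h v")
      case True
      have "v \<bullet> (y - \<tau> *\<^sub>R u) \<le> h v" if "v \<in> U" for v
        using y True that \<tau> uu w by (cases "v = u"; cases "v = - u") (auto simp: cap_def poly_def inner_diff_right)
      then have "y - \<tau> *\<^sub>R u \<in> S" using y uu u by (auto simp: cap_def S_def poly_def inner_diff_right)
      then show ?thesis by (intro UnI1 image_eqI[of _ _ "y - \<tau> *\<^sub>R u"]) auto
    next
      case False
      then obtain v where v: "v \<in> U - {u, -u}" "h v < v \<bullet> y - \<tau> * (v \<bullet> u)" by (auto simp: inner_diff_right not_le)
      then have "h v - \<tau> < v \<bullet> y" "v \<bullet> y \<le> h v" using vt[of v] y by (auto simp: cap_def poly_def)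
      then have "y \<in> rim u (h u - \<sigma>) \<sigma> (\<lambda>v. h v - \<tau>) \<tau>"
        using v y norm_poly_h[of y] u by (auto simp: rim_def cap_def poly_def intro!: bexI[of _ v])
      then show ?thesis by blast
    qed
  qed
  have "vol S \<le> vol (cap h u \<sigma>) + C * (\<sigma> * \<tau>)"
    using measure_le_translation_Un[OF SL capL rim_lmeasurable 1] C[OF u, of \<sigma> \<tau>] \<sigma> \<tau> by (smt (verit))
  moreover have "vol (cap h u \<sigma>) \<le> vol S + C * (\<sigma> * \<tau>)"
    using measure_le_translation_Un[OF capL SL rim_lmeasurable 2] C[OF u, of \<sigma> \<tau>] \<sigma> \<tau> by (smt (verit))
  ultimately show ?thesis using eq by (simp add: mult.commute)
qed

end

text \<open>A converse to subadditivity: removing \<open>E i\<close> from each \<open>A i\<close>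
  makes the sets disjoint and costs at most the volume of \<open>E i\<close>.\<close>

lemma sum_measure_le_UN_plus_overlap:
  fixes A :: "'b \<Rightarrow> 'a set"
  assumes I: "finite I" and A: "\<And>i. i \<in> I \<Longrightarrow> A i \<in> fmeasurable M"
    and E: "\<And>i. i \<in> I \<Longrightarrow> E i \<in> fmeasurable M"
    and ov: "\<And>i j. i \<in> I \<Longrightarrow> j \<in> I \<Longrightarrow> i \<noteq> j \<Longrightarrow> A i \<inter> A j \<subseteq> E i"
  shows "(\<Sum>i\<in>I. measure M (A i)) \<le> measure M (\<Union>i\<in>I. A i) + (\<Sum>i\<in>I. measure M (E i))"
proof -
  have AE: "A i - E i \<in> fmeasurable M" if "i \<in> I" for i using A[OF that] E[OF that] by auto
  have "measure M (A i) \<le> measure M (A i - E i) + measure M (E i)" if i: "i \<in> I" for i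
  proof -
    have "measure M (A i) \<le> measure M ((A i - E i) \<union> E i)"
      using A[OF i] AE[OF i] E[OF i] by (intro measure_mono_fmeasurable fmeasurable.Un) auto
    also have "\<dots> \<le> measure M (A i - E i) + measure M (E i)"
      using AE[OF i] E[OF i] by (intro measure_Un_le) auto
    finally show ?thesis .
  qed
  then have "(\<Sum>i\<in>I. measure M (A i)) \<le> (\<Sum>i\<in>I. measure M (A i - E i)) + (\<Sum>i\<in>I. measure M (E i))"
    unfolding sum.distrib[symmetric] by (rule sum_mono)
  also have "(\<Sum>i\<in>I. measure M (A i - E i)) = measure M (\<Union>i\<in>I. A i - E i)"
    using I AE ov by (intro measure_UNION'[symmetric]) (fastforce simp: pairwise_def disjnt_def)+
  also have "\<dots> \<le> measure M (\<Union>i\<in>I. A i)"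
    using I A AE by (intro measure_mono_fmeasurable fmeasurable.finite_UN) (auto dest: fmeasurableD)
  finally show ?thesis by simp
qed

section \<open>First variation of the volume\<close>

context facet_normals
begin

text \<open>
  Moving the facets by an odd function \<open>k\<close> of the normal does not change the volume to first order
  when opposite facets have the same area: gains at \<open>u\<close> are compensated by losses at \<open>- u\<close>.
\<close>

lemma odd_perturbation_measure_le:
  assumes odd: "\<And>u. u \<in> U \<Longrightarrow> k (- u) = - k u"
    and bal: "\<And>u \<tau>. u \<in> U \<Longrightarrow> 0 < \<tau> \<Longrightarrow> \<tau> < \<tau>0 \<Longrightarrow> vol (cap h u \<tau>) - vol (cap h (- u) \<tau>) \<le> B * \<tau>\<^sup>2"
    and t0: "\<tau>0 > 0" and B: "B \<ge> 0"
  obtains C e0 where "C \<ge> 0" "e0 > 0"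
    "\<And>e. 0 < e \<Longrightarrow> e < e0 \<Longrightarrow> vol (poly (\<lambda>u. h u + e * k u) \<inter> cball 0 R) \<le> vol (poly h) + C * e\<^sup>2"
proof -
  obtain C0 where C0: "C0 \<ge> 0"
    "\<And>u p \<alpha> q \<beta>. u \<in> U \<Longrightarrow> \<alpha> \<ge> 0 \<Longrightarrow> \<beta> \<ge> 0 \<Longrightarrow> vol (rim u p \<alpha> q \<beta>) \<le> C0 * (\<alpha> * \<beta>)"
    by (rule rim_measure_le) blast
  define K where "K = (\<Sum>u\<in>U. \<bar>k u\<bar>) + 1"
  have K: "K > 0" unfolding K_def by (intro add_nonneg_pos sum_nonneg) auto
  have kK: "\<bar>k u\<bar> \<le> K" if "u \<in> U" for u
    using member_le_sum[OF that, of "\<lambda>u. \<bar>k u\<bar>"] finite_U by (simp add: K_def)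
  define N where "N = real (card U)"
  define e0 where "e0 = \<tau>0 / K"
  \<comment> \<open>The facets that move outward; by oddness the one opposite to each of them moves
    inward by the same amount.\<close>
  define Up where "Up = {u \<in> U. k u > 0}"
  have Up: "finite Up" "Up \<subseteq> U" using finite_U by (auto simp: Up_def)
  have cardUp: "real (card Up) \<le> N" unfolding N_def using Up finite_U by (simp add: card_mono)
  \<comment> \<open>The summands stand for the imbalance \<open>B\<close> of opposite caps, for the
    rim of a gained layer, where one of the slabs has thickness \<open>2 * (e * K)\<close>, and for
    the overlap of the lost layers.\<close>
  define C where "C = N * (B * K\<^sup>2 + C0 * (2 * K\<^sup>2) + C0 * K\<^sup>2)"
  show thesis
  proof (rule that[of C e0])
    show "C \<ge> 0" unfolding C_def N_def using B C0(1) by (intro mult_nonneg_nonneg add_nonneg_nonneg) auto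
    show "e0 > 0" using t0 K by (simp add: e0_def)
    fix e assume e: "0 < e" "e < e0"
    have eK: "e * K < \<tau>0" using e K by (simp add: e0_def field_simps)
    have ek: "\<bar>e * k u\<bar> \<le> e * K" if "u \<in> U" for u using kK[OF that] e by (simp add: abs_mult)
    have ekp: "0 < e * k u" "e * k u \<le> e * K" "e * k u < \<tau>0" if "u \<in> Up" for u
    proof -
      have u: "u \<in> U" "k u > 0" using that by (auto simp: Up_def)
      show "0 < e * k u" using u e by simp
      show le: "e * k u \<le> e * K" using ek[OF u(1)] by linarith
      show "e * k u < \<tau>0" using le eK by linarith
    qed
    \<comment> \<open>The perturbed polytope may leave the ball to which the rim estimates are tied,
      hence the intersection.\<close>
    let ?Q = "poly (\<lambda>u. h u + e * k u) \<inter> cball 0 R"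
    let ?P = "poly h"
    note capL = cap_lmeasurable[OF poly_h_subset]
    have QL: "?Q \<in> lmeasurable" by (intro lmeasurable_compact closed_Int_compact closed_poly compact_cball)
    have PL: "?P \<in> lmeasurable" by (intro lmeasurable_compact compact_poly_h)
    define A where "A u = {x \<in> ?Q. h u < u \<bullet> x}" for u
    have AL: "A u \<in> lmeasurable" for u
    proof -
      have "A u = ?Q \<inter> {x. h u < u \<bullet> x}" by (auto simp: A_def)
      then show ?thesis using QL by (auto intro!: fmeasurable_Int_fmeasurable intro: borel_open open_halfspace_gt)
    qed
    have QmP: "?Q - ?P \<subseteq> (\<Union>u\<in>Up. A u)"
    proof
      fix x assume x: "x \<in> ?Q - ?P"
      then obtain u where u: "u \<in> U" "h u < u \<bullet> x" by (auto simp: poly_def not_le)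
      moreover have "u \<bullet> x \<le> h u + e * k u" using x u by (auto simp: poly_def)
      ultimately have "e * k u > 0" by linarith
      then have "u \<in> Up" using u e by (simp add: Up_def zero_less_mult_iff)
      then show "x \<in> (\<Union>u\<in>Up. A u)" using x u by (auto simp: A_def)
    qed
    \<comment> \<open>Pushed inward by \<open>e * k u\<close>, the gained layer becomes the cap of
      the same depth; a point that misses the polytope is close to another hyperplane and belongs to
      the rim.\<close>
    have Ale: "vol (A u) \<le> vol (cap h u (e * k u)) + C0 * (2 * K\<^sup>2) * e\<^sup>2" if u: "u \<in> Up" for u
    proof -
      have uU: "u \<in> U" using u Up by auto
      note uu = inner_U[OF uU]
      have "A u \<subseteq> (+) ((e * k u) *\<^sub>R u) ` cap h u (e * k u) \<union> rim u (h u) (e * K) (\<lambda>v. h v - e * K) (2 * (e * K))"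
      proof
        fix y assume y: "y \<in> A u"
        let ?z = "y - (e * k u) *\<^sub>R u"
        have yQ: "v \<bullet> y \<le> h v + e * k v" if "v \<in> U" for v using y that by (auto simp: A_def poly_def)
        show "y \<in> (+) ((e * k u) *\<^sub>R u) ` cap h u (e * k u) \<union> rim u (h u) (e * K) (\<lambda>v. h v - e * K) (2 * (e * K))"
        proof (cases "\<forall>v\<in>U - {u, -u}. v \<bullet> ?z \<le> h v")
          case True
          have "v \<bullet> ?z \<le> h v" if "v \<in> U" for v
            using True that uu yQ[OF that] odd[OF uU] by (cases "v = u"; cases "v = - u") (auto simp: inner_diff_right)
          then have "?z \<in> cap h u (e * k u)" using y uu by (simp add: cap_def A_def poly_def inner_diff_right)
          then show ?thesis by (intro UnI1 image_eqI[of _ _ ?z]) auto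
        next
          case False
          then obtain v where v: "v \<in> U - {u, -u}" "h v < v \<bullet> y - e * k u * (v \<bullet> u)" by (auto simp: inner_diff_right not_le)
          then have vU: "v \<in> U" by simp
          have "\<bar>e * k u * (v \<bullet> u)\<bar> = e * k u * \<bar>v \<bullet> u\<bar>" using ekp(1)[OF u] by (simp only: abs_mult[of "e * k u"] abs_of_pos)
          also have "\<dots> \<le> e * k u * 1" using abs_inner_U[OF vU uU] ekp(1)[OF u] by (intro mult_left_mono) auto
          finally have "\<bar>e * k u * (v \<bullet> u)\<bar> \<le> e * k u * 1" .
          then have "h v - e * K < v \<bullet> y" using v(2) ekp(2)[OF u] by linarith
          moreover have "v \<bullet> y \<le> h v - e * K + 2 * (e * K)" using yQ[OF vU] ek[OF vU] by linarith
          moreover have "u \<bullet> y \<le> h u + e * K" using yQ[OF uU] ekp(2)[OF u] by linarith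
          ultimately have "y \<in> rim u (h u) (e * K) (\<lambda>v. h v - e * K) (2 * (e * K))"
            using v y by (auto simp: rim_def A_def)
          then show ?thesis by blast
        qed
      qed
      from measure_le_translation_Un[OF AL capL rim_lmeasurable this]
      have "vol (A u) \<le> vol (cap h u (e * k u)) + vol (rim u (h u) (e * K) (\<lambda>v. h v - e * K) (2 * (e * K)))" .
      also have "vol (rim u (h u) (e * K) (\<lambda>v. h v - e * K) (2 * (e * K))) \<le> C0 * (e * K * (2 * (e * K)))"
        using e K by (intro C0(2) uU) auto
      finally show ?thesis by (simp add: power2_eq_square algebra_simps)
    qed
    \<comment> \<open>The layer lost at \<open>- u\<close>. Such layers overlap only in rims, so
      that their volumes add up to second order.\<close>
    define T where "T u = cap h (- u) (e * k u)" for u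
    have TQ: "(\<Union>u\<in>Up. T u) \<subseteq> ?P - ?Q"
    proof
      fix x assume "x \<in> (\<Union>u\<in>Up. T u)"
      then obtain u where u: "u \<in> Up" "x \<in> cap h (- u) (e * k u)" by (auto simp: T_def)
      then have uU: "u \<in> U" using Up by auto
      have "(- u) \<bullet> x > h (- u) + e * k (- u)" using u odd[OF uU] by (simp add: cap_def)
      then have "x \<notin> poly (\<lambda>u. h u + e * k u)" unfolding poly_def using uminus_U[OF uU] by force
      then show "x \<in> ?P - ?Q" using u by (auto simp: cap_def)
    qed
    have "(\<Sum>u\<in>Up. vol (T u)) \<le> vol (\<Union>u\<in>Up. T u)
        + (\<Sum>u\<in>Up. vol (rim (- u) (h (- u) - e * K) (e * K) (\<lambda>v. h v - e * K) (e * K)))"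
    proof (rule sum_measure_le_UN_plus_overlap[OF Up(1)])
      fix u v assume uv: "u \<in> Up" "v \<in> Up" "u \<noteq> v"
      then have U: "u \<in> U" "v \<in> U" "- v \<in> U" using Up uminus_U by auto
      have "- v \<noteq> u" using uv odd[OF U(2)] by (auto simp: Up_def)
      show "T u \<inter> T v \<subseteq> rim (- u) (h (- u) - e * K) (e * K) (\<lambda>v. h v - e * K) (e * K)"
      proof
        fix x assume x: "x \<in> T u \<inter> T v"
        then have xP: "x \<in> poly h" by (simp add: T_def cap_def)
        have "h (- w) - e * K < (- w) \<bullet> x" "(- w) \<bullet> x \<le> h (- w)" if "w \<in> Up" "x \<in> T w" for w
          using that ekp(2)[OF that(1)] uminus_U[of w] Up(2) unfolding T_def cap_def poly_def by force+
        from this[of u] this[of v] show "x \<in> rim (- u) (h (- u) - e * K) (e * K) (\<lambda>v. h v - e * K) (e * K)"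
          unfolding rim_def using x uv U \<open>- v \<noteq> u\<close> norm_poly_h[OF xP] by (auto intro!: bexI[of _ "- v"])
      qed
    qed (auto simp: T_def intro: capL rim_lmeasurable)
    also have "(\<Sum>u\<in>Up. vol (rim (- u) (h (- u) - e * K) (e * K) (\<lambda>v. h v - e * K) (e * K))) \<le> (\<Sum>u\<in>Up. C0 * K\<^sup>2 * e\<^sup>2)"
    proof (rule sum_mono)
      fix u assume "u \<in> Up"
      then have "- u \<in> U" using Up uminus_U by auto
      then have "vol (rim (- u) (h (- u) - e * K) (e * K) (\<lambda>v. h v - e * K) (e * K)) \<le> C0 * (e * K * (e * K))"
        using e K by (intro C0(2)) auto
      then show "vol (rim (- u) (h (- u) - e * K) (e * K) (\<lambda>v. h v - e * K) (e * K)) \<le> C0 * K\<^sup>2 * e\<^sup>2"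
        by (simp add: power2_eq_square algebra_simps)
    qed
    also have "vol (\<Union>u\<in>Up. T u) \<le> vol (?P - ?Q)"
      using TQ PL QL Up(1) by (intro measure_mono_fmeasurable fmeasurableD fmeasurable.finite_UN fmeasurable.Diff)
        (auto simp: T_def intro: capL fmeasurableD)
    finally have loss: "(\<Sum>u\<in>Up. vol (T u)) \<le> vol (?P - ?Q) + (\<Sum>u\<in>Up. C0 * K\<^sup>2 * e\<^sup>2)" by simp
    have "vol (?Q - ?P) \<le> vol (\<Union>u\<in>Up. A u)"
      using QmP PL QL Up(1) AL by (intro measure_mono_fmeasurable fmeasurableD fmeasurable.finite_UN fmeasurable.Diff) auto
    also have "\<dots> \<le> (\<Sum>u\<in>Up. vol (A u))"
      using Up(1) AL by (intro measure_UNION_le) (auto dest: fmeasurableD)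
    also have "\<dots> \<le> (\<Sum>u\<in>Up. vol (T u) + B * K\<^sup>2 * e\<^sup>2 + C0 * (2 * K\<^sup>2) * e\<^sup>2)"
    proof (rule sum_mono)
      fix u assume u: "u \<in> Up"
      then have uU: "u \<in> U" using Up by auto
      have "B * (e * k u)\<^sup>2 \<le> B * (e * K)\<^sup>2" by (rule mult_left_mono[OF power_mono[OF ekp(2)[OF u] less_imp_le[OF ekp(1)[OF u]]] B])
      then have "vol (cap h u (e * k u)) \<le> vol (T u) + B * K\<^sup>2 * e\<^sup>2"
        using bal[OF uU ekp(1)[OF u] ekp(3)[OF u]] by (simp add: T_def power_mult_distrib algebra_simps)
      then show "vol (A u) \<le> vol (T u) + B * K\<^sup>2 * e\<^sup>2 + C0 * (2 * K\<^sup>2) * e\<^sup>2"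
        using Ale[OF u] by linarith
    qed
    finally have gain: "vol (?Q - ?P) \<le> (\<Sum>u\<in>Up. vol (T u)) + (\<Sum>u\<in>Up. B * K\<^sup>2 * e\<^sup>2 + C0 * (2 * K\<^sup>2) * e\<^sup>2)"
      by (simp only: sum.distrib add.assoc)
    have IL: "?P \<inter> ?Q \<in> lmeasurable" "?Q - ?P \<in> lmeasurable" "?P - ?Q \<in> lmeasurable" using PL QL by auto
    have "vol ?Q = vol ((?P \<inter> ?Q) \<union> (?Q - ?P))" by (rule arg_cong[where f = "vol"]) auto
    also have "\<dots> \<le> vol (?P \<inter> ?Q) + vol (?Q - ?P)" using IL by (intro measure_Un_le) auto
    finally have mQ: "vol ?Q \<le> vol (?P \<inter> ?Q) + vol (?Q - ?P)" .
    have "vol ((?P \<inter> ?Q) \<union> (?P - ?Q)) = vol (?P \<inter> ?Q) + vol (?P - ?Q)"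
    proof -
      have "(?P \<inter> ?Q) \<inter> (?P - ?Q) = {}" by auto
      then show ?thesis using measure_Un3[OF IL(1,3)] by simp
    qed
    moreover have "(?P \<inter> ?Q) \<union> (?P - ?Q) = ?P" by auto
    ultimately have mP: "vol ?P = vol (?P \<inter> ?Q) + vol (?P - ?Q)" by simp
    have "vol ?Q \<le> vol ?P + ((\<Sum>u\<in>Up. C0 * K\<^sup>2 * e\<^sup>2) + (\<Sum>u\<in>Up. B * K\<^sup>2 * e\<^sup>2 + C0 * (2 * K\<^sup>2) * e\<^sup>2))"
      using mQ mP loss gain by linarith
    also have "(\<Sum>u\<in>Up. C0 * K\<^sup>2 * e\<^sup>2) + (\<Sum>u\<in>Up. B * K\<^sup>2 * e\<^sup>2 + C0 * (2 * K\<^sup>2) * e\<^sup>2)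
      = real (card Up) * ((B * K\<^sup>2 + C0 * (2 * K\<^sup>2) + C0 * K\<^sup>2) * e\<^sup>2)" by (simp add: algebra_simps)
    also have "\<dots> \<le> N * ((B * K\<^sup>2 + C0 * (2 * K\<^sup>2) + C0 * K\<^sup>2) * e\<^sup>2)"
      using B C0(1) cardUp by (intro mult_right_mono mult_nonneg_nonneg add_nonneg_nonneg) auto
    also have "\<dots> = C * e\<^sup>2" by (simp add: C_def)
    finally show "vol ?Q \<le> vol ?P + C * e\<^sup>2" by simp
  qed
qed

end

section \<open>From balanced caps to central symmetry\<close>

lemma measure_scaleR_image:
  fixes S :: "'a::euclidean_space set"
  shows "vol ((\<lambda>x. c *\<^sub>R x) ` S) = \<bar>c\<bar> ^ DIM('a) * vol S"
  using measure_lebesgue_affine[of c 0 S] by simp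

context facet_normals
begin

lemma difference_body_measure_le:
  assumes bal: "\<And>u \<tau>. u \<in> U \<Longrightarrow> 0 < \<tau> \<Longrightarrow> \<tau> < \<tau>0 \<Longrightarrow> vol (cap h u \<tau>) - vol (cap h (- u) \<tau>) \<le> B * \<tau>\<^sup>2"
    and t0: "\<tau>0 > 0" and B: "B \<ge> 0"
  shows "vol (minkowski_sum (poly h) (uminus ` poly h)) \<le> 2 ^ DIM('a) * vol (poly h)"
proof -
  let ?n = "DIM('a)" and ?P = "poly h"
  define M where "M = minkowski_sum ?P (uminus ` ?P)"
  \<comment> \<open>\<open>k u\<close> equals \<open>(h u + h (- u)) / 2 - h u\<close>, the change
    in the height of the bounding hyperplane on passing from P to D = (P - P) / 2.\<close>
  define k where "k u = (h (- u) - h u) / 2" for u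
  have odd: "k (- u) = - k u" for u by (simp add: k_def field_simps)
  obtain C e0 where C: "C \<ge> 0" "e0 > 0"
    "\<And>e. 0 < e \<Longrightarrow> e < e0 \<Longrightarrow> vol (poly (\<lambda>u. h u + e * k u) \<inter> cball 0 R) \<le> vol ?P + C * e\<^sup>2"
    by (rule odd_perturbation_measure_le[of k, OF odd bal t0 B]) blast+
  have P: "compact ?P" "convex ?P" "?P \<noteq> {}"
    using compact_poly_h convex_poly poly_h_measure_pos by auto
  have Mc: "compact M" unfolding M_def by (intro compact_minkowski_sum P compact_negations)
  have Mconv: "convex M"
  proof -
    have "M = (\<Union>x\<in>?P. \<Union>y\<in>uminus ` ?P. {x + y})" unfolding M_def minkowski_sum_def by blast
    then show ?thesis using convex_sums[OF P(2) convex_negations[OF P(2)]] by simp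
  qed
  have Mne: "M \<noteq> {}" using P(3) unfolding M_def minkowski_sum_def by auto
  obtain v where v: "v \<ge> 0" "v ^ ?n = vol ?P" using power_root_exists[OF measure_nonneg, of ?n] by auto
  obtain w where w: "w \<ge> 0" "w ^ ?n = vol M" using power_root_exists[OF measure_nonneg, of ?n] by auto
  have "v \<noteq> 0" using v(2) poly_h_measure_pos by (auto simp: power_0_left)
  then have vpos: "v > 0" using v(1) by simp
  have "w \<le> 2 * v"
  proof (rule ccontr)
    assume "\<not> w \<le> 2 * v"
    \<comment> \<open>The rate at which Brunn-Minkowski forces the root of the volume to grow, since
      \<open>(1 - e) * v + (e / 2) * w = v + e * d\<close>. If \<open>d > 0\<close>, the volume
      grows to first order.\<close>
    define d where "d = w / 2 - v"
    have d: "d > 0" using \<open>\<not> w \<le> 2 * v\<close> by (simp add: d_def)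
    have growth: "v ^ ?n + real ?n * e * d * v ^ ?n / v \<le> v ^ ?n + C * e\<^sup>2" if e: "0 < e" "e < e0" "e < 1" for e
    proof -
      let ?A = "(\<lambda>x. (1 - e) *\<^sub>R x) ` ?P" and ?B = "(\<lambda>x. (e / 2) *\<^sub>R x) ` M"
      have "0 \<le> e * d / v" using e d vpos by simp
      then have ge: "-1 \<le> e * d / v" by linarith
      have "v ^ ?n + real ?n * e * d * v ^ ?n / v = v ^ ?n * (1 + real ?n * (e * d / v))"
        using vpos by (simp add: field_simps)
      also have "\<dots> \<le> v ^ ?n * (1 + e * d / v) ^ ?n"
        by (rule mult_left_mono[OF Bernoulli_inequality[OF ge]]) (use vpos in simp)
      also have "\<dots> = (v + e * d) ^ ?n" using vpos by (simp add: power_mult_distrib[symmetric] field_simps)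
      also have "v + e * d = (1 - e) * v + (e / 2) * w" by (simp add: d_def field_simps)
      also have "((1 - e) * v + (e / 2) * w) ^ ?n \<le> vol (minkowski_sum ?A ?B)"
        using e v w P Mc Mconv Mne
        by (intro brunn_minkowski_convex compact_scaling convex_scaling)
          (auto simp: measure_scaleR_image power_mult_distrib power_divide)
      also have "\<dots> \<le> vol (poly (\<lambda>u. h u + e * k u) \<inter> cball 0 R)"
      proof (rule measure_mono_fmeasurable)
        show "minkowski_sum ?A ?B \<in> sets lebesgue"
          by (intro fmeasurableD lmeasurable_compact compact_minkowski_sum compact_scaling P Mc)
        show "poly (\<lambda>u. h u + e * k u) \<inter> cball 0 R \<in> lmeasurable"
          by (intro lmeasurable_compact closed_Int_compact closed_poly compact_cball)
        show "minkowski_sum ?A ?B \<subseteq> poly (\<lambda>u. h u + e * k u) \<inter> cball 0 R"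
        proof
          fix z assume "z \<in> minkowski_sum ?A ?B"
          then obtain p q r where z: "p \<in> ?P" "q \<in> ?P" "r \<in> ?P" "z = (1 - e) *\<^sub>R p + (e / 2) *\<^sub>R (q - r)"
            unfolding M_def by (auto elim!: minkowski_sumE)
          have "u \<bullet> z \<le> h u + e * k u" if u: "u \<in> U" for u
          proof -
            have "u \<bullet> p \<le> h u" "u \<bullet> q \<le> h u" "(- u) \<bullet> r \<le> h (- u)" using z u uminus_U unfolding poly_def by blast+
            then have "(1 - e) * (u \<bullet> p) \<le> (1 - e) * h u" "(e / 2) * (u \<bullet> q - u \<bullet> r) \<le> (e / 2) * (h u + h (- u))"
              using e by (auto intro!: mult_left_mono)
            then show ?thesis unfolding z(4) by (simp add: inner_add_right inner_diff_right k_def field_simps)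
          qed
          moreover have "norm z \<le> R"
          proof -
            have "norm (q - r) \<le> R + R"
              using norm_triangle_ineq4[of q r] norm_poly_h[OF z(2)] norm_poly_h[OF z(3)] by linarith
            have "norm z \<le> norm ((1 - e) *\<^sub>R p) + norm ((e / 2) *\<^sub>R (q - r))" unfolding z(4) by (rule norm_triangle_ineq)
            also have "\<dots> \<le> (1 - e) * R + (e / 2) * (R + R)"
              using e norm_poly_h[OF z(1)] \<open>norm (q - r) \<le> R + R\<close>
              by (intro add_mono) (auto intro!: mult_left_mono)
            also have "\<dots> = R" by (simp add: field_simps)
            finally show ?thesis .
          qed
          ultimately show "z \<in> poly (\<lambda>u. h u + e * k u) \<inter> cball 0 R" by (simp add: poly_def)
        qed
      qed
      also have "\<dots> \<le> v ^ ?n + C * e\<^sup>2" using C(3)[OF e(1,2)] v by simp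
      finally show ?thesis .
    qed
    define a where "a = real ?n * d * v ^ ?n / v"
    have a: "a > 0" using vpos d by (simp add: a_def)
    \<comment> \<open>Small enough for the quadratic error to be at most half of the linear gain
      \<open>a * e\<close>.\<close>
    define e where "e = Min {e0 / 2, 1 / 2, a / (2 * (C + 1))}"
    have e: "0 < e" "e < e0" "e < 1" "e \<le> a / (2 * (C + 1))" using C a by (auto simp: e_def)
    have "a * e \<le> C * e\<^sup>2" using growth[OF e(1-3)] by (simp add: a_def field_simps)
    then have "a \<le> C * e" using e(1) by (simp add: power2_eq_square)
    also have "\<dots> \<le> (C + 1) * (a / (2 * (C + 1)))" using e C by (intro mult_mono) auto
    also have "\<dots> = a / 2" using C(1) add_nonneg_pos[OF C(1) zero_less_one] by (simp add: divide_simps)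
    finally show False using a by simp
  qed
  then have "w ^ ?n \<le> (2 * v) ^ ?n" using w by (intro power_mono) auto
  then show ?thesis using v w by (simp add: M_def power_mult_distrib)
qed

text \<open>In every direction of \<open>U\<close> the equality case places the centroid
  \<open>g\<close> halfway between the two bounding hyperplanes, so reflection in \<open>g\<close>
  exchanges the half-spaces of \<open>u\<close> and \<open>- u\<close>. \<open>sharp\<close>
  provides the extremal points for which the equality case is stated.\<close>

lemma balanced_imp_symmetric:
  assumes bal: "\<And>u \<tau>. u \<in> U \<Longrightarrow> 0 < \<tau> \<Longrightarrow> \<tau> < \<tau>0 \<Longrightarrow> vol (cap h u \<tau>) - vol (cap h (- u) \<tau>) \<le> B * \<tau>\<^sup>2"
    and t0: "\<tau>0 > 0" and B: "B \<ge> 0"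
    and sharp: "\<And>u. u \<in> U \<Longrightarrow> \<exists>x\<in>poly h. u \<bullet> x = h u"
  shows "centrally_symmetric (poly h)"
proof -
  let ?P = "poly h"
  define V where "V = vol ?P"
  have V: "V > 0" using poly_h_measure_pos by (simp add: V_def)
  define g where "g = (1 / V) *\<^sub>R integral\<^sup>L (lebesgue_on ?P) (\<lambda>x. x)"
  have hg: "h u - h (- u) = 2 * (u \<bullet> g)" if u: "u \<in> U" for u
  proof -
    obtain x1 where x1: "x1 \<in> ?P" "u \<bullet> x1 = h u" using sharp[OF u] by blast
    obtain x0 where x0: "x0 \<in> ?P" "u \<bullet> x0 = - h (- u)" using sharp[OF uminus_U[OF u]] by (metis inner_minus_left minus_minus)
    have "u \<bullet> x0 \<le> u \<bullet> x \<and> u \<bullet> x \<le> u \<bullet> x1" if "x \<in> ?P" for x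
    proof -
      have "u \<bullet> x \<le> h u" "(- u) \<bullet> x \<le> h (- u)" using that u uminus_U[OF u] unfolding poly_def by blast+
      then show ?thesis using x0 x1 by simp
    qed
    from difference_body_equality[OF compact_poly_h convex_poly poly_h_measure_pos norm_U[OF u] x0(1) x1(1) this
      difference_body_measure_le[OF bal t0 B]]
    have "(h u - h (- u)) * V = 2 * (u \<bullet> integral\<^sup>L (lebesgue_on ?P) (\<lambda>x. x))"
      using x0 x1 by (simp add: V_def algebra_simps)
    then show ?thesis using V by (simp add: g_def field_simps)
  qed
  have refl: "2 *\<^sub>R g - x \<in> ?P" if x: "x \<in> ?P" for x
    unfolding poly_def
  proof (intro CollectI ballI)
    fix u assume u: "u \<in> U"
    have "(- u) \<bullet> x \<le> h (- u)" using x uminus_U[OF u] unfolding poly_def by blast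
    then show "u \<bullet> (2 *\<^sub>R g - x) \<le> h u" using hg[OF u] by (simp add: inner_diff_right)
  qed
  have "(\<lambda>y. g - y) ` ?P = (\<lambda>y. y - g) ` ?P"
  proof (intro equalityI subsetI; elim imageE)
    fix z y assume y: "y \<in> ?P" "z = g - y"
    then show "z \<in> (\<lambda>y. y - g) ` ?P" using refl[OF y(1)] by (intro image_eqI[of _ _ "2 *\<^sub>R g - y"]) (auto simp: scaleR_2)
  next
    fix z y assume y: "y \<in> ?P" "z = y - g"
    then show "z \<in> (\<lambda>y. g - y) ` ?P" using refl[OF y(1)] by (intro image_eqI[of _ _ "2 *\<^sub>R g - y"]) (auto simp: scaleR_2)
  qed
  then show ?thesis unfolding centrally_symmetric_def by blast
qed

text \<open>Minkowski's theorem for the pair \<open>P\<close>, \<open>- P\<close>.\<close>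

theorem unbalanced_facet:
  assumes sharp: "\<And>u. u \<in> U \<Longrightarrow> \<exists>x\<in>poly h. u \<bullet> x = h u"
    and asym: "\<not> centrally_symmetric (poly h)"
  obtains u c \<tau>1 where "u \<in> U" "c > 0" "\<tau>1 > 0"
    "\<And>\<tau>. 0 < \<tau> \<Longrightarrow> \<tau> < \<tau>1 \<Longrightarrow> c * \<tau> \<le> \<bar>vol (cap h u \<tau>) - vol (cap h (- u) \<tau>)\<bar>"
proof (rule ccontr)
  assume neg: "\<not> thesis"
  note found = that
  obtain C where C: "C \<ge> 0"
    "\<And>u p \<alpha> q \<beta>. u \<in> U \<Longrightarrow> \<alpha> \<ge> 0 \<Longrightarrow> \<beta> \<ge> 0 \<Longrightarrow> vol (rim u p \<alpha> q \<beta>) \<le> C * (\<alpha> * \<beta>)"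
    "\<And>u p \<alpha>. u \<in> U \<Longrightarrow> \<alpha> \<ge> 0 \<Longrightarrow> vol {x \<in> cball 0 R. p < u \<bullet> x \<and> u \<bullet> x \<le> p + \<alpha>} \<le> C * \<alpha>"
    by (rule rim_measure_le) blast
  obtain \<omega> where w: "\<omega> > 0" "\<And>u. u \<in> U \<Longrightarrow> h u + h (- u) \<ge> \<omega>" by (rule width_pos) blast
  define D where "D u \<tau> = vol (cap h u \<tau>) - vol (cap h (- u) \<tau>)" for u \<tau>
  have absD: "\<bar>D u \<tau>\<bar> \<le> (2 * C) * \<tau>\<^sup>2" if u: "u \<in> U" and t: "0 < \<tau>" "\<tau> < \<omega>" for u \<tau>
  proof (rule quasi_additive_dichotomy[of "2 * C" \<omega> "D u" \<tau>])
    have u': "- u \<in> U" by (rule uminus_U[OF u])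
    fix \<tau> :: real assume t: "\<tau> > 0"
    have "\<bar>D u \<tau>\<bar> \<le> C * \<tau>"
      using cap_measure_le[OF u _ poly_h_subset C(3), of \<tau>] cap_measure_le[OF u' _ poly_h_subset C(3), of \<tau>] t
        measure_nonneg[of lebesgue "cap h u \<tau>"] measure_nonneg[of lebesgue "cap h (- u) \<tau>"]
      unfolding D_def by linarith
    also have "\<dots> \<le> 2 * C * \<tau>" using C(1) t by simp
    finally show "\<bar>D u \<tau>\<bar> \<le> 2 * C * \<tau>" .
    fix \<sigma> :: real assume s: "\<sigma> > 0" "\<tau> + \<sigma> < \<omega>"
    have "\<bar>vol (cap h u (\<tau> + \<sigma>)) - vol (cap h u \<tau>) - vol (cap h u \<sigma>)\<bar> \<le> C * (\<tau> * \<sigma>)"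
      using w(2)[OF u] s by (intro cap_quasi_additive[OF u t s(1) _ C(2)]) auto
    moreover have "\<bar>vol (cap h (- u) (\<tau> + \<sigma>)) - vol (cap h (- u) \<tau>) - vol (cap h (- u) \<sigma>)\<bar> \<le> C * (\<tau> * \<sigma>)"
      using w(2)[OF u'] s by (intro cap_quasi_additive[OF u' t s(1) _ C(2)]) auto
    ultimately show "\<bar>D u (\<tau> + \<sigma>) - D u \<tau> - D u \<sigma>\<bar> \<le> 2 * C * (\<tau> * \<sigma>)" unfolding D_def by linarith
  next
    fix c \<tau>1 :: real assume c: "c > 0" "\<tau>1 > 0"
    \<comment> \<open>The negation is a linear lower bound for the difference of the two caps, which
      is what the theorem claims to exist.\<close>
    show "\<exists>\<sigma>. 0 < \<sigma> \<and> \<sigma> < \<tau>1 \<and> \<bar>D u \<sigma>\<bar> < c * \<sigma>"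
    proof (rule ccontr)
      assume no: "\<not> (\<exists>\<sigma>. 0 < \<sigma> \<and> \<sigma> < \<tau>1 \<and> \<bar>D u \<sigma>\<bar> < c * \<sigma>)"
      have "c * \<tau> \<le> \<bar>vol (cap h u \<tau>) - vol (cap h (- u) \<tau>)\<bar>" if "0 < \<tau>" "\<tau> < \<tau>1" for \<tau>
        using no that unfolding D_def[symmetric] not_less[symmetric] by blast
      from found[OF u c this] show False using neg by simp
    qed
  qed (use C w t in auto)
  have "vol (cap h u \<tau>) - vol (cap h (- u) \<tau>) \<le> (2 * C) * \<tau>\<^sup>2"
    if "u \<in> U" "0 < \<tau>" "\<tau> < \<omega>" for u \<tau>
    using abs_le_D1[OF absD[OF that]] unfolding D_def .
  from balanced_imp_symmetric[OF this w(1) _ sharp] have "centrally_symmetric (poly h)" using C(1) by simp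
  with asym show False by simp
qed

end

section \<open>Fourier transforms of polytopes\<close>

lemma norm_cis_diff_le: "norm (cis a - cis b) \<le> \<bar>a - b\<bar>"
proof -
  have "cis a - cis b = cis b * (cis (a - b) - 1)" by (simp add: right_diff_distrib cis_mult)
  then have "norm (cis a - cis b) = norm (cis (a - b) - 1)" by (simp add: norm_mult)
  also have "\<dots> = 2 * \<bar>sin ((a - b) / 2)\<bar>" using dist_exp_i_1[of "a - b"] by (simp add: cis_conv_exp)
  also have "\<dots> \<le> \<bar>a - b\<bar>" using abs_sin_le_one abs_sin_x_le_abs_x[of "(a - b) / 2"] by simp
  finally show ?thesis .
qed

text \<open>The exponent carries a plus sign: this is the usual Fourier transform of the indicator
  function at \<open>- l\<close>, which explains the sign in \<open>ambiguity\<close>.\<close>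

definition fourier_set :: "'a::euclidean_space set \<Rightarrow> 'a \<Rightarrow> complex" where
  "fourier_set E l = (LINT x|lebesgue. indicator E x *\<^sub>R cis (2 * pi * (l \<bullet> x)))"

lemma cis_inner_borel [measurable]: "(\<lambda>x::'a::euclidean_space. cis (2 * pi * (l \<bullet> x))) \<in> borel_measurable borel"
  by (intro borel_measurable_continuous_onI continuous_intros)

lemma fourier_set_integrable:
  fixes E :: "'a::euclidean_space set"
  assumes "E \<in> lmeasurable"
  shows "integrable lebesgue (\<lambda>x. indicator E x *\<^sub>R cis (2 * pi * (l \<bullet> x)))"
proof (rule Bochner_Integration.integrable_bound)
  show "integrable lebesgue (indicator E :: 'a \<Rightarrow> real)"
    using assms by (intro integrable_real_indicator) (auto simp: fmeasurable_def)
  have [measurable]: "E \<in> sets lebesgue" using assms by auto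
  have "(\<lambda>x::'a. cis (2 * pi * (l \<bullet> x))) \<in> borel_measurable lebesgue"
    using cis_inner_borel[of l] by (intro measurable_completion) simp
  then show "(\<lambda>x. indicator E x *\<^sub>R cis (2 * pi * (l \<bullet> x))) \<in> borel_measurable lebesgue" by measurable
qed (auto simp: indicator_def)

lemma norm_fourier_set_le:
  assumes "E \<in> lmeasurable" shows "norm (fourier_set E l) \<le> vol E"
proof -
  have "norm (fourier_set E l) \<le> (LINT x|lebesgue. norm (indicator E x *\<^sub>R cis (2 * pi * (l \<bullet> x))))"
    unfolding fourier_set_def by (rule integral_norm_bound)
  also have "\<dots> = (LINT x|lebesgue. indicator E x)" by (rule Bochner_Integration.integral_cong) (auto simp: indicator_def)
  finally show ?thesis using assms by (simp add: fmeasurable_def)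
qed

lemma fourier_set_Un:
  assumes "A \<in> lmeasurable" "B \<in> lmeasurable" "A \<inter> B = {}"
  shows "fourier_set (A \<union> B) l = fourier_set A l + fourier_set B l"
proof -
  have "fourier_set (A \<union> B) l = (LINT x|lebesgue. indicator A x *\<^sub>R cis (2 * pi * (l \<bullet> x)) + indicator B x *\<^sub>R cis (2 * pi * (l \<bullet> x)))"
    unfolding fourier_set_def using assms(3) by (intro Bochner_Integration.integral_cong) (auto simp: indicator_def)
  then show ?thesis
    by (simp add: fourier_set_def Bochner_Integration.integral_add fourier_set_integrable assms)
qed

lemma fourier_set_split:
  assumes "A \<in> lmeasurable" "B \<in> lmeasurable"
  shows "fourier_set A l = fourier_set (A \<inter> B) l + fourier_set (A - B) l"
proof -
  have "A = (A \<inter> B) \<union> (A - B)" "(A \<inter> B) \<inter> (A - B) = {}" by auto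
  then show ?thesis using fourier_set_Un[of "A \<inter> B" "A - B" l] assms by (simp add: fmeasurable.Int fmeasurable.Diff Int_Diff)
qed

lemma norm_fourier_set_diff_le:
  assumes "A \<in> lmeasurable" "B \<in> lmeasurable"
  shows "norm (fourier_set A l - fourier_set B l) \<le> vol (A - B) + vol (B - A)"
proof -
  have "fourier_set A l - fourier_set B l = fourier_set (A - B) l - fourier_set (B - A) l"
    using fourier_set_split[OF assms, of l] fourier_set_split[OF assms(2,1), of l] by (simp add: Int_commute)
  also have "norm \<dots> \<le> norm (fourier_set (A - B) l) + norm (fourier_set (B - A) l)" by (rule norm_triangle_ineq4)
  also have "\<dots> \<le> vol (A - B) + vol (B - A)"
    using assms by (intro add_mono norm_fourier_set_le fmeasurable.Diff) auto
  finally show ?thesis .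
qed

lemma mem_translation_iff: "x \<in> (+) s ` S \<longleftrightarrow> x - s \<in> S" for x s :: "'a::ab_group_add"
  by (force simp: image_iff intro: bexI[of _ "x - s"])

lemma borel_translation:
  fixes E :: "'a::euclidean_space set"
  assumes "E \<in> sets borel" shows "(+) a ` E \<in> sets borel"
proof -
  have "(+) a ` E = (\<lambda>x. x - a) -` E \<inter> space borel" by (auto simp: mem_translation_iff)
  also have "\<dots> \<in> sets borel" using assms by (intro measurable_sets[of _ borel borel]) auto
  finally show ?thesis .
qed

lemma integral_lebesgue_translation:
  fixes f :: "'a::euclidean_space \<Rightarrow> 'b::{banach, second_countable_topology}"
  assumes [measurable]: "f \<in> borel_measurable borel"
  shows "integral\<^sup>L lebesgue f = integral\<^sup>L lebesgue (\<lambda>x. f (a + x))"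
proof -
  have "integral\<^sup>L lborel f = integral\<^sup>L (distr lborel borel ((+) a)) f" by (simp add: lborel_distr_plus)
  also have "\<dots> = integral\<^sup>L lborel (\<lambda>x. f (a + x))" by (subst integral_distr) auto
  finally show ?thesis by (simp add: integral_completion)
qed

lemma fourier_set_translation:
  fixes E :: "'a::euclidean_space set"
  assumes [measurable]: "E \<in> sets borel"
  shows "fourier_set ((+) a ` E) l = cis (2 * pi * (l \<bullet> a)) * fourier_set E l"
proof -
  have [measurable]: "(+) a ` E \<in> sets borel" by (rule borel_translation[OF assms])
  have "fourier_set ((+) a ` E) l = (LINT x|lebesgue. indicator ((+) a ` E) (a + x) *\<^sub>R cis (2 * pi * (l \<bullet> (a + x))))"
    unfolding fourier_set_def by (subst integral_lebesgue_translation[where a = a]) simp_all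
  also have "\<dots> = (LINT x|lebesgue. cis (2 * pi * (l \<bullet> a)) * (indicator E x *\<^sub>R cis (2 * pi * (l \<bullet> x))))"
    by (intro Bochner_Integration.integral_cong) (auto simp: indicator_def inner_add_right cis_mult distrib_left)
  finally show ?thesis by (simp only: fourier_set_def integral_mult_right_zero)
qed

lemma measure_Diff_translation_eq:
  fixes E :: "'a::euclidean_space set"
  assumes "E \<in> lmeasurable"
  shows "vol ((+) s ` E - E) = vol (E - (+) s ` E)"
proof -
  have L: "(+) s ` E \<in> lmeasurable" by (rule measurable_translation[OF assms])
  have split: "vol A = vol (A \<inter> B) + vol (A - B)"
    if "A \<in> lmeasurable" "B \<in> lmeasurable" for A B :: "'a set"
    using measure_Un3[of "A \<inter> B" lebesgue "A - B"] that
    by (simp add: fmeasurable.Int fmeasurable.Diff Int_Diff_disjoint Int_Diff_Un)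
  show ?thesis using split[OF assms L] split[OF L assms] by (simp add: measure_translation Int_commute)
qed

text \<open>Translation by half a period changes the sign of the coefficient, so twice the
  coefficient is the difference of those of \<open>E\<close> and of its translate; what the two sets
  share drops out.\<close>

lemma norm_fourier_set_half_period:
  fixes E :: "'a::euclidean_space set"
  assumes E: "E \<in> sets borel" "E \<in> lmeasurable" and s: "l \<bullet> s = 1 / 2"
  shows "norm (fourier_set E l) \<le> vol (E - (+) s ` E)"
proof -
  have neg: "fourier_set ((+) s ` E) l = - fourier_set E l"
    by (simp add: fourier_set_translation E s)
  have "2 * norm (fourier_set E l) = norm (2 * fourier_set E l)" by (simp add: norm_mult)
  also have "norm (2 * fourier_set E l) = norm (fourier_set E l - fourier_set ((+) s ` E) l)" unfolding neg by simp
  also have "\<dots> \<le> vol (E - (+) s ` E) + vol ((+) s ` E - E)"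
    by (intro norm_fourier_set_diff_le E measurable_translation)
  finally show ?thesis using measure_Diff_translation_eq[OF E(2)] by simp
qed

lemma norm_fourier_set_const_phase:
  fixes E :: "'a::euclidean_space set"
  assumes E: "E \<in> lmeasurable" and c: "\<And>x. x \<in> E \<Longrightarrow> \<bar>l \<bullet> x - c\<bar> \<le> \<delta>"
  shows "norm (fourier_set E l - of_real (vol E) * cis (2 * pi * c)) \<le> 2 * pi * \<delta> * vol E"
proof -
  have int1: "integrable lebesgue (\<lambda>x. indicator E x *\<^sub>R cis (2 * pi * c))"
    using E by (intro integrable_scaleR_left integrable_real_indicator) (auto simp: fmeasurable_def)
  have "of_real (vol E) * cis (2 * pi * c) = (LINT x|lebesgue. indicator E x *\<^sub>R cis (2 * pi * c))"
    using E by (subst integral_scaleR_left) (auto simp: fmeasurable_def scaleR_conv_of_real intro: integrable_real_indicator)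
  then have "fourier_set E l - of_real (vol E) * cis (2 * pi * c)
      = (LINT x|lebesgue. indicator E x *\<^sub>R cis (2 * pi * (l \<bullet> x)) - indicator E x *\<^sub>R cis (2 * pi * c))"
    unfolding fourier_set_def using int1 fourier_set_integrable[OF E] by simp
  also have "norm \<dots> \<le> (LINT x|lebesgue. indicator E x * (2 * pi * \<delta>))"
  proof (rule Bochner_Integration.integral_norm_bound_integral)
    show "integrable lebesgue (\<lambda>x. indicator E x * (2 * pi * \<delta>))"
      using E by (intro integrable_mult_left integrable_real_indicator) (auto simp: fmeasurable_def)
    fix x :: 'a
    show "norm (indicator E x *\<^sub>R cis (2 * pi * (l \<bullet> x)) - indicator E x *\<^sub>R cis (2 * pi * c)) \<le> indicator E x * (2 * pi * \<delta>)"
    proof (cases "x \<in> E")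
      case True
      have "norm (cis (2 * pi * (l \<bullet> x)) - cis (2 * pi * c)) \<le> \<bar>2 * pi * (l \<bullet> x) - 2 * pi * c\<bar>" by (rule norm_cis_diff_le)
      also have "\<dots> = 2 * pi * \<bar>l \<bullet> x - c\<bar>" by (simp add: abs_mult flip: right_diff_distrib)
      also have "\<dots> \<le> 2 * pi * \<delta>" using c[OF True] by simp
      finally show ?thesis using True by simp
    qed simp
  qed (use int1 fourier_set_integrable[OF E] in auto)
  also have "\<dots> = 2 * pi * \<delta> * vol E"
    using E by (simp add: fmeasurable_def)
  finally show ?thesis .
qed

lemma fourier_set_finite_UN:
  assumes "finite I" "\<And>i. i \<in> I \<Longrightarrow> A i \<in> lmeasurable" "disjoint_family_on A I"
  shows "fourier_set (\<Union>i\<in>I. A i) l = (\<Sum>i\<in>I. fourier_set (A i) l)"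
  using assms
proof (induction I rule: finite_induct)
  case empty then show ?case by (simp add: fourier_set_def)
next
  case (insert i I)
  have "A i \<inter> (\<Union>i\<in>I. A i) = {}" using insert.prems(2) insert.hyps(2) by (fastforce simp: disjoint_family_on_def)
  moreover have "(\<Union>i\<in>I. A i) \<in> lmeasurable" using insert by (intro fmeasurable.finite_UN) auto
  ultimately have "fourier_set (A i \<union> (\<Union>i\<in>I. A i)) l = fourier_set (A i) l + fourier_set (\<Union>i\<in>I. A i) l"
    using insert.prems by (intro fourier_set_Un) auto
  moreover have "fourier_set (\<Union>i\<in>I. A i) l = (\<Sum>i\<in>I. fourier_set (A i) l)"
    using insert.prems by (intro insert.IH) (auto simp: disjoint_family_on_def)
  ultimately show ?case using insert.hyps by simp
qed

text \<open>Removing the overlaps \<open>E i\<close> makes the sets disjoint. This is paid for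
  twice, once in the union and once in the separate terms.\<close>

lemma norm_fourier_set_UN_diff_sum:
  fixes A :: "'b \<Rightarrow> 'a::euclidean_space set"
  assumes I: "finite I" and A: "\<And>i. i \<in> I \<Longrightarrow> A i \<in> lmeasurable" and E: "\<And>i. i \<in> I \<Longrightarrow> E i \<in> lmeasurable"
    and ov: "\<And>i j. i \<in> I \<Longrightarrow> j \<in> I \<Longrightarrow> i \<noteq> j \<Longrightarrow> A i \<inter> A j \<subseteq> E i"
  shows "norm (fourier_set (\<Union>i\<in>I. A i) l - (\<Sum>i\<in>I. fourier_set (A i) l)) \<le> 2 * (\<Sum>i\<in>I. vol (E i))"
proof -
  let ?B = "\<lambda>i. A i - E i"
  have B: "?B i \<in> lmeasurable" if "i \<in> I" for i using A[OF that] E[OF that] by auto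
  have "disjoint_family_on ?B I" using ov by (fastforce simp: disjoint_family_on_def)
  then have eq: "fourier_set (\<Union>i\<in>I. ?B i) l = (\<Sum>i\<in>I. fourier_set (?B i) l)" by (intro fourier_set_finite_UN I B)
  have U: "(\<Union>i\<in>I. A i) \<in> lmeasurable" "(\<Union>i\<in>I. ?B i) \<in> lmeasurable" "(\<Union>i\<in>I. E i) \<in> lmeasurable"
    using I A B E by (auto intro!: fmeasurable.finite_UN)
  have "norm (fourier_set (\<Union>i\<in>I. A i) l - fourier_set (\<Union>i\<in>I. ?B i) l)
      \<le> vol ((\<Union>i\<in>I. A i) - (\<Union>i\<in>I. ?B i)) + vol ((\<Union>i\<in>I. ?B i) - (\<Union>i\<in>I. A i))"
    by (rule norm_fourier_set_diff_le[OF U(1,2)])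
  also have "(\<Union>i\<in>I. ?B i) - (\<Union>i\<in>I. A i) = {}" by auto
  also have "vol ((\<Union>i\<in>I. A i) - (\<Union>i\<in>I. ?B i)) \<le> vol (\<Union>i\<in>I. E i)"
    using U by (intro measure_mono_fmeasurable) auto
  also have "\<dots> \<le> (\<Sum>i\<in>I. vol (E i))" using I E by (intro measure_UNION_le) auto
  finally have 1: "norm (fourier_set (\<Union>i\<in>I. A i) l - fourier_set (\<Union>i\<in>I. ?B i) l) \<le> (\<Sum>i\<in>I. vol (E i))" by simp
  have "norm (fourier_set (?B i) l - fourier_set (A i) l) \<le> vol (E i)" if i: "i \<in> I" for i
  proof -
    have "norm (fourier_set (?B i) l - fourier_set (A i) l) \<le> vol (?B i - A i) + vol (A i - ?B i)"
      by (rule norm_fourier_set_diff_le[OF B[OF i] A[OF i]])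
    also have "?B i - A i = {}" by auto
    also have "vol (A i - ?B i) \<le> vol (E i)"
      using A[OF i] B[OF i] E[OF i] by (intro measure_mono_fmeasurable) auto
    finally show ?thesis by simp
  qed
  then have 2: "norm (\<Sum>i\<in>I. fourier_set (?B i) l - fourier_set (A i) l) \<le> (\<Sum>i\<in>I. vol (E i))"
    by (rule sum_norm_le)
  have "norm (fourier_set (\<Union>i\<in>I. A i) l - (\<Sum>i\<in>I. fourier_set (A i) l))
    = norm ((fourier_set (\<Union>i\<in>I. A i) l - fourier_set (\<Union>i\<in>I. ?B i) l) + (\<Sum>i\<in>I. fourier_set (?B i) l - fourier_set (A i) l))"
    unfolding eq by (simp add: sum_subtractf)
  also have "\<dots> \<le> (\<Sum>i\<in>I. vol (E i)) + (\<Sum>i\<in>I. vol (E i))"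
    by (rule norm_triangle_mono[OF 1 2])
  finally show ?thesis by simp
qed

section \<open>Shells and caps at large frequencies\<close>

context facet_normals
begin

lemma poly_borel: "poly k \<in> sets borel"
  by (simp add: borel_closed closed_poly)

lemma poly_lmeasurable: "poly k \<subseteq> cball 0 R \<Longrightarrow> poly k \<in> lmeasurable"
  by (intro borel_bounded_lmeasurable poly_borel bounded_subset[OF bounded_cball])

text \<open>A point is uncovered by the translation exactly when \<open>x - s\<close> violates one
  of the constraints, so the exposed shell is a union of caps without any error term.\<close>

lemma poly_Diff_translation:
  "poly k - (+) s ` poly k = (\<Union>v\<in>{v\<in>U. v \<bullet> s < 0}. cap k v (- (v \<bullet> s)))"
proof (intro set_eqI iffI)
  fix x assume x: "x \<in> poly k - (+) s ` poly k"
  then obtain v where v: "v \<in> U" "k v < v \<bullet> x - v \<bullet> s"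
    by (auto simp: mem_translation_iff poly_def inner_diff_right not_le)
  moreover have "v \<bullet> x \<le> k v" using x v by (auto simp: poly_def)
  ultimately show "x \<in> (\<Union>v\<in>{v\<in>U. v \<bullet> s < 0}. cap k v (- (v \<bullet> s)))"
    using x by (auto simp: cap_def intro!: bexI[of _ v])
next
  fix x assume "x \<in> (\<Union>v\<in>{v\<in>U. v \<bullet> s < 0}. cap k v (- (v \<bullet> s)))"
  then obtain v where "v \<in> U" "x \<in> poly k" "k v < v \<bullet> (x - s)" by (auto simp: cap_def inner_diff_right)
  then show "x \<in> poly k - (+) s ` poly k" by (auto simp: mem_translation_iff poly_def not_le[symmetric])
qed

lemma parallel_gap:
  obtains c0 where "c0 > 0" "c0 \<le> 1" "\<And>u v. u \<in> U \<Longrightarrow> v \<in> U \<Longrightarrow> u \<noteq> v \<Longrightarrow> u \<noteq> - v \<Longrightarrow> (u \<bullet> v)\<^sup>2 \<le> 1 - c0"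
proof -
  \<comment> \<open>The extra element 1 covers the case that all normals are parallel and gives
    \<open>c0 \<le> 1\<close>.\<close>
  define S where "S = insert 1 ((\<lambda>(u, v). 1 - (u \<bullet> v)\<^sup>2) ` {(u, v) \<in> U \<times> U. u \<noteq> v \<and> u \<noteq> - v})"
  have S: "finite S" "S \<noteq> {}" unfolding S_def by (auto intro!: finite_subset[OF _ finite_cartesian_product[OF finite_U finite_U]])
  have "\<forall>s\<in>S. s > 0" unfolding S_def using unit_inner_square_less_1 norm_U by auto
  then have "Min S > 0" using S by simp
  moreover have "Min S \<le> 1 - (u \<bullet> v)\<^sup>2" if "u \<in> U" "v \<in> U" "u \<noteq> v" "u \<noteq> - v" for u v
    using S(1) that by (intro Min_le) (auto simp: S_def image_iff)
  moreover have "Min S \<le> 1" using S(1) by (intro Min_le) (auto simp: S_def)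
  ultimately show thesis using that[of "Min S"] by fastforce
qed

text \<open>
  For a facet that is not orthogonal to the frequency there is a half-period shift parallel to it,
  so its cap contributes only through its rim.
\<close>

lemma norm_fourier_cap_le:
  assumes C: "\<And>u p \<alpha> q \<beta>. u \<in> U \<Longrightarrow> \<alpha> \<ge> 0 \<Longrightarrow> \<beta> \<ge> 0 \<Longrightarrow> vol (rim u p \<alpha> q \<beta>) \<le> C * (\<alpha> * \<beta>)"
    and k: "poly k \<subseteq> cball 0 R" and v: "v \<in> U" and d: "d \<in> U" "d \<noteq> v" "d \<noteq> - v"
    and c0: "c0 > 0" "(d \<bullet> v)\<^sup>2 \<le> 1 - c0" and \<tau>: "0 \<le> \<tau>" "\<tau> \<le> T"
    and l: "norm (l - (\<sigma> * r) *\<^sub>R d) \<le> 1" "\<sigma> = 1 \<or> \<sigma> = - 1" "r * c0 \<ge> 2" and C0: "C \<ge> 0"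
  shows "norm (fourier_set (cap k v \<tau>) l) \<le> C * (T * (1 / (r * c0)))"
proof -
  \<comment> \<open>The projection of \<open>d\<close> to the hyperplane orthogonal to
    \<open>v\<close>. Up to an error of at most 1, \<open>l \<bullet> d'\<close> has modulus
    \<open>r * (d \<bullet> d')\<close>, which is at least \<open>r * c0\<close>; the bound
    \<open>r * c0 \<ge> 2\<close> absorbs the error.\<close>
  define d' where "d' = d - (d \<bullet> v) *\<^sub>R v"
  note dd = inner_U[OF d(1)] and vv = inner_U[OF v]
  have vd': "v \<bullet> d' = 0" by (simp add: d'_def inner_diff_right vv inner_commute)
  have dd': "d \<bullet> d' = 1 - (d \<bullet> v)\<^sup>2" by (simp add: d'_def inner_diff_right dd power2_eq_square)
  have "d' \<bullet> d' = 1 - (d \<bullet> v)\<^sup>2" using dd' vd' by (simp add: d'_def inner_diff_left)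
  then have "(norm d')\<^sup>2 \<le> 1" by (simp add: power2_norm_eq_inner)
  then have nd': "norm d' \<le> 1" by (simp add: abs_square_le_1)
  have rpos: "r > 0" using l(3) c0(1) by (smt (verit) mult_nonpos_nonneg)
  define q where "q = (l - (\<sigma> * r) *\<^sub>R d) \<bullet> d'"
  have "l \<bullet> d' = \<sigma> * (r * (d \<bullet> d')) + q" by (simp add: q_def inner_diff_left)
  moreover have "\<bar>q\<bar> \<le> 1 * 1"
    unfolding q_def using Cauchy_Schwarz_ineq2[of "l - (\<sigma> * r) *\<^sub>R d" d'] mult_mono[OF l(1) nd'] by simp
  moreover have "r * (d \<bullet> d') \<ge> r * c0" using rpos c0 dd' by simp
  moreover have "\<sigma> * (r * (d \<bullet> d')) = r * (d \<bullet> d') \<or> \<sigma> * (r * (d \<bullet> d')) = - (r * (d \<bullet> d'))" using l(2) by auto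
  ultimately have ld: "\<bar>l \<bullet> d'\<bar> \<ge> r * c0 / 2" using l(3) by linarith
  have pos: "r * c0 / 2 > 0" using rpos c0 by simp
  then have ld0: "l \<bullet> d' \<noteq> 0" using ld by linarith
  \<comment> \<open>Half a period along \<open>d'\<close>: the shift is parallel to the facet of
    \<open>v\<close> and has length at most \<open>1 / (r * c0)\<close>.\<close>
  define s where "s = (1 / (2 * (l \<bullet> d'))) *\<^sub>R d'"
  have ls: "l \<bullet> s = 1 / 2" using ld0 by (simp add: s_def)
  have vs: "v \<bullet> s = 0" using vd' by (simp add: s_def)
  have ns: "norm s \<le> 1 / (r * c0)"
  proof -
    have "norm s = norm d' / (2 * \<bar>l \<bullet> d'\<bar>)" by (simp add: s_def abs_mult)
    also have "\<dots> \<le> 1 / (2 * (r * c0 / 2))" using nd' ld pos by (intro frac_le) auto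
    finally show ?thesis by simp
  qed
  let ?b = "1 / (r * c0)"
  have "norm (fourier_set (cap k v \<tau>) l) \<le> vol (cap k v \<tau> - (+) s ` cap k v \<tau>)"
    by (rule norm_fourier_set_half_period[OF cap_borel cap_lmeasurable[OF k] ls])
  also have "\<dots> \<le> vol (rim v (k v - T) T (\<lambda>w. k w - ?b) ?b)"
  proof (rule measure_mono_fmeasurable)
    show "cap k v \<tau> - (+) s ` cap k v \<tau> \<in> sets lebesgue"
      using cap_lmeasurable[OF k] by (intro sets.Diff fmeasurableD measurable_translation)
    show "cap k v \<tau> - (+) s ` cap k v \<tau> \<subseteq> rim v (k v - T) T (\<lambda>w. k w - ?b) ?b"
    proof
      fix x assume x: "x \<in> cap k v \<tau> - (+) s ` cap k v \<tau>"
      then have xk: "x \<in> poly k" "k v - \<tau> < v \<bullet> x" and "x - s \<notin> cap k v \<tau>" by (auto simp: cap_def mem_translation_iff)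
      then have "x - s \<notin> poly k" using vs by (simp add: cap_def inner_diff_right)
      then obtain w where w: "w \<in> U" "k w < w \<bullet> x - w \<bullet> s" by (auto simp: poly_def inner_diff_right not_le)
      have wk: "w \<bullet> x \<le> k w" "v \<bullet> x \<le> k v" using xk w v by (auto simp: poly_def)
      have "w \<noteq> v" "w \<noteq> - v" using w wk vs by auto
      moreover have "\<bar>w \<bullet> s\<bar> \<le> ?b" using Cauchy_Schwarz_ineq2[of w s] norm_U[OF w(1)] ns by simp
      ultimately show "x \<in> rim v (k v - T) T (\<lambda>w. k w - ?b) ?b"
        using w wk xk \<tau> k unfolding rim_def by (auto intro!: bexI[of _ w])
    qed
  qed (rule rim_lmeasurable)
  also have "\<dots> \<le> C * (T * ?b)" using \<tau> pos by (intro C v) auto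
  finally show ?thesis .
qed

text \<open>The shell exposed by a shift of \<open>\<eta> / r\<close> against \<open>d\<close>
  consists of caps that overlap only in rims. The cap at \<open>d\<close> is a fraction
  \<open>\<eta>\<close> of a wavelength thick, so the modulus of its coefficient is nearly its
  volume, which is of order \<open>\<eta> / r\<close> for a facet. Overlaps and all other caps cost
  terms quadratic in \<open>1 / r\<close>. The sign \<open>\<sigma>\<close> allows one frequency to
  be used at both \<open>u\<close> and \<open>- u\<close>.\<close>

lemma norm_fourier_shell_estimate:
  assumes C: "C \<ge> 0" "\<And>u p \<alpha> q \<beta>. u \<in> U \<Longrightarrow> \<alpha> \<ge> 0 \<Longrightarrow> \<beta> \<ge> 0 \<Longrightarrow> vol (rim u p \<alpha> q \<beta>) \<le> C * (\<alpha> * \<beta>)"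
    "\<And>u p \<alpha>. u \<in> U \<Longrightarrow> \<alpha> \<ge> 0 \<Longrightarrow> vol {x \<in> cball 0 R. p < u \<bullet> x \<and> u \<bullet> x \<le> p + \<alpha>} \<le> C * \<alpha>"
    and c0: "c0 > 0" "\<And>u v. u \<in> U \<Longrightarrow> v \<in> U \<Longrightarrow> u \<noteq> v \<Longrightarrow> u \<noteq> - v \<Longrightarrow> (u \<bullet> v)\<^sup>2 \<le> 1 - c0"
    and k: "poly k \<subseteq> cball 0 R" and d: "d \<in> U" and \<eta>: "0 < \<eta>" "\<eta> \<le> 1"
    and l: "norm (l - (\<sigma> * r) *\<^sub>R d) \<le> \<epsilon>" "\<epsilon> \<le> 1" "\<sigma> = 1 \<or> \<sigma> = - 1" "r * c0 \<ge> 2" and R: "R \<ge> 0"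
  shows "\<bar>norm (fourier_set (poly k - (+) (- ((\<eta> / r) *\<^sub>R d)) ` poly k) l) - vol (cap k d (\<eta> / r))\<bar>
    \<le> 2 * pi * (\<eta> + \<epsilon> * R) * (C * (\<eta> / r)) + (2 * C + C / c0) * real (card U) / r\<^sup>2"
proof -
  have rpos: "r > 0" using l(4) c0(1) by (smt (verit) mult_nonpos_nonneg)
  define \<tau> where "\<tau> = \<eta> / r"
  have \<tau>: "\<tau> > 0" "r * \<tau> = \<eta>" "\<tau> \<le> 1 / r" using \<eta> rpos by (auto simp: \<tau>_def divide_right_mono)
  define I where "I = {v\<in>U. v \<bullet> d > 0}"
  define A where "A v = cap k v (\<tau> * (v \<bullet> d))" for v
  define E where "E v = rim v (k v - \<tau>) \<tau> (\<lambda>w. k w - \<tau>) \<tau>" for v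
  have I: "finite I" "I \<subseteq> U" "d \<in> I" using finite_U d inner_U[OF d] by (auto simp: I_def)
  have cardI: "real (card I) \<le> real (card U)" using I finite_U by (simp add: card_mono)
  have X: "poly k - (+) (- (\<tau> *\<^sub>R d)) ` poly k = (\<Union>v\<in>I. A v)"
    unfolding poly_Diff_translation I_def A_def using \<tau>(1) by (simp add: zero_less_mult_iff)
  have vd: "0 < v \<bullet> d" "v \<bullet> d \<le> 1" if "v \<in> I" for v
    using that abs_inner_U[of v d] d by (auto simp: I_def)
  have t1: "0 \<le> \<tau> * (v \<bullet> d)" "\<tau> * (v \<bullet> d) \<le> \<tau>" if "v \<in> I" for v
    using vd[OF that] \<tau>(1) by (auto simp: mult_left_le)
  have AL: "A v \<in> lmeasurable" for v unfolding A_def by (rule cap_lmeasurable[OF k])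
  have EL: "E v \<in> lmeasurable" for v unfolding E_def by (rule rim_lmeasurable)
  have ov: "A v \<inter> A w \<subseteq> E v" if vw: "v \<in> I" "w \<in> I" "v \<noteq> w" for v w
  proof
    fix x assume x: "x \<in> A v \<inter> A w"
    have "w \<noteq> - v" using vd(1)[OF vw(1)] vd(1)[OF vw(2)] by auto
    moreover have "k z - \<tau> < z \<bullet> x" "z \<bullet> x \<le> k z" if "z \<in> I" "x \<in> A z" for z
      using that t1[of z] I(2) by (auto simp: A_def cap_def poly_def)
    moreover have "norm x \<le> R" using x k by (auto simp: A_def cap_def)
    ultimately show "x \<in> E v" using x vw I(2) unfolding E_def rim_def by (auto intro!: bexI[of _ w])
  qed
  have "norm (fourier_set (\<Union>v\<in>I. A v) l - (\<Sum>v\<in>I. fourier_set (A v) l)) \<le> 2 * (\<Sum>v\<in>I. vol (E v))"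
    by (rule norm_fourier_set_UN_diff_sum[OF I(1) AL EL ov])
  also have "(\<Sum>v\<in>I. vol (E v)) \<le> (\<Sum>v\<in>I. C * (1 / r * (1 / r)))"
  proof (rule sum_mono)
    fix v assume "v \<in> I"
    then have "vol (E v) \<le> C * (\<tau> * \<tau>)" unfolding E_def using I \<tau> by (intro C(2)) auto
    also have "\<dots> \<le> C * (1 / r * (1 / r))" using \<tau> C(1) rpos by (intro mult_left_mono mult_mono) auto
    finally show "vol (E v) \<le> C * (1 / r * (1 / r))" .
  qed
  finally have 1: "norm (fourier_set (\<Union>v\<in>I. A v) l - (\<Sum>v\<in>I. fourier_set (A v) l)) \<le> real (card I) * (2 * C / r\<^sup>2)"
    by (simp add: power2_eq_square ac_simps)
  have 2: "norm (\<Sum>v\<in>I - {d}. fourier_set (A v) l) \<le> (\<Sum>v\<in>I - {d}. C * (1 / r * (1 / (r * c0))))"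
  proof (rule sum_norm_le)
    fix v assume v: "v \<in> I - {d}"
    then have vU: "v \<in> U" "d \<noteq> v" "d \<noteq> - v" using I(2) vd(1)[of v] inner_U[of v] by auto
    have "norm (fourier_set (A v) l) \<le> C * (1 / r * (1 / (r * c0)))"
      unfolding A_def
    proof (rule norm_fourier_cap_le[OF C(2) k vU(1) d vU(2,3) c0(1) _ _ _ _ l(3,4) C(1)])
      show "norm (l - (\<sigma> * r) *\<^sub>R d) \<le> 1" using l by linarith
      show "0 \<le> \<tau> * (v \<bullet> d)" "\<tau> * (v \<bullet> d) \<le> 1 / r" using t1[of v] v \<tau>(3) by auto
      show "(d \<bullet> v)\<^sup>2 \<le> 1 - c0" by (rule c0(2)[OF d vU])
    qed auto
    then show "norm (fourier_set (A v) l) \<le> C * (1 / r * (1 / (r * c0)))" .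
  qed
  also have "\<dots> \<le> (\<Sum>v\<in>I. C * (1 / r * (1 / (r * c0))))"
    using I(1) C(1) rpos c0(1) by (intro sum_mono2) auto
  also have "\<dots> = real (card I) * (C / c0 / r\<^sup>2)" by (simp add: power2_eq_square)
  finally have 2: "norm (\<Sum>v\<in>I - {d}. fourier_set (A v) l) \<le> real (card I) * (C / c0 / r\<^sup>2)" .
  have Ad: "A d = cap k d \<tau>" by (simp add: A_def inner_U[OF d])
  let ?ph = "cis (2 * pi * (\<sigma> * r * k d))"
  \<comment> \<open>On this cap \<open>l \<bullet> x\<close> varies by at most
    \<open>r * \<tau> = \<eta>\<close> because of its depth and by \<open>\<epsilon> * R\<close>
    because \<open>l\<close> is off the ray.\<close>
  have 3: "norm (fourier_set (A d) l - of_real (vol (A d)) * ?ph) \<le> 2 * pi * (\<eta> + \<epsilon> * R) * vol (A d)"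
  proof (rule norm_fourier_set_const_phase[OF AL])
    fix x assume "x \<in> A d"
    then have x: "k d - \<tau> < d \<bullet> x" "d \<bullet> x \<le> k d" "norm x \<le> R" using k d by (auto simp: Ad cap_def poly_def)
    have "l \<bullet> x - \<sigma> * r * k d = \<sigma> * (r * (d \<bullet> x - k d)) + (l - (\<sigma> * r) *\<^sub>R d) \<bullet> x"
      by (simp add: inner_diff_left algebra_simps)
    moreover have "\<bar>\<sigma> * (r * (d \<bullet> x - k d))\<bar> \<le> \<eta>"
    proof -
      have "\<bar>\<sigma> * (r * (d \<bullet> x - k d))\<bar> = r * \<bar>d \<bullet> x - k d\<bar>" using l(3) rpos by (auto simp: abs_mult)
      also have "\<dots> \<le> r * \<tau>" using x rpos by (intro mult_left_mono) auto
      finally show ?thesis using \<tau> by simp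
    qed
    moreover have "\<bar>(l - (\<sigma> * r) *\<^sub>R d) \<bullet> x\<bar> \<le> \<epsilon> * R"
    proof -
      have "0 \<le> \<epsilon>" using norm_ge_zero[of "l - (\<sigma> * r) *\<^sub>R d"] l(1) by linarith
      then show ?thesis
        using Cauchy_Schwarz_ineq2[of "l - (\<sigma> * r) *\<^sub>R d" x] mult_mono[OF l(1) x(3)] by simp
    qed
    ultimately show "\<bar>l \<bullet> x - \<sigma> * r * k d\<bar> \<le> \<eta> + \<epsilon> * R" by linarith
  qed
  have eps: "0 \<le> \<epsilon>" using norm_ge_zero[of "l - (\<sigma> * r) *\<^sub>R d"] l(1) by linarith
  have "2 * pi * (\<eta> + \<epsilon> * R) * vol (A d) \<le> 2 * pi * (\<eta> + \<epsilon> * R) * (C * \<tau>)"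
    using cap_measure_le[OF d _ k C(3), of \<tau>] \<tau> \<eta> eps R unfolding Ad by (intro mult_left_mono) auto
  with 3 have 3: "norm (fourier_set (A d) l - of_real (vol (A d)) * ?ph) \<le> 2 * pi * (\<eta> + \<epsilon> * R) * (C * \<tau>)" by linarith
  have sum: "(\<Sum>v\<in>I. fourier_set (A v) l) = fourier_set (A d) l + (\<Sum>v\<in>I - {d}. fourier_set (A v) l)"
    by (rule sum.remove[OF I(1,3)])
  have "\<bar>norm (fourier_set (\<Union>v\<in>I. A v) l) - vol (A d)\<bar>
      = \<bar>norm (fourier_set (\<Union>v\<in>I. A v) l) - norm (of_real (vol (A d)) * ?ph)\<bar>" by (simp add: norm_mult)
  also have "\<dots> \<le> norm (fourier_set (\<Union>v\<in>I. A v) l - of_real (vol (A d)) * ?ph)" by (rule norm_triangle_ineq3)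
  also have "\<dots> = norm ((fourier_set (\<Union>v\<in>I. A v) l - (\<Sum>v\<in>I. fourier_set (A v) l)) + ((\<Sum>v\<in>I - {d}. fourier_set (A v) l)
      + (fourier_set (A d) l - of_real (vol (A d)) * ?ph)))" by (simp add: sum)
  also have "\<dots> \<le> real (card I) * (2 * C / r\<^sup>2) + (real (card I) * (C / c0 / r\<^sup>2) + 2 * pi * (\<eta> + \<epsilon> * R) * (C * \<tau>))"
    by (intro norm_triangle_mono 1 2 3)
  also have "\<dots> = 2 * pi * (\<eta> + \<epsilon> * R) * (C * \<tau>) + real (card I) * ((2 * C + C / c0) / r\<^sup>2)"
    by (simp add: add_divide_distrib distrib_left)
  also have "real (card I) * ((2 * C + C / c0) / r\<^sup>2) \<le> real (card U) * ((2 * C + C / c0) / r\<^sup>2)"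
    using cardI C(1) c0(1) by (intro mult_right_mono) auto
  finally have "\<bar>norm (fourier_set (\<Union>v\<in>I. A v) l) - vol (A d)\<bar>
    \<le> 2 * pi * (\<eta> + \<epsilon> * R) * (C * \<tau>) + (2 * C + C / c0) * real (card U) / r\<^sup>2" by (simp add: mult.commute)
  then show ?thesis unfolding X[symmetric] Ad unfolding \<tau>_def .
qed


section \<open>Intersections of the polytope with a translate\<close>

definition cut_heights :: "'a \<Rightarrow> 'a \<Rightarrow> real" where
  "cut_heights t v = h v + min 0 (v \<bullet> t)"

lemma poly_Int_translation: "poly h \<inter> (+) t ` poly h = poly (cut_heights t)"
proof -
  have "(a \<le> H \<and> a - b \<le> H) = (a \<le> H + min 0 b)" for a b H :: real by (auto simp: min_def)
  then show ?thesis
    unfolding set_eq_iff Int_iff mem_translation_iff poly_def cut_heights_def mem_Collect_eq inner_diff_right by blast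
qed

lemma poly_cut_subset: "poly (cut_heights t) \<subseteq> cball 0 R"
  using poly_Int_translation[of t] poly_h_subset by blast

text \<open>The source of uniformity in \<open>t\<close>. The bounding hyperplane at
  \<open>u\<close> is inherited from P or from P + t according to the sign of
  \<open>u \<bullet> t\<close>; after the corresponding shift \<open>s\<close> the two caps differ
  only within \<open>norm t\<close> of another hyperplane.\<close>

lemma cap_cut_measure_diff:
  assumes u: "u \<in> U" and \<tau>: "\<tau> > 0" and w: "\<tau> + norm t < h u + h (- u)"
    and C: "\<And>u p \<alpha> q \<beta>. u \<in> U \<Longrightarrow> \<alpha> \<ge> 0 \<Longrightarrow> \<beta> \<ge> 0 \<Longrightarrow> vol (rim u p \<alpha> q \<beta>) \<le> C * (\<alpha> * \<beta>)"
  shows "\<bar>vol (cap (cut_heights t) u \<tau>) - vol (cap h u \<tau>)\<bar> \<le> C * (\<tau> * norm t)"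
proof -
  let ?k = "cut_heights t"
  define s where "s = (if u \<bullet> t \<ge> 0 then 0 else t)"
  have kL: "cap ?k u \<tau> \<in> lmeasurable" and hL: "cap h u \<tau> \<in> lmeasurable"
    by (intro cap_lmeasurable poly_cut_subset poly_h_subset)+
  have iff: "x \<in> poly ?k \<longleftrightarrow> x \<in> poly h \<and> x - t \<in> poly h" for x
    using poly_Int_translation[of t] mem_translation_iff by blast
  have vt: "\<bar>v \<bullet> t\<bar> \<le> norm t" if "v \<in> U" for v using Cauchy_Schwarz_ineq2[of v t] norm_U[OF that] by simp
  have ku: "?k u = h u + u \<bullet> s" by (auto simp: s_def cut_heights_def)
  have 1: "cap ?k u \<tau> \<subseteq> (+) s ` cap h u \<tau> \<union> {}"
    using ku by (auto simp: cap_def mem_translation_iff iff s_def inner_diff_right split: if_splits)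
  have 2: "cap h u \<tau> \<subseteq> (+) (- s) ` cap ?k u \<tau> \<union> rim u (h u - \<tau>) \<tau> (\<lambda>v. h v - norm t) (norm t)"
  proof
    fix x assume x: "x \<in> cap h u \<tau>"
    then have xh: "x \<in> poly h" "h u - \<tau> < u \<bullet> x" by (auto simp: cap_def)
    have rimI: "x \<in> rim u (h u - \<tau>) \<tau> (\<lambda>v. h v - norm t) (norm t)"
      if v: "v \<in> U" "v \<noteq> u" "v \<noteq> - u" "h v - norm t < v \<bullet> x" for v
      using v xh u norm_poly_h[OF xh(1)] by (auto simp: rim_def poly_def intro!: bexI[of _ v])
    have mu: "(- u) \<bullet> x < h (- u) - norm t" using xh w by simp
    show "x \<in> (+) (- s) ` cap ?k u \<tau> \<union> rim u (h u - \<tau>) \<tau> (\<lambda>v. h v - norm t) (norm t)"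
    proof (cases "x + s \<in> poly ?k")
      case True
      then have "x + s \<in> cap ?k u \<tau>" using xh ku by (simp add: cap_def inner_add_right)
      then show ?thesis by (intro UnI1 image_eqI[of _ _ "x + s"]) auto
    next
      case False
      obtain v where v: "v \<in> U" "h v - norm t < v \<bullet> x" "v \<noteq> u"
      proof (cases "u \<bullet> t \<ge> 0")
        case True
        then have "x - t \<notin> poly h" using False xh iff[of "x + s"] by (simp add: s_def)
        then obtain v where v: "v \<in> U" "h v < v \<bullet> x - v \<bullet> t" by (auto simp: poly_def inner_diff_right not_le)
        moreover have "v \<noteq> u" using v True xh by (auto simp: poly_def)
        ultimately show thesis using vt[of v] that[of v] by linarith
      next
        case neg: False
        then have "x + t \<notin> poly h" using False xh iff[of "x + s"] by (simp add: s_def)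
        then obtain v where v: "v \<in> U" "h v < v \<bullet> x + v \<bullet> t" by (auto simp: poly_def inner_add_right not_le)
        moreover have "v \<noteq> u" using v neg xh by (auto simp: poly_def)
        ultimately show thesis using vt[of v] that[of v] by linarith
      qed
      moreover have "v \<noteq> - u" using v(2) mu by auto
      ultimately show ?thesis using rimI by blast
    qed
  qed
  have "vol (cap ?k u \<tau>) \<le> vol (cap h u \<tau>)"
    using measure_le_translation_Un[OF kL hL _ 1] by simp
  moreover have "vol (cap h u \<tau>) \<le> vol (cap ?k u \<tau>) + C * (\<tau> * norm t)"
    using measure_le_translation_Un[OF hL kL rim_lmeasurable 2] C[OF u, of \<tau> "norm t" "h u - \<tau>" "\<lambda>v. h v - norm t"] \<tau> by simp
  moreover have "0 \<le> C * (\<tau> * norm t)"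
    using C[OF u, of \<tau> "norm t" "h u - \<tau>" "\<lambda>v. h v - norm t"] \<tau> measure_nonneg order_trans by (metis less_imp_le norm_ge_zero)
  ultimately show ?thesis by linarith
qed

text \<open>A finite perimeter property, which serves the decay of the transform as well as the
  continuity of the ambiguity function in time.\<close>

lemma poly_shift_measure_le:
  assumes C: "C \<ge> 0" "\<And>u p \<alpha>. u \<in> U \<Longrightarrow> \<alpha> \<ge> 0 \<Longrightarrow> vol {x \<in> cball 0 R. p < u \<bullet> x \<and> u \<bullet> x \<le> p + \<alpha>} \<le> C * \<alpha>"
    and k: "poly k \<subseteq> cball 0 R"
  shows "vol (poly k - (+) s ` poly k) \<le> real (card U) * (C * norm s)"
proof -
  have vs: "- (v \<bullet> s) \<le> norm s" if "v \<in> U" for v using Cauchy_Schwarz_ineq2[of v s] norm_U[OF that] by simp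
  have "vol (poly k - (+) s ` poly k) \<le> (\<Sum>v\<in>{v\<in>U. v \<bullet> s < 0}. vol (cap k v (- (v \<bullet> s))))"
    unfolding poly_Diff_translation using finite_U cap_lmeasurable[OF k] by (intro measure_UNION_le) auto
  also have "\<dots> \<le> (\<Sum>v\<in>{v\<in>U. v \<bullet> s < 0}. C * norm s)"
  proof (rule sum_mono)
    fix v assume v: "v \<in> {v\<in>U. v \<bullet> s < 0}"
    then have "vol (cap k v (- (v \<bullet> s))) \<le> C * (- (v \<bullet> s))"
      by (intro cap_measure_le[OF _ _ k C(2)]) auto
    also have "\<dots> \<le> C * norm s" using C(1) vs[of v] v by (intro mult_left_mono) auto
    finally show "vol (cap k v (- (v \<bullet> s))) \<le> C * norm s" .
  qed
  also have "\<dots> = real (card {v\<in>U. v \<bullet> s < 0}) * (C * norm s)" by simp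
  also have "\<dots> \<le> real (card U) * (C * norm s)"
    using finite_U C(1) by (intro mult_right_mono) (auto intro!: card_mono)
  finally show ?thesis .
qed

text \<open>A shift by half a wavelength in the direction of \<open>l\<close>. Far out the transform
  is thus smaller than the volume, which excludes differences of parameters with the same
  atom.\<close>

lemma norm_fourier_poly_decay:
  assumes C: "C \<ge> 0" "\<And>u p \<alpha>. u \<in> U \<Longrightarrow> \<alpha> \<ge> 0 \<Longrightarrow> vol {x \<in> cball 0 R. p < u \<bullet> x \<and> u \<bullet> x \<le> p + \<alpha>} \<le> C * \<alpha>"
    and k: "poly k \<subseteq> cball 0 R" and l: "l \<noteq> 0"
  shows "norm (fourier_set (poly k) l) \<le> real (card U) * (C * (1 / (2 * norm l)))"
proof -
  define s where "s = (1 / (2 * (norm l)\<^sup>2)) *\<^sub>R l"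
  have ls: "l \<bullet> s = 1 / 2" using l by (simp add: s_def power2_norm_eq_inner)
  have ns: "norm s = 1 / (2 * norm l)" using l by (simp add: s_def power2_eq_square)
  have "norm (fourier_set (poly k) l) \<le> vol (poly k - (+) s ` poly k)"
    by (rule norm_fourier_set_half_period[OF poly_borel poly_lmeasurable[OF k] ls])
  also have "\<dots> \<le> real (card U) * (C * norm s)" by (rule poly_shift_measure_le[OF C k])
  finally show ?thesis by (simp add: ns)
qed

text \<open>
  If the Fourier transform vanishes at \<open>l\<close>, the two shells swept out by a short shift along \<open>u\<close>
  have Fourier coefficients of the same size; these are close to the volumes of the caps at
  \<open>u\<close> and \<open>- u\<close>, which differ.
\<close>

theorem fourier_cut_nonzero_tube:
  assumes sharp: "\<And>u. u \<in> U \<Longrightarrow> \<exists>x\<in>poly h. u \<bullet> x = h u"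
    and asym: "\<not> centrally_symmetric (poly h)"
  obtains u \<delta> r0 where "norm u = 1" "\<delta> > 0" "r0 > 0"
    "\<And>t l r. norm t < \<delta> \<Longrightarrow> r \<ge> r0 \<Longrightarrow> norm (l - r *\<^sub>R u) < \<delta> \<Longrightarrow>
      fourier_set (poly h \<inter> (+) t ` poly h) l \<noteq> 0 \<and> norm (fourier_set (poly h \<inter> (+) t ` poly h) l) < vol (poly h)"
proof -
  obtain C where C: "C \<ge> 0"
    "\<And>u p \<alpha> q \<beta>. u \<in> U \<Longrightarrow> \<alpha> \<ge> 0 \<Longrightarrow> \<beta> \<ge> 0 \<Longrightarrow> vol (rim u p \<alpha> q \<beta>) \<le> C * (\<alpha> * \<beta>)"
    "\<And>u p \<alpha>. u \<in> U \<Longrightarrow> \<alpha> \<ge> 0 \<Longrightarrow> vol {x \<in> cball 0 R. p < u \<bullet> x \<and> u \<bullet> x \<le> p + \<alpha>} \<le> C * \<alpha>"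
    by (rule rim_measure_le) blast
  obtain \<omega> where w: "\<omega> > 0" "\<And>u. u \<in> U \<Longrightarrow> h u + h (- u) \<ge> \<omega>" by (rule width_pos) blast
  obtain c0 where c0: "c0 > 0" "c0 \<le> 1" "\<And>u v. u \<in> U \<Longrightarrow> v \<in> U \<Longrightarrow> u \<noteq> v \<Longrightarrow> u \<noteq> - v \<Longrightarrow> (u \<bullet> v)\<^sup>2 \<le> 1 - c0"
    by (rule parallel_gap) blast
  obtain u c \<tau>1 where u: "u \<in> U" "c > 0" "\<tau>1 > 0"
    "\<And>\<tau>. 0 < \<tau> \<Longrightarrow> \<tau> < \<tau>1 \<Longrightarrow> c * \<tau> \<le> \<bar>vol (cap h u \<tau>) - vol (cap h (- u) \<tau>)\<bar>"
    by (rule unbalanced_facet[OF sharp asym]) blast+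
  have u': "- u \<in> U" by (rule uminus_U[OF u(1)])
  have R: "R \<ge> 0"
  proof -
    obtain x where "x \<in> poly h" using sharp[OF u(1)] by blast
    then show ?thesis using norm_poly_h[of x] norm_ge_zero[of x] by linarith
  qed
  define V where "V = vol (poly h)"
  have V: "V > 0" unfolding V_def by (rule poly_h_measure_pos)
  define N where "N = (2 * C + C / c0) * real (card U)"
  have N: "N \<ge> 0" using C c0 by (simp add: N_def)
  \<comment> \<open>\<open>K\<close> bounds the coefficients of both \<open>\<eta>\<close> and
    \<open>\<delta>\<close> in the error terms; each of the two products is then made at most
    \<open>c / 8\<close>.\<close>
  define K where "K = 2 * C + 4 * pi * C * (1 + R) + 1"
  have K: "K > 0" using C(1) R by (simp add: K_def add_nonneg_pos)
  define \<eta> where "\<eta> = min 1 (c / (8 * K))"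
  define \<delta> where "\<delta> = Min {1, c / (8 * K), \<omega> / 2}"
  have \<eta>: "0 < \<eta>" "\<eta> \<le> 1" "K * \<eta> \<le> c / 8" using u(2) K by (auto simp: \<eta>_def min_def field_simps)
  have \<delta>: "0 < \<delta>" "\<delta> \<le> 1" "K * \<delta> \<le> c / 8" "\<delta> \<le> \<omega> / 2"
  proof -
    have "\<delta> \<le> c / (8 * K)" by (simp add: \<delta>_def)
    then show "K * \<delta> \<le> c / 8" using K by (simp add: field_simps)
  qed (use u(2) K w in \<open>auto simp: \<delta>_def\<close>)
  \<comment> \<open>Each demand on \<open>r\<close> has its summand: \<open>2 / c0\<close> for the
    facets not parallel to \<open>u\<close>, \<open>1 / \<tau>1\<close> and
    \<open>2 / \<omega>\<close> for thin caps, \<open>8 * N / (c * \<eta>)\<close> to absorb what is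
    quadratic in \<open>1 / r\<close>, and the last one for a modulus below the volume.\<close>
  define r0 where "r0 = 2 / c0 + 1 / \<tau>1 + 2 / \<omega> + 8 * N / (c * \<eta>) + 1 + real (card U) * C / V"
  have r0parts: "2 / c0 > 0" "1 / \<tau>1 > 0" "2 / \<omega> > 0" "8 * N / (c * \<eta>) \<ge> 0" "real (card U) * C / V \<ge> 0"
    using c0 u w N \<eta> C V by auto
  show thesis
  proof (rule that[of u \<delta> r0])
    show "norm u = 1" "\<delta> > 0" by (fact norm_U[OF u(1)] \<delta>(1))+
    show "r0 > 0" using r0parts unfolding r0_def by linarith
    fix t l :: 'a and r :: real assume t: "norm t < \<delta>" and r: "r \<ge> r0" and l: "norm (l - r *\<^sub>R u) < \<delta>"
    have rr: "r \<ge> 2 / c0" "r > 1 / \<tau>1" "r > 2 / \<omega>" "r \<ge> 8 * N / (c * \<eta>)" "r \<ge> 1" "r > real (card U) * C / V"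
      using r r0parts unfolding r0_def by linarith+
    let ?k = "cut_heights t"
    let ?F = "fourier_set (poly ?k) l"
    define \<tau> where "\<tau> = \<eta> / r"
    have rpos: "r > 0" using rr by simp
    have "0 < \<tau>" "\<tau> \<le> 1 / r" using \<eta> rpos by (simp_all add: \<tau>_def divide_right_mono)
    moreover have "1 / r < \<tau>1" "1 / r < \<omega> / 2" using rr rpos u(3) w(1) by (auto simp: field_simps)
    ultimately have \<tau>: "\<tau> > 0" "\<tau> < \<tau>1" "\<tau> < \<omega> / 2" by linarith+
    have "?F \<noteq> 0"
    proof
      assume F0: "?F = 0"
      let ?s = "\<tau> *\<^sub>R u"
      let ?X = "poly ?k - (+) (- ?s) ` poly ?k" and ?Y = "poly ?k - (+) ?s ` poly ?k"
      have kL: "poly ?k \<in> lmeasurable" "(+) s ` poly ?k \<in> lmeasurable" for s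
        using poly_lmeasurable[OF poly_cut_subset] by (auto intro: measurable_translation)
      have bor: "poly ?k \<in> sets borel" "(+) s ` poly ?k \<in> sets borel" for s
        using poly_borel by (auto intro: borel_translation)
      \<comment> \<open>The translate has coefficient zero as well, so both one-sided differences
        have the same coefficient. One of them is the shell \<open>?Y\<close>, the other a translate
        of the shell \<open>?X\<close>.\<close>
      have "fourier_set ((+) ?s ` poly ?k) l = 0" using F0 by (simp add: fourier_set_translation poly_borel)
      then have "fourier_set ?Y l = fourier_set ((+) ?s ` poly ?k - poly ?k) l"
        using fourier_set_split[OF kL(1) kL(2)[of ?s], of l] fourier_set_split[OF kL(2)[of ?s] kL(1), of l] F0
        by (simp add: Int_commute add_eq_0_iff)
      also have "(+) ?s ` poly ?k - poly ?k = (+) ?s ` ?X"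
        by (rule set_eqI) (simp only: Diff_iff mem_translation_iff diff_minus_eq_add diff_add_cancel)
      also have "fourier_set ((+) ?s ` ?X) l = cis (2 * pi * (l \<bullet> ?s)) * fourier_set ?X l"
        by (rule fourier_set_translation[OF sets.Diff[OF bor(1) bor(2)]])
      finally have eq: "norm (fourier_set ?Y l) = norm (fourier_set ?X l)" by (simp add: norm_mult)
      have rc: "r * c0 \<ge> 2" using rr(1) c0(1) by (simp add: field_simps)
      have X: "\<bar>norm (fourier_set ?X l) - vol (cap ?k u \<tau>)\<bar>
          \<le> 2 * pi * (\<eta> + \<delta> * R) * (C * \<tau>) + N / r\<^sup>2"
        using norm_fourier_shell_estimate[OF C c0(1,3) poly_cut_subset[of t] u(1) \<eta>(1,2), where \<sigma> = 1 and l = l and r = r and \<epsilon> = \<delta>] l \<delta> rc R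
        by (simp add: \<tau>_def N_def)
      have Y: "\<bar>norm (fourier_set ?Y l) - vol (cap ?k (- u) \<tau>)\<bar>
          \<le> 2 * pi * (\<eta> + \<delta> * R) * (C * \<tau>) + N / r\<^sup>2"
        using norm_fourier_shell_estimate[OF C c0(1,3) poly_cut_subset[of t] u' \<eta>(1,2), where \<sigma> = "-1" and l = l and r = r and \<epsilon> = \<delta>] l \<delta> rc R
        by (simp add: \<tau>_def N_def)
      have "\<tau> + norm t < \<omega>" using \<tau> t \<delta> by linarith
      then have D: "\<bar>vol (cap ?k u \<tau>) - vol (cap h u \<tau>)\<bar> \<le> C * (\<tau> * norm t)"
        "\<bar>vol (cap ?k (- u) \<tau>) - vol (cap h (- u) \<tau>)\<bar> \<le> C * (\<tau> * norm t)"
        using w(2)[OF u(1)] w(2)[OF u'] by (intro cap_cut_measure_diff u u' \<tau> C(2); simp)+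
      have Ct: "C * (\<tau> * norm t) \<le> C * (\<tau> * \<delta>)" using t C(1) \<tau> by (intro mult_left_mono) auto
      have "c * \<tau> \<le> 2 * (C * (\<tau> * \<delta>)) + 2 * (2 * pi * (\<eta> + \<delta> * R) * (C * \<tau>) + N / r\<^sup>2)"
      proof -
        have "\<bar>m1 - m2\<bar> \<le> 2 * D' + 2 * E" if "\<bar>f - a1\<bar> \<le> E" "\<bar>f - a2\<bar> \<le> E" "\<bar>a1 - m1\<bar> \<le> D" "\<bar>a2 - m2\<bar> \<le> D" "D \<le> D'"
          for f a1 a2 m1 m2 D D' E :: real
          using that by linarith
        from this[OF X Y[unfolded eq] D] show ?thesis
          using u(4)[OF \<tau>(1,2)] Ct by (meson order_trans)
      qed
      also have "\<dots> = \<tau> * (2 * C * \<delta> + 4 * pi * C * (\<eta> + \<delta> * R)) + 2 * N / r\<^sup>2" by (simp add: algebra_simps)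
      also have "2 * N / r\<^sup>2 \<le> \<tau> * (c / 4)"
      proof -
        have "8 * N \<le> r * (c * \<eta>)" using rr(4) u(2) \<eta>(1) by (simp add: field_simps)
        then have "2 * N / r\<^sup>2 \<le> (r * (c * \<eta>) / 4) / r\<^sup>2" using rpos by (intro divide_right_mono) auto
        also have "\<dots> = \<tau> * (c / 4)" using rpos by (simp add: \<tau>_def power2_eq_square mult.commute)
        finally show ?thesis .
      qed
      finally have "c * \<tau> \<le> \<tau> * (2 * C * \<delta> + 4 * pi * C * (\<eta> + \<delta> * R) + c / 4)" by (simp add: algebra_simps)
      then have "c \<le> 2 * C * \<delta> + 4 * pi * C * (\<eta> + \<delta> * R) + c / 4" using \<tau>(1) by (simp add: mult.commute)
      also have "2 * C * \<delta> + 4 * pi * C * (\<eta> + \<delta> * R) \<le> K * \<eta> + K * \<delta>"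
      proof -
        have "K * \<eta> + K * \<delta> - (2 * C * \<delta> + 4 * pi * C * (\<eta> + \<delta> * R))
          = 2 * C * \<eta> + 4 * pi * C * R * \<eta> + \<eta> + 4 * pi * C * \<delta> + \<delta>" by (simp add: K_def algebra_simps)
        moreover have "\<dots> \<ge> 0" using C(1) R \<eta> \<delta> by (intro add_nonneg_nonneg mult_nonneg_nonneg) auto
        ultimately show ?thesis by linarith
      qed
      \<comment> \<open>The estimate now reads \<open>c \<le> c / 8 + c / 8 + c / 4\<close>.\<close>
      finally show False using \<eta>(3) \<delta>(3) u(2) by linarith
    qed
    moreover have "norm ?F < V"
    proof -
      have "norm (r *\<^sub>R u) \<le> norm l + norm (l - r *\<^sub>R u)"
        using norm_triangle_sub[of "r *\<^sub>R u" l] by (simp add: norm_minus_commute)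
      then have "r \<le> norm l + \<delta>" using l rpos norm_U[OF u(1)] by simp
      moreover have "2 \<le> 2 / c0" using c0 by (simp add: field_simps)
      ultimately have nl: "norm l \<ge> r / 2" "norm l > 0" using rr(1) \<delta>(2) by linarith+
      have "norm ?F \<le> real (card U) * (C * (1 / (2 * norm l)))"
        using nl by (intro norm_fourier_poly_decay[OF C(1,3) poly_cut_subset]) auto
      also have "\<dots> \<le> real (card U) * (C * (1 / r))"
        using nl C(1) rpos by (intro mult_left_mono frac_le) auto
      also have "\<dots> < V" using rr(6) rpos V by (simp add: field_simps)
      finally show ?thesis .
    qed
    ultimately show "fourier_set (poly h \<inter> (+) t ` poly h) l \<noteq> 0 \<and> norm (fourier_set (poly h \<inter> (+) t ` poly h) l) < vol (poly h)"
      unfolding poly_Int_translation V_def by blast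
  qed
qed

end

section \<open>Orthonormal systems and the Plancherel inequality\<close>

lemma L2_product_integrable:
  assumes "f \<in> L2_functions" "g \<in> L2_functions"
  shows "integrable lebesgue (\<lambda>x. f x * cnj (g x))"
proof (rule Bochner_Integration.integrable_bound)
  show "integrable lebesgue (\<lambda>x. (cmod (f x))\<^sup>2 + (cmod (g x))\<^sup>2)"
    using assms by (auto simp: L2_functions_def)
  have [measurable]: "f \<in> borel_measurable lebesgue" "g \<in> borel_measurable lebesgue"
    using assms by (auto simp: L2_functions_def)
  have [measurable]: "cnj \<in> borel_measurable borel"
    by (intro borel_measurable_continuous_onI continuous_intros)
  show "(\<lambda>x. f x * cnj (g x)) \<in> borel_measurable lebesgue" by measurable
  have "a * b \<le> a\<^sup>2 + b\<^sup>2" if "a \<ge> 0" "b \<ge> 0" for a b :: real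
    using sum_squares_bound[of a b] mult_nonneg_nonneg[OF that] by (simp only: mult.assoc)
  then show "AE x in lebesgue. norm (f x * cnj (g x)) \<le> norm ((cmod (f x))\<^sup>2 + (cmod (g x))\<^sup>2)"
    by (simp add: norm_mult)
qed

lemma L2_functions_add:
  assumes "f \<in> L2_functions" "g \<in> L2_functions"
  shows "(\<lambda>x. f x + g x) \<in> L2_functions"
proof -
  have [measurable]: "f \<in> borel_measurable lebesgue" "g \<in> borel_measurable lebesgue"
    using assms by (auto simp: L2_functions_def)
  have "integrable lebesgue (\<lambda>x. (cmod (f x + g x))\<^sup>2)"
  proof (rule Bochner_Integration.integrable_bound)
    show "integrable lebesgue (\<lambda>x. 2 * (cmod (f x))\<^sup>2 + 2 * (cmod (g x))\<^sup>2)"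
      using assms by (auto simp: L2_functions_def)
    have "(cmod (a + b))\<^sup>2 \<le> 2 * (cmod a)\<^sup>2 + 2 * (cmod b)\<^sup>2" for a b
    proof -
      have "(cmod (a + b))\<^sup>2 \<le> (cmod a + cmod b)\<^sup>2" by (intro power_mono norm_triangle_ineq) simp
      also have "\<dots> \<le> 2 * (cmod a)\<^sup>2 + 2 * (cmod b)\<^sup>2"
        using sum_squares_bound[of "cmod a" "cmod b"] by (simp add: power2_sum)
      finally show ?thesis .
    qed
    then show "AE x in lebesgue. norm ((cmod (f x + g x))\<^sup>2) \<le> norm (2 * (cmod (f x))\<^sup>2 + 2 * (cmod (g x))\<^sup>2)"
      by simp
  qed measurable
  then show ?thesis by (simp add: L2_functions_def)
qed

lemma L2_functions_cmult:
  assumes "f \<in> L2_functions" shows "(\<lambda>x. c * f x) \<in> L2_functions"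
  using assms by (auto simp: L2_functions_def norm_mult power_mult_distrib)

lemma L2_functions_zero: "(\<lambda>x. 0) \<in> L2_functions"
  by (simp add: L2_functions_def)

lemma L2_functions_sum:
  assumes "finite I" "\<And>i. i \<in> I \<Longrightarrow> f i \<in> L2_functions"
  shows "(\<lambda>x. \<Sum>i\<in>I. f i x) \<in> L2_functions"
  using assms by (induction I rule: finite_induct) (auto intro: L2_functions_zero L2_functions_add)

lemma L2_inner_self:
  assumes "f \<in> L2_functions"
  shows "L2_inner f f = of_real ((L2_norm f)\<^sup>2)"
proof -
  have "L2_inner f f = (LINT x|lebesgue. complex_of_real ((cmod (f x))\<^sup>2))"
    unfolding L2_inner_def by (simp only: complex_norm_square)
  also have "\<dots> = of_real (LINT x|lebesgue. (cmod (f x))\<^sup>2)" by (rule integral_complex_of_real)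
  also have "(LINT x|lebesgue. (cmod (f x))\<^sup>2) = (L2_norm f)\<^sup>2" by (simp add: L2_norm_def)
  finally show ?thesis .
qed

lemma cnj_L2_inner: "cnj (L2_inner f g) = L2_inner g f"
  unfolding L2_inner_def using Bochner_Integration.integral_cnj[of lebesgue "\<lambda>x. f x * cnj (g x)"] by (simp add: mult.commute)

text \<open>Pythagoras with arbitrary coefficients \<open>c\<close>: the optimal choice gives
  Bessel's inequality, and dropping the last sum turns density of finite combinations into
  Parseval.\<close>

lemma L2_norm_diff_sum_square:
  fixes h :: "'i \<Rightarrow> 'a::euclidean_space \<Rightarrow> complex"
  assumes f: "f \<in> L2_functions" and I: "finite I" and h: "\<And>i. i \<in> I \<Longrightarrow> h i \<in> L2_functions"
    and orth: "\<And>i j. i \<in> I \<Longrightarrow> j \<in> I \<Longrightarrow> L2_inner (h i) (h j) = (if i = j then 1 else 0)"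
  shows "(L2_norm (\<lambda>x. f x - (\<Sum>i\<in>I. c i * h i x)))\<^sup>2
    = (L2_norm f)\<^sup>2 - (\<Sum>i\<in>I. (cmod (L2_inner f (h i)))\<^sup>2) + (\<Sum>i\<in>I. (cmod (c i - L2_inner f (h i)))\<^sup>2)"
proof -
  define S where "S x = (\<Sum>i\<in>I. c i * h i x)" for x
  have S: "S \<in> L2_functions" unfolding S_def by (intro L2_functions_sum I L2_functions_cmult h)
  have fS: "(\<lambda>x. f x - S x) \<in> L2_functions"
    using L2_functions_add[OF f L2_functions_cmult[OF S, of "-1"]] by simp
  define a where "a i = L2_inner f (h i)" for i
  have ff: "L2_inner f f = of_real ((L2_norm f)\<^sup>2)" by (rule L2_inner_self[OF f])
  have inner_S: "L2_inner g S = (\<Sum>i\<in>I. cnj (c i) * L2_inner g (h i))" if g: "g \<in> L2_functions" for g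
  proof -
    have "L2_inner g S = (LINT x|lebesgue. (\<Sum>i\<in>I. cnj (c i) * (g x * cnj (h i x))))"
      unfolding L2_inner_def S_def by (simp add: cnj_sum sum_distrib_left mult.left_commute)
    also have "\<dots> = (\<Sum>i\<in>I. (LINT x|lebesgue. cnj (c i) * (g x * cnj (h i x))))"
      by (rule Bochner_Integration.integral_sum) (intro integrable_mult_right L2_product_integrable g h)
    finally show ?thesis by (simp add: L2_inner_def)
  qed
  have hS: "L2_inner (h i) S = cnj (c i)" if "i \<in> I" for i
    unfolding inner_S[OF h[OF that]] using orth[OF that] I that
    by (simp add: if_distrib[of "\<lambda>x. _ * x"] sum.delta cong: if_cong)
  have fS': "L2_inner f S = (\<Sum>i\<in>I. cnj (c i) * a i)" unfolding inner_S[OF f] a_def ..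
  have Sf: "L2_inner S f = (\<Sum>i\<in>I. c i * cnj (a i))" using arg_cong[OF fS', of cnj] by (simp add: cnj_L2_inner cnj_sum)
  have SS: "L2_inner S S = (\<Sum>i\<in>I. c i * cnj (c i))"
  proof -
    have "L2_inner S S = (\<Sum>i\<in>I. cnj (c i) * L2_inner S (h i))" by (rule inner_S[OF S])
    also have "\<dots> = (\<Sum>i\<in>I. cnj (c i) * c i)"
      using hS cnj_L2_inner[of _ S] by (intro sum.cong refl) (metis complex_cnj_cnj)
    finally show ?thesis by (simp add: mult.commute)
  qed
  have "of_real ((L2_norm (\<lambda>x. f x - S x))\<^sup>2) = L2_inner (\<lambda>x. f x - S x) (\<lambda>x. f x - S x)"
    by (rule L2_inner_self[OF fS, symmetric])
  also have "\<dots> = (LINT x|lebesgue. (f x * cnj (f x) - f x * cnj (S x)) - (S x * cnj (f x) - S x * cnj (S x)))"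
    unfolding L2_inner_def by (simp add: algebra_simps)
  also have "\<dots> = (L2_inner f f - L2_inner f S) - (L2_inner S f - L2_inner S S)"
    unfolding L2_inner_def by (simp add: L2_product_integrable f S)
  also have "\<dots> = of_real ((L2_norm f)\<^sup>2) + (\<Sum>i\<in>I. c i * cnj (c i) - cnj (c i) * a i - c i * cnj (a i))"
    unfolding ff fS' Sf SS by (simp add: sum_subtractf)
  also have "(\<Sum>i\<in>I. c i * cnj (c i) - cnj (c i) * a i - c i * cnj (a i))
      = (\<Sum>i\<in>I. (c i - a i) * cnj (c i - a i) - a i * cnj (a i))"
    by (rule sum.cong[OF refl]) (simp add: algebra_simps)
  also have "\<dots> = of_real (\<Sum>i\<in>I. (cmod (c i - a i))\<^sup>2 - (cmod (a i))\<^sup>2)"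
    by (simp only: of_real_sum of_real_diff complex_norm_square)
  finally have "of_real ((L2_norm (\<lambda>x. f x - S x))\<^sup>2)
      = complex_of_real ((L2_norm f)\<^sup>2 + (\<Sum>i\<in>I. (cmod (c i - a i))\<^sup>2 - (cmod (a i))\<^sup>2))" by simp
  then have "(L2_norm (\<lambda>x. f x - S x))\<^sup>2 = (L2_norm f)\<^sup>2 + (\<Sum>i\<in>I. (cmod (c i - a i))\<^sup>2 - (cmod (a i))\<^sup>2)"
    by (simp only: of_real_eq_iff)
  then show ?thesis by (simp add: S_def a_def sum_subtractf)
qed

lemma L2_bessel:
  assumes f: "f \<in> L2_functions" and I: "finite I" and h: "\<And>i. i \<in> I \<Longrightarrow> h i \<in> L2_functions"
    and orth: "\<And>i j. i \<in> I \<Longrightarrow> j \<in> I \<Longrightarrow> L2_inner (h i) (h j) = (if i = j then 1 else 0)"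
  shows "(\<Sum>i\<in>I. (cmod (L2_inner f (h i)))\<^sup>2) \<le> (L2_norm f)\<^sup>2"
proof -
  have "0 \<le> (L2_norm (\<lambda>x. f x - (\<Sum>i\<in>I. L2_inner f (h i) * h i x)))\<^sup>2" by simp
  also have "\<dots> = (L2_norm f)\<^sup>2 - (\<Sum>i\<in>I. (cmod (L2_inner f (h i)))\<^sup>2)"
    by (subst L2_norm_diff_sum_square[OF f I h orth]) auto
  finally show ?thesis by simp
qed

lemma L2_orthonormal_basis_inner:
  assumes "L2_orthonormal_basis B" "f \<in> B" "g \<in> B"
  shows "L2_inner f g = (if f = g then 1 else 0)"
  using assms L2_inner_self[of f] unfolding L2_orthonormal_basis_def by (auto simp: subset_iff)

lemma L2_orthonormal_basis_parseval:
  assumes B: "L2_orthonormal_basis B" and f: "f \<in> L2_functions" and e: "e > 0"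
  obtains F where "finite F" "F \<subseteq> B" "(L2_norm f)\<^sup>2 - e < (\<Sum>h\<in>F. (cmod (L2_inner f h))\<^sup>2)"
proof -
  have "sqrt e > 0" using e by simp
  then obtain F c where F: "finite F" "F \<subseteq> B" "L2_norm (\<lambda>x. f x - (\<Sum>h\<in>F. c h * h x)) < sqrt e"
    using B f unfolding L2_orthonormal_basis_def by blast
  have "(L2_norm (\<lambda>x. f x - (\<Sum>h\<in>F. c h * h x)))\<^sup>2 < (sqrt e)\<^sup>2"
    using F(3) by (intro power_strict_mono) (auto simp: L2_norm_def)
  then have "(L2_norm (\<lambda>x. f x - (\<Sum>h\<in>F. c h * h x)))\<^sup>2 < e" using e by simp
  moreover have "F \<subseteq> L2_functions" using F(2) B by (auto simp: L2_orthonormal_basis_def)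
  then have "(L2_norm (\<lambda>x. f x - (\<Sum>h\<in>F. c h * h x)))\<^sup>2 
    = (L2_norm f)\<^sup>2 - (\<Sum>h\<in>F. (cmod (L2_inner f h))\<^sup>2) + (\<Sum>h\<in>F. (cmod (c h - L2_inner f h))\<^sup>2)"
    using F by (intro L2_norm_diff_sum_square[of f F "\<lambda>h. h" c] f L2_orthonormal_basis_inner[OF B]) auto
  moreover have "0 \<le> (\<Sum>h\<in>F. (cmod (c h - L2_inner f h))\<^sup>2)" by (intro sum_nonneg) simp
  ultimately have "(L2_norm f)\<^sup>2 - e < (\<Sum>h\<in>F. (cmod (L2_inner f h))\<^sup>2)" by linarith
  with F show thesis using that by blast
qed

section \<open>Lattice characters and Plancherel's inequality\<close>

definition int_lattice :: "'a::euclidean_space set" where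
  "int_lattice = {k. \<forall>b\<in>Basis. k \<bullet> b \<in> \<int>}"

text \<open>Half-open, so that a slice cut off on one side fits exactly on the opposite
  side.\<close>

definition period_cell :: "real \<Rightarrow> 'a::euclidean_space \<Rightarrow> 'a set" where
  "period_cell L a = {x. \<forall>b\<in>Basis. a \<bullet> b \<le> x \<bullet> b \<and> x \<bullet> b < a \<bullet> b + L}"

lemma countable_int_lattice: "countable (int_lattice :: 'a::euclidean_space set)"
proof -
  have "(int_lattice :: 'a set) \<subseteq> (\<lambda>f. \<Sum>b\<in>Basis. f b *\<^sub>R b) ` (Basis \<rightarrow>\<^sub>E (\<int>::real set))"
  proof
    fix k :: 'a assume k: "k \<in> int_lattice"
    show "k \<in> (\<lambda>f. \<Sum>b\<in>Basis. f b *\<^sub>R b) ` (Basis \<rightarrow>\<^sub>E (\<int>::real set))"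
      by (rule image_eqI[of _ _ "restrict (\<lambda>b. k \<bullet> b) Basis"]) (use k in \<open>auto simp: int_lattice_def euclidean_representation\<close>)
  qed
  moreover have "countable ((Basis :: 'a set) \<rightarrow>\<^sub>E (\<int>::real set))"
    by (intro countable_PiE finite_Basis) (simp add: countable_int)
  ultimately show ?thesis by (meson countable_image countable_subset)
qed

lemma int_lattice_diff: "k \<in> int_lattice \<Longrightarrow> m \<in> int_lattice \<Longrightarrow> k - m \<in> int_lattice"
  by (simp add: int_lattice_def inner_diff_left)

lemma int_lattice_exists:
  fixes x :: "'a::euclidean_space"
  assumes "L > 0" obtains k where "k \<in> int_lattice" "x + L *\<^sub>R k \<in> period_cell L a"
proof -
  define k where "k = (\<Sum>b\<in>Basis. (- of_int \<lfloor>(x \<bullet> b - a \<bullet> b) / L\<rfloor>) *\<^sub>R b)"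
  have kb: "k \<bullet> b = - of_int \<lfloor>(x \<bullet> b - a \<bullet> b) / L\<rfloor>" if "b \<in> Basis" for b
    unfolding k_def by (rule inner_sum_left_Basis[OF that])
  show thesis
  proof (rule that[of k])
    show "k \<in> int_lattice" by (simp add: int_lattice_def kb)
    show "x + L *\<^sub>R k \<in> period_cell L a" unfolding period_cell_def
    proof (intro CollectI ballI)
      fix b :: 'a assume b: "b \<in> Basis"
      let ?q = "(x \<bullet> b - a \<bullet> b) / L"
      have eq: "L * ?q = x \<bullet> b - a \<bullet> b" using assms by simp
      have "L * of_int \<lfloor>?q\<rfloor> \<le> L * ?q" "L * ?q < L * (of_int \<lfloor>?q\<rfloor> + 1)"
        using assms by (auto intro!: mult_left_mono mult_strict_left_mono simp del: times_divide_eq_right)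
      then show "a \<bullet> b \<le> (x + L *\<^sub>R k) \<bullet> b \<and> (x + L *\<^sub>R k) \<bullet> b < a \<bullet> b + L"
        using assms unfolding eq by (simp add: inner_add_left kb[OF b] algebra_simps)
    qed
  qed
qed

lemma period_cell_borel: "period_cell L a \<in> sets borel"
proof -
  have "period_cell L a = (\<Inter>b\<in>Basis. {x. a \<bullet> b \<le> x \<bullet> b} \<inter> {x. x \<bullet> b < a \<bullet> b + L})" by (auto simp: period_cell_def)
  also have "\<dots> \<in> sets borel"
    by (intro sets.countable_INT'' sets.Int) (auto intro: countable_finite borel_closed closed_halfspace_component_ge borel_open open_halfspace_component_lt)
  finally show ?thesis .
qed

lemma emeasure_period_cell:
  fixes a :: "'a::euclidean_space" assumes "L > 0"
  shows "emeasure lborel (period_cell L a) = ennreal (L ^ DIM('a))"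
proof -
  let ?c = "a + L *\<^sub>R One"
  have cb: "?c \<bullet> b = a \<bullet> b + L" if "b \<in> Basis" for b using that by (simp add: inner_add_left)
  have "box a ?c \<subseteq> period_cell L a" "period_cell L a \<subseteq> cbox a ?c"
    using cb by (auto simp: period_cell_def mem_box less_imp_le)
  then have "emeasure lborel (box a ?c) \<le> emeasure lborel (period_cell L a)"
    "emeasure lborel (period_cell L a) \<le> emeasure lborel (cbox a ?c)"
    by (auto intro!: emeasure_mono simp: period_cell_borel)
  moreover have "emeasure lborel (box a ?c) = ennreal (L ^ DIM('a))" "emeasure lborel (cbox a ?c) = ennreal (L ^ DIM('a))"
    using assms cb by (simp_all add: emeasure_lborel_box_eq emeasure_lborel_cbox_eq inner_diff_left)
  ultimately show ?thesis by simp
qed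

lemma period_cell_lmeasurable: "L > 0 \<Longrightarrow> period_cell L a \<in> lmeasurable"
  using emeasure_period_cell[of L a] period_cell_borel[of L a] by (auto simp: fmeasurable_def)

lemma measure_period_cell: "L > 0 \<Longrightarrow> vol (period_cell L (a::'a::euclidean_space)) = L ^ DIM('a)"
  using emeasure_period_cell[of L a] period_cell_borel[of L a] by (simp add: measure_def)

text \<open>
  Cutting off a slice of the period cell and putting it back on the opposite side is a translation of
  the cell which does not change the integral of a periodic character.
\<close>

lemma fourier_period_cell_eq_0:
  fixes a :: "'a::euclidean_space"
  assumes L: "L > 0" and m: "L *\<^sub>R l \<in> int_lattice" "l \<noteq> 0"
  shows "fourier_set (period_cell L a) l = 0"
proof -
  obtain b where b: "b \<in> Basis" "l \<bullet> b \<noteq> 0" using m(2) by (metis euclidean_all_zero_iff)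
  have int: "L * (l \<bullet> b) \<in> \<int>" using m(1) b by (simp add: int_lattice_def)
  \<comment> \<open>Half a period of the character in coordinate \<open>b\<close>. As
    \<open>L * (l \<bullet> b)\<close> is a nonzero integer, \<open>\<sigma>\<close> is at most
    \<open>L / 2\<close>, so the slice is smaller than the cell.\<close>
  define \<sigma> where "\<sigma> = 1 / (2 * \<bar>l \<bullet> b\<bar>)"
  have "\<bar>L * (l \<bullet> b)\<bar> \<ge> 1" using int b L by (intro Ints_nonzero_abs_ge1) auto
  then have s: "\<sigma> > 0" "\<sigma> < L" using b L by (auto simp: \<sigma>_def abs_mult field_simps)
  let ?Q = "period_cell L a"
  define lo where "lo = ?Q \<inter> {x. x \<bullet> b < a \<bullet> b + \<sigma>}"
  define hi where "hi = ?Q \<inter> {x. a \<bullet> b + \<sigma> \<le> x \<bullet> b}"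
  have bb: "c \<bullet> b = (if c = b then 1 else 0)" if "c \<in> Basis" for c using that b by (simp add: inner_Basis)
  have bor: "lo \<in> sets borel" "hi \<in> sets borel" unfolding lo_def hi_def
    by (auto intro!: sets.Int period_cell_borel intro: borel_closed closed_halfspace_component_ge borel_open open_halfspace_component_lt)
  have Lm: "lo \<in> lmeasurable" "hi \<in> lmeasurable"
    using period_cell_lmeasurable[OF L, of a] bor unfolding lo_def hi_def
    by (auto intro!: fmeasurable_Int_fmeasurable intro: borel_closed closed_halfspace_component_ge borel_open open_halfspace_component_lt)
  have Q: "?Q = lo \<union> hi" "lo \<inter> hi = {}" by (auto simp: lo_def hi_def)
  have shift: "(+) (\<sigma> *\<^sub>R b) ` ?Q = (+) (L *\<^sub>R b) ` lo \<union> hi"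
  proof (rule set_eqI)
    fix x
    have comp: "(x - c *\<^sub>R b) \<bullet> i = x \<bullet> i - (if i = b then c else 0)" if "i \<in> Basis" for c i
      using that b by (simp add: inner_diff_left inner_Basis)
    have all: "(\<forall>i\<in>Basis. P i) \<longleftrightarrow> P b \<and> (\<forall>i\<in>Basis - {b}. P i)" for P using b by auto
    have mem: "x - c *\<^sub>R b \<in> ?Q \<longleftrightarrow> (a \<bullet> b \<le> x \<bullet> b - c \<and> x \<bullet> b - c < a \<bullet> b + L) \<and> (\<forall>i\<in>Basis - {b}. a \<bullet> i \<le> x \<bullet> i \<and> x \<bullet> i < a \<bullet> i + L)" for c
      unfolding period_cell_def mem_Collect_eq by (subst all) (simp add: comp b)
    have mem0: "x \<in> ?Q \<longleftrightarrow> (a \<bullet> b \<le> x \<bullet> b \<and> x \<bullet> b < a \<bullet> b + L) \<and> (\<forall>i\<in>Basis - {b}. a \<bullet> i \<le> x \<bullet> i \<and> x \<bullet> i < a \<bullet> i + L)"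
      using mem[of 0] by simp
    show "x \<in> (+) (\<sigma> *\<^sub>R b) ` ?Q \<longleftrightarrow> x \<in> (+) (L *\<^sub>R b) ` lo \<union> hi"
      unfolding Un_iff mem_translation_iff lo_def hi_def Int_iff mem mem0 mem_Collect_eq comp[OF b(1)] using s by auto
  qed
  have "(+) (L *\<^sub>R b) ` lo \<inter> hi = {}"
  proof (rule equals0I)
    fix x assume "x \<in> (+) (L *\<^sub>R b) ` lo \<inter> hi"
    then obtain y where y: "y \<in> lo" "x = L *\<^sub>R b + y" "x \<in> hi" by auto
    then have "a \<bullet> b \<le> y \<bullet> b" "x \<bullet> b < a \<bullet> b + L" "x \<bullet> b = L + y \<bullet> b"
      using b(1) by (auto simp: lo_def hi_def period_cell_def inner_add_left)
    then show False by simp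
  qed
  then have "fourier_set ((+) (\<sigma> *\<^sub>R b) ` ?Q) l = fourier_set ((+) (L *\<^sub>R b) ` lo) l + fourier_set hi l"
    unfolding shift by (intro fourier_set_Un measurable_translation Lm)
  also have "fourier_set ((+) (L *\<^sub>R b) ` lo) l = fourier_set lo l"
  proof -
    obtain i :: int where i: "L * (l \<bullet> b) = of_int i" using int by (auto elim: Ints_cases)
    have "cis (2 * pi * (l \<bullet> (L *\<^sub>R b))) = 1" using i cis_multiple_2pi[of "of_int i"] by (simp add: mult.assoc)
    then show ?thesis by (simp add: fourier_set_translation bor)
  qed
  also have "fourier_set lo l + fourier_set hi l = fourier_set ?Q l"
    unfolding Q(1) by (rule fourier_set_Un[OF Lm Q(2), symmetric])
  finally have "cis (2 * pi * (l \<bullet> (\<sigma> *\<^sub>R b))) * fourier_set ?Q l = fourier_set ?Q l"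
    by (simp add: fourier_set_translation period_cell_borel)
  moreover have "cis (2 * pi * (l \<bullet> (\<sigma> *\<^sub>R b))) = -1"
  proof -
    have "2 * pi * (l \<bullet> (\<sigma> *\<^sub>R b)) = pi \<or> 2 * pi * (l \<bullet> (\<sigma> *\<^sub>R b)) = - pi" using b by (auto simp: \<sigma>_def abs_if)
    moreover have "cis (- pi) = -1" by (simp add: complex_eq_iff)
    ultimately show ?thesis by (metis cis_pi)
  qed
  ultimately show ?thesis by simp
qed

lemma L2_indicator_cis:
  fixes E :: "'a::euclidean_space set"
  assumes "E \<in> lmeasurable"
  shows "(\<lambda>x. c * (indicator E x *\<^sub>R cis (2 * pi * (l \<bullet> x)))) \<in> L2_functions"
    "L2_norm (\<lambda>x. indicator E x *\<^sub>R cis (2 * pi * (l \<bullet> x))) = sqrt (vol E)"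
proof -
  have meas: "(\<lambda>x. indicator E x *\<^sub>R cis (2 * pi * (l \<bullet> x))) \<in> borel_measurable lebesgue"
    using fourier_set_integrable[OF assms, of l] by auto
  have sq: "(cmod (indicator E x *\<^sub>R cis (2 * pi * (l \<bullet> x))))\<^sup>2 = indicator E x" for x by (simp add: indicator_def)
  have "integrable lebesgue (indicator E :: 'a \<Rightarrow> real)"
    using assms by (intro integrable_real_indicator) (auto simp: fmeasurable_def)
  then have "(\<lambda>x. indicator E x *\<^sub>R cis (2 * pi * (l \<bullet> x))) \<in> L2_functions"
    using meas unfolding L2_functions_def mem_Collect_eq sq by blast
  then show "(\<lambda>x. c * (indicator E x *\<^sub>R cis (2 * pi * (l \<bullet> x)))) \<in> L2_functions" by (rule L2_functions_cmult)
  show "L2_norm (\<lambda>x. indicator E x *\<^sub>R cis (2 * pi * (l \<bullet> x))) = sqrt (vol E)"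
    using assms unfolding L2_norm_def sq by (simp add: fmeasurable_def)
qed

lemma L2_inner_indicator_cis:
  "L2_inner (\<lambda>x. c * (indicator E x *\<^sub>R cis (2 * pi * (l \<bullet> x)))) (\<lambda>x. d * (indicator F x *\<^sub>R cis (2 * pi * (m \<bullet> x))))
    = c * cnj d * fourier_set (E \<inter> F) (l - m)"
proof -
  have "L2_inner (\<lambda>x. c * (indicator E x *\<^sub>R cis (2 * pi * (l \<bullet> x)))) (\<lambda>x. d * (indicator F x *\<^sub>R cis (2 * pi * (m \<bullet> x))))
    = (LINT x|lebesgue. c * cnj d * (indicator (E \<inter> F) x *\<^sub>R cis (2 * pi * ((l - m) \<bullet> x))))"
    unfolding L2_inner_def
    by (intro Bochner_Integration.integral_cong) (auto simp: indicator_def cis_mult cis_cnj inner_diff_left right_diff_distrib)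
  then show ?thesis unfolding fourier_set_def by (simp only: integral_mult_right_zero)
qed

text \<open>\<open>E\<close> lies in one cell, so these coefficients are, up to the factor
  \<open>c\<close>, inner products with the normalized characters of the cell, an orthonormal
  system. The offset \<open>\<eta>\<close> is kept free in order to be integrated over a frequency
  cell.\<close>

lemma fourier_set_bessel:
  fixes E :: "'a::euclidean_space set"
  assumes L: "L > 0" and E: "E \<in> lmeasurable" "E \<subseteq> period_cell L a" and I: "finite I" "I \<subseteq> int_lattice"
  shows "(\<Sum>k\<in>I. (cmod (fourier_set E (\<eta> - (1 / L) *\<^sub>R k)))\<^sup>2) \<le> L ^ DIM('a) * vol E"
proof -
  let ?Q = "period_cell L a" and ?n = "DIM('a)"
  have QL: "?Q \<in> lmeasurable" by (rule period_cell_lmeasurable[OF L])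
  define c where "c = 1 / sqrt (L ^ ?n)"
  have c: "c * c * L ^ ?n = 1" "c > 0" "c\<^sup>2 = 1 / L ^ ?n" using L by (auto simp: c_def power2_eq_square)
  define f where "f x = 1 * (indicator E x *\<^sub>R cis (2 * pi * (\<eta> \<bullet> x)))" for x
  define h where "h k x = of_real c * (indicator ?Q x *\<^sub>R cis (2 * pi * (((1 / L) *\<^sub>R k) \<bullet> x)))" for k x
  have orth: "L2_inner (h k) (h m) = (if k = m then 1 else 0)" if km: "k \<in> I" "m \<in> I" for k m
  proof -
    have eq: "L2_inner (h k) (h m) = of_real c * of_real c * fourier_set ?Q ((1 / L) *\<^sub>R (k - m))"
      unfolding h_def L2_inner_indicator_cis by (simp add: scaleR_right_diff_distrib)
    show ?thesis
    proof (cases "k = m")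
      case True
      have "fourier_set ?Q 0 = of_real (vol ?Q)"
        unfolding fourier_set_def using QL by (simp add: scaleR_conv_of_real fmeasurable_def)
      then show ?thesis unfolding eq using True c(1) measure_period_cell[OF L, of a]
        by (simp flip: of_real_mult of_real_power add: mult.assoc)
    next
      case False
      have "fourier_set ?Q ((1 / L) *\<^sub>R (k - m)) = 0"
        using L False km I by (intro fourier_period_cell_eq_0) (auto intro: int_lattice_diff)
      then show ?thesis unfolding eq using False by simp
    qed
  qed
  have "(\<Sum>k\<in>I. (cmod (L2_inner f (h k)))\<^sup>2) \<le> (L2_norm f)\<^sup>2"
  proof (rule L2_bessel[OF _ I(1) _ orth])
    show "f \<in> L2_functions" unfolding f_def by (rule L2_indicator_cis(1)[OF E(1)])
    show "h k \<in> L2_functions" for k unfolding h_def by (rule L2_indicator_cis(1)[OF QL])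
  qed
  also have "(L2_norm f)\<^sup>2 = vol E"
  proof -
    have "f = (\<lambda>x. indicator E x *\<^sub>R cis (2 * pi * (\<eta> \<bullet> x)))" by (simp add: f_def fun_eq_iff)
    then show ?thesis using L2_indicator_cis(2)[OF E(1), of \<eta>] by simp
  qed
  finally have bes: "(\<Sum>k\<in>I. (cmod (L2_inner f (h k)))\<^sup>2) \<le> vol E" .
  have "L2_inner f (h k) = of_real c * fourier_set E (\<eta> - (1 / L) *\<^sub>R k)" for k
    using E(2) unfolding f_def h_def L2_inner_indicator_cis by (simp add: Int_absorb2)
  with bes have "(\<Sum>k\<in>I. c\<^sup>2 * (cmod (fourier_set E (\<eta> - (1 / L) *\<^sub>R k)))\<^sup>2) \<le> vol E"
    using c(2) by (simp add: norm_mult power_mult_distrib)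
  then have "c\<^sup>2 * (\<Sum>k\<in>I. (cmod (fourier_set E (\<eta> - (1 / L) *\<^sub>R k)))\<^sup>2) \<le> vol E"
    by (simp add: sum_distrib_left)
  then show ?thesis using L unfolding c(3) by (simp add: field_simps)
qed

lemma dist_fourier_set_le:
  fixes E :: "'a::euclidean_space set"
  assumes E: "E \<in> lmeasurable" "E \<subseteq> cball 0 R"
  shows "dist (fourier_set E l) (fourier_set E m) \<le> (2 * pi * R * vol E) * dist l m"
proof -
  have int: "integrable lebesgue (\<lambda>x. indicator E x *\<^sub>R cis (2 * pi * (l \<bullet> x)))" for l
    by (rule fourier_set_integrable[OF E(1)])
    have "fourier_set E l - fourier_set E m = (LINT x|lebesgue. indicator E x *\<^sub>R cis (2 * pi * (l \<bullet> x)) - indicator E x *\<^sub>R cis (2 * pi * (m \<bullet> x)))"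
      unfolding fourier_set_def by (rule Bochner_Integration.integral_diff[symmetric, OF int int])
    also have "norm \<dots> \<le> (LINT x|lebesgue. indicator E x * (2 * pi * R * dist l m))"
    proof (rule Bochner_Integration.integral_norm_bound_integral)
      show "integrable lebesgue (\<lambda>x. indicator E x * (2 * pi * R * dist l m))"
        using E(1) by (intro integrable_mult_left integrable_real_indicator) (auto simp: fmeasurable_def)
      fix x :: 'a
      show "norm (indicator E x *\<^sub>R cis (2 * pi * (l \<bullet> x)) - indicator E x *\<^sub>R cis (2 * pi * (m \<bullet> x))) \<le> indicator E x * (2 * pi * R * dist l m)"
      proof (cases "x \<in> E")
        case x: True
        have "norm (cis (2 * pi * (l \<bullet> x)) - cis (2 * pi * (m \<bullet> x))) \<le> \<bar>2 * pi * (l \<bullet> x) - 2 * pi * (m \<bullet> x)\<bar>" by (rule norm_cis_diff_le)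
        also have "\<dots> = 2 * pi * \<bar>(l - m) \<bullet> x\<bar>" by (simp add: abs_mult inner_diff_left flip: right_diff_distrib)
        also have "\<bar>(l - m) \<bullet> x\<bar> \<le> norm (l - m) * norm x" by (rule Cauchy_Schwarz_ineq2)
        also have "norm (l - m) * norm x \<le> dist l m * R" using x E(2) by (auto simp: dist_norm intro!: mult_left_mono)
        finally show ?thesis using x by (simp add: mult_ac)
      qed simp
    qed (use int in auto)
    also have "\<dots> = (2 * pi * R * vol E) * dist l m" using E(1) by (simp add: fmeasurable_def)
    finally show ?thesis by (simp add: dist_norm)
qed

lemma continuous_on_fourier_set:
  fixes E :: "'a::euclidean_space set"
  assumes "E \<in> lmeasurable" "E \<subseteq> cball 0 R" "R \<ge> 0"
  shows "continuous_on S (fourier_set E)"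
proof -
  have "(2 * pi * R * vol E)-lipschitz_on S (fourier_set E)"
    using assms by (intro lipschitz_onI dist_fourier_set_le) auto
  then show ?thesis by (rule lipschitz_on_continuous_on)
qed

lemma nn_integral_lborel_translation:
  fixes f :: "'a::euclidean_space \<Rightarrow> ennreal"
  assumes [measurable]: "f \<in> borel_measurable borel"
  shows "(\<integral>\<^sup>+x. f (a + x) \<partial>lborel) = (\<integral>\<^sup>+x. f x \<partial>lborel)"
proof -
  have "(\<integral>\<^sup>+x. f x \<partial>lborel) = (\<integral>\<^sup>+x. f x \<partial>(distr lborel borel ((+) a)))" by (simp add: lborel_distr_plus)
  also have "\<dots> = (\<integral>\<^sup>+x. f (a + x) \<partial>lborel)" by (subst nn_integral_distr) auto
  finally show ?thesis by simp
qed

lemma nn_integral_count_space_le: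
  fixes f :: "'i \<Rightarrow> ennreal"
  assumes I: "countable I" and le: "\<And>F. finite F \<Longrightarrow> F \<subseteq> I \<Longrightarrow> sum f F \<le> c"
  shows "(\<integral>\<^sup>+i. f i \<partial>count_space I) \<le> c"
proof (cases "finite I")
  case True
  then show ?thesis using le[of I] by (simp add: nn_integral_count_space_finite)
next
  case False
  let ?g = "from_nat_into I"
  have g: "bij_betw ?g UNIV I" by (rule bij_betw_from_nat_into[OF I False])
  have "(\<integral>\<^sup>+i. f i \<partial>count_space I) = (\<integral>\<^sup>+n. f (?g n) \<partial>count_space UNIV)"
    by (rule nn_integral_bij_count_space[OF g, symmetric])
  also have "\<dots> = (\<Sum>n. f (?g n))" by (rule nn_integral_count_space_nat)
  also have "\<dots> \<le> c"
  proof (rule suminf_le_const)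
    fix n
    have "inj_on ?g {..<n}" using g by (auto simp: bij_betw_def intro: inj_on_subset)
    then have "(\<Sum>i<n. f (?g i)) = sum f (?g ` {..<n})" by (simp add: sum.reindex)
    also have "\<dots> \<le> c" using g by (intro le) (auto simp: bij_betw_def)
    finally show "(\<Sum>i<n. f (?g i)) \<le> c" .
  qed simp
  finally show ?thesis .
qed

lemma sum_le_nn_integral_count_space:
  fixes f :: "'i \<Rightarrow> ennreal"
  assumes F: "finite F" "F \<subseteq> I"
  shows "sum f F \<le> (\<integral>\<^sup>+i. f i \<partial>count_space I)"
proof -
  have "sum f F = (\<Sum>i\<in>F. f i * indicator F i)" by (rule sum.cong) auto
  also have "\<dots> = (\<integral>\<^sup>+i. f i * indicator F i \<partial>count_space I)"
    by (rule nn_integral_count_space'[symmetric]) (use F in auto)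
  also have "\<dots> \<le> (\<integral>\<^sup>+i. f i \<partial>count_space I)" by (intro nn_integral_mono) (auto simp: indicator_def)
  finally show ?thesis .
qed

text \<open>Plancherel's inequality: cut frequency space into cells and apply Bessel's inequality in each of them.\<close>

lemma nn_integral_fourier_set_le:
  fixes E :: "'a::euclidean_space set"
  assumes E: "E \<in> lmeasurable" "E \<subseteq> cball 0 R" and R: "R \<ge> 0"
  shows "(\<integral>\<^sup>+l. ennreal ((cmod (fourier_set E l))\<^sup>2) \<partial>lborel) \<le> ennreal (vol E)"
proof -
  \<comment> \<open>The extra 1 lets the half-open cell contain the closed ball and keeps
    \<open>L\<close> positive for \<open>R = 0\<close>.\<close>
  define L where "L = 2 * R + 1"
  define a where "a = - R *\<^sub>R (One :: 'a)"
  have L: "L > 0" using R by (simp add: L_def)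
  have EQ: "E \<subseteq> period_cell L a"
  proof
    fix x assume "x \<in> E"
    then have "norm x \<le> R" using E(2) by auto
    then have "\<bar>x \<bullet> b\<bar> \<le> R" if "b \<in> Basis" for b using Basis_le_norm[OF that, of x] by simp
    then show "x \<in> period_cell L a" by (force simp: period_cell_def a_def L_def abs_le_iff)
  qed
  define G where "G l = ennreal ((cmod (fourier_set E l))\<^sup>2)" for l
  have [measurable]: "fourier_set E \<in> borel_measurable borel"
    using continuous_on_fourier_set[OF E R] by (rule borel_measurable_continuous_onI)
  have [measurable]: "G \<in> borel_measurable borel" unfolding G_def by measurable
  let ?Z = "int_lattice :: 'a set" and ?c = "period_cell (1 / L) (0::'a)"
  have [measurable]: "?c \<in> sets borel" by (rule period_cell_borel)
  have L1: "1 / L > 0" using L by simp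
  have one: "(\<integral>\<^sup>+k. indicator ?c ((1 / L) *\<^sub>R k + l) \<partial>count_space ?Z) \<ge> (1::ennreal)" for l
  proof -
    obtain k where k: "k \<in> ?Z" "l + (1 / L) *\<^sub>R k \<in> ?c" by (rule int_lattice_exists[OF L1])
    then show ?thesis
      using sum_le_nn_integral_count_space[of "{k}" ?Z "\<lambda>k. indicator ?c ((1 / L) *\<^sub>R k + l)"] by (simp add: add.commute)
  qed
  have "(\<integral>\<^sup>+l. G l \<partial>lborel) \<le> (\<integral>\<^sup>+l. (\<integral>\<^sup>+k. indicator ?c ((1 / L) *\<^sub>R k + l) * G l \<partial>count_space ?Z) \<partial>lborel)"
  proof (rule nn_integral_mono)
    fix l
    have "G l = 1 * G l" by simp
    also have "\<dots> \<le> (\<integral>\<^sup>+k. indicator ?c ((1 / L) *\<^sub>R k + l) \<partial>count_space ?Z) * G l" by (intro mult_right_mono one) simp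
    also have "\<dots> = (\<integral>\<^sup>+k. indicator ?c ((1 / L) *\<^sub>R k + l) * G l \<partial>count_space ?Z)" by (rule nn_integral_multc[symmetric]) simp
    finally show "G l \<le> (\<integral>\<^sup>+k. indicator ?c ((1 / L) *\<^sub>R k + l) * G l \<partial>count_space ?Z)" .
  qed
  also have "\<dots> = (\<integral>\<^sup>+k. (\<integral>\<^sup>+l. indicator ?c ((1 / L) *\<^sub>R k + l) * G l \<partial>lborel) \<partial>count_space ?Z)"
    by (rule nn_integral_count_space_nn_integral[OF countable_int_lattice]) measurable
  also have "\<dots> = (\<integral>\<^sup>+k. (\<integral>\<^sup>+\<eta>. indicator ?c \<eta> * G (\<eta> - (1 / L) *\<^sub>R k) \<partial>lborel) \<partial>count_space ?Z)"
  proof (rule nn_integral_cong)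
    fix k
    show "(\<integral>\<^sup>+l. indicator ?c ((1 / L) *\<^sub>R k + l) * G l \<partial>lborel) = (\<integral>\<^sup>+\<eta>. indicator ?c \<eta> * G (\<eta> - (1 / L) *\<^sub>R k) \<partial>lborel)"
      using nn_integral_lborel_translation[of "\<lambda>\<eta>. indicator ?c \<eta> * G (\<eta> - (1 / L) *\<^sub>R k)" "(1 / L) *\<^sub>R k"] by simp
  qed
  also have "\<dots> = (\<integral>\<^sup>+\<eta>. (\<integral>\<^sup>+k. indicator ?c \<eta> * G (\<eta> - (1 / L) *\<^sub>R k) \<partial>count_space ?Z) \<partial>lborel)"
    by (rule nn_integral_count_space_nn_integral[OF countable_int_lattice, symmetric]) measurable
  \<comment> \<open>Bessel's inequality for each offset in the cell; its factor
    \<open>L ^ DIM('a)\<close> cancels against the volume of the frequency cell, whose side is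
    \<open>1 / L\<close>.\<close>
  also have "\<dots> \<le> (\<integral>\<^sup>+\<eta>. indicator ?c \<eta> * ennreal (L ^ DIM('a) * vol E) \<partial>lborel)"
  proof (rule nn_integral_mono)
    fix \<eta>
    have "(\<integral>\<^sup>+k. indicator ?c \<eta> * G (\<eta> - (1 / L) *\<^sub>R k) \<partial>count_space ?Z) = indicator ?c \<eta> * (\<integral>\<^sup>+k. G (\<eta> - (1 / L) *\<^sub>R k) \<partial>count_space ?Z)"
      by (rule nn_integral_cmult) simp
    also have "(\<integral>\<^sup>+k. G (\<eta> - (1 / L) *\<^sub>R k) \<partial>count_space ?Z) \<le> ennreal (L ^ DIM('a) * vol E)"
    proof (rule nn_integral_count_space_le[OF countable_int_lattice])
      fix F assume F: "finite F" "F \<subseteq> ?Z"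
      have "(\<Sum>k\<in>F. G (\<eta> - (1 / L) *\<^sub>R k)) = ennreal (\<Sum>k\<in>F. (cmod (fourier_set E (\<eta> - (1 / L) *\<^sub>R k)))\<^sup>2)"
        unfolding G_def by (rule sum_ennreal) simp
      also have "\<dots> \<le> ennreal (L ^ DIM('a) * vol E)"
        by (intro ennreal_leI fourier_set_bessel[OF L E(1) EQ F])
      finally show "(\<Sum>k\<in>F. G (\<eta> - (1 / L) *\<^sub>R k)) \<le> ennreal (L ^ DIM('a) * vol E)" .
    qed
    finally show "(\<integral>\<^sup>+k. indicator ?c \<eta> * G (\<eta> - (1 / L) *\<^sub>R k) \<partial>count_space ?Z) \<le> indicator ?c \<eta> * ennreal (L ^ DIM('a) * vol E)"
      by (simp add: mult_left_mono)
  qed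
  also have "\<dots> = emeasure lborel ?c * ennreal (L ^ DIM('a) * vol E)"
    by (subst nn_integral_multc) auto
  also have "\<dots> = ennreal (vol E)"
    using L by (simp add: emeasure_period_cell flip: ennreal_mult) (simp add: power_one_over power_divide)
  finally show ?thesis by (simp add: G_def)
qed

section \<open>Gabor systems generated by a set\<close>

lemma fourier_set_uminus: "fourier_set E (- l) = cnj (fourier_set E l)"
  unfolding fourier_set_def
  by (subst Bochner_Integration.integral_cnj[symmetric]) (simp add: cis_cnj)

text \<open>Up to normalization, the ambiguity function of the indicator function of \<open>P\<close>.\<close>

definition ambiguity :: "'a::euclidean_space set \<Rightarrow> 'a \<times> 'a \<Rightarrow> complex" where
  "ambiguity P z = fourier_set (P \<inter> (+) (fst z) ` P) (- snd z)"

text \<open>\<open>shift_P\<close> expresses finite perimeter. Together with a tube free of zeros it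
  carries all the geometry that enters the Gabor argument.\<close>

locale lipschitz_body =
  fixes P :: "'a::euclidean_space set" and R C :: real
  assumes borel_P: "P \<in> sets borel" and bounded_P: "P \<subseteq> cball 0 R" and R: "R \<ge> 0" and C: "C \<ge> 0"
    and pos_P: "vol P > 0"
    and shift_P: "\<And>s. vol (P - (+) s ` P) \<le> C * norm s"
begin

lemma lmeasurable_P: "P \<in> lmeasurable"
  using borel_P bounded_P by (intro borel_bounded_lmeasurable bounded_subset[OF bounded_cball])

lemma lmeasurable_Int_shift: "P \<inter> (+) t ` P \<in> lmeasurable"
  by (intro fmeasurable.Int lmeasurable_P measurable_translation)

lemma measure_Int_shift_le: "vol (P \<inter> (+) t ` P) \<le> vol P"
  by (intro measure_mono_fmeasurable fmeasurableD lmeasurable_Int_shift lmeasurable_P) auto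

lemma measure_Int_shift_Diff_le:
  "vol (P \<inter> (+) t ` P - P \<inter> (+) t' ` P) \<le> C * norm (t - t')"
proof -
  have "vol (P \<inter> (+) t ` P - P \<inter> (+) t' ` P) \<le> vol ((+) t ` (P - (+) (t' - t) ` P))"
  proof (rule measure_mono_fmeasurable)
    show "P \<inter> (+) t ` P - P \<inter> (+) t' ` P \<subseteq> (+) t ` (P - (+) (t' - t) ` P)"
    proof
      fix x assume "x \<in> P \<inter> (+) t ` P - P \<inter> (+) t' ` P"
      then have "x - t \<in> P" "x - t' \<notin> P" by (auto simp: mem_translation_iff)
      moreover have "x - t - (t' - t) = x - t'" by simp
      ultimately show "x \<in> (+) t ` (P - (+) (t' - t) ` P)" by (simp only: mem_translation_iff Diff_iff simp_thms)
    qed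
  qed (intro fmeasurableD measurable_translation fmeasurable.Diff lmeasurable_Int_shift lmeasurable_P measurable_translation)+
  also have "\<dots> \<le> C * norm (t' - t)" unfolding measure_translation by (rule shift_P)
  finally show ?thesis by (simp add: norm_minus_commute)
qed

text \<open>The frequency is changed on a fixed set, then the set at a fixed frequency;
  \<open>shift_P\<close> controls the second change.\<close>

lemma dist_ambiguity_le:
  "dist (ambiguity P z) (ambiguity P w) \<le> (2 * pi * R * vol P + 2 * C) * dist z w"
proof -
  let ?A = "P \<inter> (+) (fst z) ` P" and ?B = "P \<inter> (+) (fst w) ` P"
  have "dist (ambiguity P z) (ambiguity P w) \<le> dist (fourier_set ?A (- snd z)) (fourier_set ?A (- snd w))
      + dist (fourier_set ?A (- snd w)) (fourier_set ?B (- snd w))"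
    unfolding ambiguity_def by (rule dist_triangle)
  also have "dist (fourier_set ?A (- snd z)) (fourier_set ?A (- snd w)) \<le> (2 * pi * R * vol ?A) * dist (- snd z) (- snd w)"
    using bounded_P by (intro dist_fourier_set_le lmeasurable_Int_shift) auto
  also have "\<dots> \<le> (2 * pi * R * vol P) * dist z w"
    using R measure_Int_shift_le dist_snd_le[of z w] by (intro mult_mono) (auto simp: dist_minus)
  also have "dist (fourier_set ?A (- snd w)) (fourier_set ?B (- snd w)) \<le> vol (?A - ?B) + vol (?B - ?A)"
    unfolding dist_norm by (intro norm_fourier_set_diff_le lmeasurable_Int_shift)
  also have "\<dots> \<le> C * norm (fst z - fst w) + C * norm (fst w - fst z)"
    by (intro add_mono measure_Int_shift_Diff_le)
  also have "\<dots> = 2 * C * dist (fst z) (fst w)" by (simp add: dist_norm norm_minus_commute)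
  also have "\<dots> \<le> 2 * C * dist z w" using C dist_fst_le[of z w] by (intro mult_left_mono) auto
  finally show ?thesis by (simp add: algebra_simps)
qed

lemma continuous_on_ambiguity: "continuous_on S (ambiguity P)"
proof -
  have "(2 * pi * R * vol P + 2 * C)-lipschitz_on S (ambiguity P)"
    using R C by (intro lipschitz_onI dist_ambiguity_le) auto
  then show ?thesis by (rule lipschitz_on_continuous_on)
qed

lemma borel_measurable_ambiguity [measurable]: "ambiguity P \<in> borel_measurable borel"
  by (intro borel_measurable_continuous_onI continuous_on_ambiguity)

lemma ambiguity_0: "ambiguity P 0 = of_real (vol P)"
  using lmeasurable_P by (simp add: ambiguity_def fourier_set_def fmeasurable_def scaleR_conv_of_real)

lemma ambiguity_nonzero_near_0:
  obtains \<delta> where "\<delta> > 0" "\<And>z. norm z < \<delta> \<Longrightarrow> ambiguity P z \<noteq> 0"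
proof -
  have "isCont (ambiguity P) 0"
    using continuous_on_ambiguity[of UNIV] continuous_on_eq_continuous_at[OF open_UNIV, of "ambiguity P"] by blast
  moreover have "ambiguity P 0 \<noteq> 0" using pos_P by (simp add: ambiguity_0)
  ultimately obtain e where "e > 0" "\<forall>y. dist 0 y < e \<longrightarrow> ambiguity P y \<noteq> 0"
    using continuous_at_avoid[of 0 "ambiguity P" 0] by blast
  then have "e > 0" "\<And>z. norm z < e \<Longrightarrow> ambiguity P z \<noteq> 0" by (metis dist_0_norm)+
  then show thesis by (rule that)
qed

lemma ambiguity_eq_0:
  assumes "norm (fst z) > 2 * R" shows "ambiguity P z = 0"
proof -
  have "P \<inter> (+) (fst z) ` P = {}"
  proof (rule equals0I)
    fix x assume "x \<in> P \<inter> (+) (fst z) ` P"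
    then have "norm x \<le> R" "norm (x - fst z) \<le> R" using bounded_P by (auto simp: mem_translation_iff)
    then show False using norm_triangle_ineq4[of x "x - fst z"] assms by simp
  qed
  then show ?thesis by (simp add: ambiguity_def fourier_set_def)
qed

text \<open>Plancherel's inequality in frequency at each fixed time; the times that matter lie in a
  ball of radius \<open>2 * R\<close>.\<close>

lemma ambiguity_L2: "(\<integral>\<^sup>+z. ennreal ((cmod (ambiguity P z))\<^sup>2) \<partial>lborel) < \<infinity>"
proof -
  let ?V = "vol P"
  have [measurable]: "ambiguity P \<in> borel_measurable (lborel \<Otimes>\<^sub>M lborel)"
    unfolding lborel_prod by simp
  have "(\<integral>\<^sup>+z. ennreal ((cmod (ambiguity P z))\<^sup>2) \<partial>lborel) = (\<integral>\<^sup>+z. ennreal ((cmod (ambiguity P z))\<^sup>2) \<partial>(lborel \<Otimes>\<^sub>M lborel))"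
    by (simp add: lborel_prod)
  also have "\<dots> = (\<integral>\<^sup>+t. (\<integral>\<^sup>+l. ennreal ((cmod (ambiguity P (t, l)))\<^sup>2) \<partial>lborel) \<partial>lborel)"
    by (rule lborel.nn_integral_fst[symmetric]) measurable
  also have "\<dots> \<le> (\<integral>\<^sup>+t. ennreal ?V * indicator (cball (0::'a) (2 * R)) t \<partial>lborel)"
  proof (rule nn_integral_mono)
    fix t :: 'a
    show "(\<integral>\<^sup>+l. ennreal ((cmod (ambiguity P (t, l)))\<^sup>2) \<partial>lborel) \<le> ennreal ?V * indicator (cball 0 (2 * R)) t"
    proof (cases "norm t > 2 * R")
      case True
      then show ?thesis by (simp add: ambiguity_eq_0)
    next
      case False
      have "(\<integral>\<^sup>+l. ennreal ((cmod (ambiguity P (t, l)))\<^sup>2) \<partial>lborel)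
        = (\<integral>\<^sup>+l. ennreal ((cmod (fourier_set (P \<inter> (+) t ` P) l))\<^sup>2) \<partial>lborel)"
        by (simp add: ambiguity_def fourier_set_uminus)
      also have "\<dots> \<le> ennreal (vol (P \<inter> (+) t ` P))"
        using bounded_P by (intro nn_integral_fourier_set_le[OF lmeasurable_Int_shift _ R]) auto
      also have "\<dots> \<le> ennreal ?V" by (intro ennreal_leI measure_Int_shift_le)
      finally show ?thesis using False by simp
    qed
  qed
  also have "\<dots> = ennreal ?V * emeasure lborel (cball (0::'a) (2 * R))" by (simp add: nn_integral_cmult_indicator)
  also have "\<dots> < \<infinity>" using emeasure_lborel_cball_finite[of "0::'a" "2 * R"] by (simp add: ennreal_mult_less_top)
  finally show ?thesis .
qed

text \<open>The tail is taken in frequency alone, since the ambiguity function vanishes at times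
  beyond \<open>2 * R\<close>.\<close>

lemma ambiguity_tail:
  assumes "e > 0"
  obtains n :: nat where "(\<integral>\<^sup>+z. ennreal ((cmod (ambiguity P z))\<^sup>2) * indicator {z. norm (snd z) > real n} z \<partial>lborel) < e"
proof -
  let ?M = "density lborel (\<lambda>z. ennreal ((cmod (ambiguity P z))\<^sup>2))"
  let ?A = "\<lambda>n. {z :: 'a \<times> 'a. norm (snd z) > real n}"
  have A [measurable]: "?A n \<in> sets borel" for n
    by (intro borel_open open_Collect_less continuous_intros)
  have em: "emeasure ?M (?A n) = (\<integral>\<^sup>+z. ennreal ((cmod (ambiguity P z))\<^sup>2) * indicator (?A n) z \<partial>lborel)" for n
    by (subst emeasure_density) auto
  have "emeasure ?M UNIV < \<infinity>"
    using ambiguity_L2 by (subst emeasure_density) auto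
  then have fin: "emeasure ?M (?A n) \<noteq> \<infinity>" for n
    using emeasure_mono[of "?A n" UNIV ?M] by (auto simp: top_unique less_top[symmetric])
  have "(\<lambda>n. emeasure ?M (?A n)) \<longlonglongrightarrow> emeasure ?M (\<Inter>n. ?A n)"
    by (rule Lim_emeasure_decseq) (use fin in \<open>auto simp: decseq_def\<close>)
  moreover have "(\<Inter>n. ?A n) = {}"
  proof (rule equals0I)
    fix z assume "z \<in> (\<Inter>n. ?A n)"
    then have "real n < norm (snd z)" for n by auto
    then show False using real_arch_simple[of "norm (snd z)"] by (meson not_less)
  qed
  ultimately have "(\<lambda>n. emeasure ?M (?A n)) \<longlonglongrightarrow> 0" by simp
  then have "\<forall>\<^sub>F n in sequentially. emeasure ?M (?A n) < e" using assms by (rule order_tendstoD(2))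
  then obtain n where "emeasure ?M (?A n) < e" by (auto simp: eventually_sequentially)
  then show thesis unfolding em by (rule that)
qed

end

lemma nn_integral_lborel_reflect:
  fixes f :: "'a::euclidean_space \<Rightarrow> ennreal"
  assumes [measurable]: "f \<in> borel_measurable borel"
  shows "(\<integral>\<^sup>+x. f (a - x) \<partial>lborel) = (\<integral>\<^sup>+x. f x \<partial>lborel)"
proof -
  have "(\<integral>\<^sup>+x. f x \<partial>lborel) = (\<integral>\<^sup>+x. f x \<partial>(distr lborel borel (\<lambda>x. a + (-1) *\<^sub>R x)))"
    by (subst lborel_affine[of "-1" a]) (simp_all add: density_1)
  also have "\<dots> = (\<integral>\<^sup>+x. f (a - x) \<partial>lborel)" by (subst nn_integral_distr) auto
  finally show ?thesis by simp
qed

section \<open>Gabor atoms, holes and averages\<close>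

context lipschitz_body
begin

definition gabor_atom :: "'a \<times> 'a \<Rightarrow> 'a \<Rightarrow> complex" where
  "gabor_atom z = (\<lambda>x. exp (2 * of_real pi * \<i> * of_real (snd z \<bullet> x)) * normalized_indicator P (x - fst z))"

lemma gabor_system_eq: "gabor_system (normalized_indicator P) \<Lambda> = gabor_atom ` \<Lambda>"
  by (force simp: gabor_system_def gabor_atom_def)

lemma gabor_atom_eq:
  "gabor_atom z = (\<lambda>x. of_real (vol P powr (- 1 / 2)) * (indicator ((+) (fst z) ` P) x *\<^sub>R cis (2 * pi * (snd z \<bullet> x))))"
proof
  fix x
  have "exp (2 * of_real pi * \<i> * of_real (snd z \<bullet> x)) = cis (2 * pi * (snd z \<bullet> x))"
    by (simp add: cis_conv_exp mult_ac)
  moreover have "indicator P (x - fst z) = (indicator ((+) (fst z) ` P) x :: complex)"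
    by (simp add: indicator_def mem_translation_iff)
  ultimately show "gabor_atom z x = of_real (vol P powr (- 1 / 2)) * (indicator ((+) (fst z) ` P) x *\<^sub>R cis (2 * pi * (snd z \<bullet> x)))"
    by (simp add: gabor_atom_def normalized_indicator_def indicator_def)
qed

lemma gabor_atom_L2: "gabor_atom z \<in> L2_functions"
  unfolding gabor_atom_eq by (intro L2_indicator_cis(1) measurable_translation lmeasurable_P)

lemma norm_L2_inner_gabor_atom:
  "cmod (L2_inner (gabor_atom w) (gabor_atom z)) = cmod (ambiguity P (z - w)) / vol P"
proof -
  let ?V = "vol P"
  have "?V powr (- 1 / 2) * ?V powr (- 1 / 2) = ?V powr (- 1)" by (simp flip: powr_add)
  then have c: "?V powr (- 1 / 2) * ?V powr (- 1 / 2) = 1 / ?V" using pos_P by (simp add: powr_minus_divide)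
  have cc: "complex_of_real (?V powr (- 1 / 2)) * cnj (complex_of_real (?V powr (- 1 / 2))) = of_real (1 / ?V)"
    by (simp only: complex_cnj_complex_of_real of_real_mult[symmetric] c)
  have set: "(+) (fst w) ` P \<inter> (+) (fst z) ` P = (+) (fst w) ` (P \<inter> (+) (fst (z - w)) ` P)"
    by (rule set_eqI) (simp add: mem_translation_iff)
  have "L2_inner (gabor_atom w) (gabor_atom z)
    = of_real (1 / ?V) * fourier_set ((+) (fst w) ` (P \<inter> (+) (fst (z - w)) ` P)) (- snd (z - w))"
    unfolding gabor_atom_eq L2_inner_indicator_cis set cc by simp
  also have "fourier_set ((+) (fst w) ` (P \<inter> (+) (fst (z - w)) ` P)) (- snd (z - w))
    = cis (2 * pi * (- snd (z - w) \<bullet> fst w)) * ambiguity P (z - w)"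
    unfolding ambiguity_def by (intro fourier_set_translation sets.Int borel_P borel_translation)
  finally show ?thesis using pos_P by (simp add: norm_mult norm_divide)
qed

lemma gabor_atom_norm: "L2_norm (gabor_atom w) = 1"
proof -
  have "complex_of_real ((L2_norm (gabor_atom w))\<^sup>2) = L2_inner (gabor_atom w) (gabor_atom w)"
    by (rule L2_inner_self[OF gabor_atom_L2, symmetric])
  then have "(L2_norm (gabor_atom w))\<^sup>2 = cmod (L2_inner (gabor_atom w) (gabor_atom w))"
    by (metis norm_of_real abs_power2)
  also have "\<dots> = 1" using pos_P by (simp add: norm_L2_inner_gabor_atom ambiguity_0 zero_prod_def[symmetric])
  finally show ?thesis by (simp add: L2_norm_def)
qed

text \<open>
  Pigeonhole: far apart translates of a ball along \<open>u\<close> cannot all meet the frequency part of \<open>\<Lambda>\<close>,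
  since two points in the same relative position would differ by an element of the tube.
\<close>

lemma hole_exists:
  fixes \<Lambda> :: "('a \<times> 'a) set"
  assumes \<Lambda>: "\<And>z w. z \<in> \<Lambda> \<Longrightarrow> w \<in> \<Lambda> \<Longrightarrow> ambiguity P (z - w) = 0 \<or> cmod (ambiguity P (z - w)) = vol P"
    and \<delta>: "\<delta> > 0" and r0: "r0 > 0"
    and tube: "\<And>t l r. norm t < \<delta> \<Longrightarrow> r \<ge> r0 \<Longrightarrow> norm (l - r *\<^sub>R u) < \<delta> \<Longrightarrow>
      ambiguity P (t, l) \<noteq> 0 \<and> cmod (ambiguity P (t, l)) < vol P"
  obtains \<xi> :: 'a where "\<And>z. z \<in> \<Lambda> \<Longrightarrow> norm (fst z) \<le> T \<Longrightarrow> norm (snd z - \<xi>) > \<rho>"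
proof (rule ccontr)
  assume neg: "\<not> thesis"
  \<comment> \<open>Two of these centres differ by a multiple of \<open>u\<close> with factor at
    least \<open>r0\<close>, as the tube demands. Without a hole, \<open>\<Lambda>\<close> has a
    point close to each of them.\<close>
  define s where "s j = (real j * r0) *\<^sub>R u" for j
  have "\<exists>z\<in>\<Lambda>. norm (fst z) \<le> T \<and> norm (snd z - s j) \<le> \<rho>" for j
  proof (rule ccontr)
    assume "\<not> ?thesis"
    then have "\<And>z. z \<in> \<Lambda> \<Longrightarrow> norm (fst z) \<le> T \<Longrightarrow> norm (snd z - s j) > \<rho>" by (meson not_le)
    then show False using neg that[of "s j"] by blast
  qed
  then obtain z where z: "\<And>j. z j \<in> \<Lambda>" "\<And>j. norm (fst (z j)) \<le> T" "\<And>j. norm (snd (z j) - s j) \<le> \<rho>" by metis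
  \<comment> \<open>The position relative to the centre ranges over a compact set independent of
    \<open>j\<close>; two positions within \<open>\<delta>\<close> of each other yield a difference
    in the tube.\<close>
  define y where "y j = (fst (z j), snd (z j) - s j)" for j
  have "compact (cball (0::'a) T \<times> cball (0::'a) \<rho>)" by (intro compact_Times compact_cball)
  then obtain k where k: "finite k" "cball (0::'a) T \<times> cball (0::'a) \<rho> \<subseteq> (\<Union>x\<in>k. ball x (\<delta> / 2))"
    using \<delta> unfolding compact_eq_totally_bounded by (meson half_gt_zero)
  have "\<exists>x\<in>k. y j \<in> ball x (\<delta> / 2)" for j
    using k(2) z(2,3)[of j] by (auto simp: y_def subset_iff)
  then obtain x where x: "\<And>j. x j \<in> k" "\<And>j. y j \<in> ball (x j) (\<delta> / 2)" by metis
  have "finite (range x)" using k(1) x(1) by (meson finite_subset image_subsetI)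
  then obtain i where i: "infinite {j. x j = x i}"
    using pigeonhole_infinite[of UNIV x] by (auto simp: infinite_UNIV_nat)
  then obtain j where j: "j > i" "x j = x i" by (metis (mono_tags, lifting) infinite_nat_iff_unbounded mem_Collect_eq)
  have "dist (y j) (y i) < \<delta>" 
    using x(2)[of j] x(2)[of i] dist_triangle_half_r[of "x i" "y j" \<delta> "y i"] j by simp
  then have d: "dist (fst (y j)) (fst (y i)) < \<delta>" "dist (snd (y j)) (snd (y i)) < \<delta>"
    using dist_fst_le[of "y j" "y i"] dist_snd_le[of "y j" "y i"] by linarith+
  have "real j - real i \<ge> 1" using j by linarith
  then have r: "(real j - real i) * r0 \<ge> r0" using r0 by simp
  have "snd (z j) - snd (z i) - ((real j - real i) * r0) *\<^sub>R u = snd (y j) - snd (y i)"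
    by (simp add: y_def s_def algebra_simps)
  then have "norm (snd (z j) - snd (z i) - ((real j - real i) * r0) *\<^sub>R u) < \<delta>" using d(2) by (simp add: dist_norm)
  moreover have "norm (fst (z j) - fst (z i)) < \<delta>" using d(1) by (simp add: y_def dist_norm)
  ultimately have "ambiguity P (fst (z j) - fst (z i), snd (z j) - snd (z i)) \<noteq> 0 \<and>
      cmod (ambiguity P (fst (z j) - fst (z i), snd (z j) - snd (z i))) < vol P"
    using tube r by blast
  moreover have "(fst (z j) - fst (z i), snd (z j) - snd (z i)) = z j - z i" by (simp add: prod_eq_iff)
  ultimately show False using \<Lambda>[OF z(1)[of j] z(1)[of i]] by auto
qed

text \<open>
  Averaging the Parseval identity for \<open>gabor_atom w\<close> over \<open>w\<close> in a small ball in the middle of a hole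
  bounds the volume of that ball by a tail of the \<open>L\<^sup>2\<close> norm of the ambiguity function.
\<close>

lemma parseval_average:
  fixes Z :: "('a \<times> 'a) set"
  assumes parseval: "\<And>w. ennreal ((vol P)\<^sup>2) \<le> (\<integral>\<^sup>+z. ennreal ((cmod (ambiguity P (z - w)))\<^sup>2) \<partial>count_space Z)"
    and sep: "\<And>z z'. z \<in> Z \<Longrightarrow> z' \<in> Z \<Longrightarrow> z \<noteq> z' \<Longrightarrow> dist z z' \<ge> 2 * \<delta>" and \<delta>: "0 < \<delta>" "\<delta> \<le> 1"
    and hole: "\<And>z. z \<in> Z \<Longrightarrow> norm (fst z) \<le> 2 * R + 1 \<Longrightarrow> norm (snd z - \<xi>) > real n + 1"
  shows "ennreal ((vol P)\<^sup>2) * emeasure lborel (ball (0 :: 'a \<times> 'a) \<delta>)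
    \<le> (\<integral>\<^sup>+z. ennreal ((cmod (ambiguity P z))\<^sup>2) * indicator {z. norm (snd z) > real n} z \<partial>lborel)"
proof -
  \<comment> \<open>The centre of the hole, at time 0; the average is taken over
    \<open>ball w0 \<delta>\<close>.\<close>
  define w0 :: "'a \<times> 'a" where "w0 = (0, \<xi>)"
  define G where "G z = ennreal ((cmod (ambiguity P z))\<^sup>2) * indicator {z :: 'a \<times> 'a. norm (snd z) > real n} z" for z
  have [measurable]: "{z :: 'a \<times> 'a. norm (snd z) > real n} \<in> sets borel"
    by (intro borel_open open_Collect_less continuous_intros)
  have [measurable]: "G \<in> borel_measurable borel" unfolding G_def by measurable
  have [measurable]: "ball a e \<in> sets borel" for a :: "'a \<times> 'a" and e by simp
  have disj: "z = z'" if zz: "z \<in> Z" "z' \<in> Z" "ball z \<delta> \<inter> ball z' \<delta> \<noteq> {}" for z z'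
  proof (rule ccontr)
    assume "z \<noteq> z'"
    then have "dist z z' \<ge> 2 * \<delta>" using sep zz by blast
    moreover obtain x where "x \<in> ball z \<delta> \<inter> ball z' \<delta>" using zz(3) by blast
    then have "dist z x < \<delta>" "dist z' x < \<delta>" by auto
    ultimately show False using dist_triangle2[of z z' x] by linarith
  qed
  have Z: "countable Z"
  proof -
    have "countable ((\<lambda>z. ball z \<delta>) ` Z)"
    proof (rule countable_disjoint_open_subsets)
      show "disjoint ((\<lambda>z. ball z \<delta>) ` Z)"
      proof (rule disjointI)
        fix A B assume "A \<in> (\<lambda>z. ball z \<delta>) ` Z" "B \<in> (\<lambda>z. ball z \<delta>) ` Z" "A \<noteq> B"
        then obtain z z' where zz: "z \<in> Z" "z' \<in> Z" "A = ball z \<delta>" "B = ball z' \<delta>" "z \<noteq> z'" by blast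
        then show "A \<inter> B = {}" using disj[OF zz(1,2)] by blast
      qed
    qed auto
    moreover have "inj_on (\<lambda>z. ball z \<delta>) Z"
    proof (rule inj_onI)
      fix z z' assume zz: "z \<in> Z" "z' \<in> Z" "ball z \<delta> = ball z' \<delta>"
      have "z \<in> ball z \<delta>" using \<delta> by simp
      then show "z = z'" using disj[OF zz(1,2)] zz(3) by blast
    qed
    ultimately show ?thesis by (rule countable_image_inj_on)
  qed
  have "ennreal ((vol P)\<^sup>2) * emeasure lborel (ball (0 :: 'a \<times> 'a) \<delta>)
      = ennreal ((vol P)\<^sup>2) * emeasure lborel (ball w0 \<delta>)"
  proof -
    have "ball w0 \<delta> = (+) w0 ` ball 0 \<delta>" by (auto simp: mem_translation_iff dist_norm norm_minus_commute)
    moreover have "emeasure lborel ((+) w0 ` ball 0 \<delta>) = emeasure lborel (ball (0 :: 'a \<times> 'a) \<delta>)"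
    proof -
      let ?S = "(+) w0 ` ball (0 :: 'a \<times> 'a) \<delta>"
      have S [measurable]: "?S \<in> sets borel" by (intro borel_translation) simp
      have "emeasure lborel ?S = (\<integral>\<^sup>+x. indicator ?S x \<partial>lborel)" using S by simp
      also have "\<dots> = (\<integral>\<^sup>+x. indicator ?S (w0 + x) \<partial>lborel)"
        by (rule nn_integral_lborel_translation[symmetric]) measurable
      also have "\<dots> = (\<integral>\<^sup>+x. indicator (ball (0 :: 'a \<times> 'a) \<delta>) x \<partial>lborel)"
        by (rule arg_cong[where f = "integral\<^sup>N lborel"], rule ext) (simp only: indicator_def mem_translation_iff add_diff_cancel_left')
      finally show ?thesis by simp
    qed
    ultimately show ?thesis by simp
  qed
  also have "\<dots> = (\<integral>\<^sup>+w. ennreal ((vol P)\<^sup>2) * indicator (ball w0 \<delta>) w \<partial>lborel)"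
    by (simp add: nn_integral_cmult_indicator)
  also have "\<dots> \<le> (\<integral>\<^sup>+w. (\<integral>\<^sup>+z. ennreal ((cmod (ambiguity P (z - w)))\<^sup>2) * indicator (ball w0 \<delta>) w \<partial>count_space Z) \<partial>lborel)"
  proof (rule nn_integral_mono)
    fix w
    have "ennreal ((vol P)\<^sup>2) * indicator (ball w0 \<delta>) w
      \<le> (\<integral>\<^sup>+z. ennreal ((cmod (ambiguity P (z - w)))\<^sup>2) \<partial>count_space Z) * indicator (ball w0 \<delta>) w"
      by (intro mult_right_mono parseval) simp
    also have "\<dots> = (\<integral>\<^sup>+z. ennreal ((cmod (ambiguity P (z - w)))\<^sup>2) * indicator (ball w0 \<delta>) w \<partial>count_space Z)"
      by (rule nn_integral_multc[symmetric]) simp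
    finally show "ennreal ((vol P)\<^sup>2) * indicator (ball w0 \<delta>) w
      \<le> (\<integral>\<^sup>+z. ennreal ((cmod (ambiguity P (z - w)))\<^sup>2) * indicator (ball w0 \<delta>) w \<partial>count_space Z)" .
  qed
  also have "\<dots> = (\<integral>\<^sup>+z. (\<integral>\<^sup>+w. ennreal ((cmod (ambiguity P (z - w)))\<^sup>2) * indicator (ball w0 \<delta>) w \<partial>lborel) \<partial>count_space Z)"
    by (rule nn_integral_count_space_nn_integral[OF Z]) measurable
  \<comment> \<open>For \<open>w\<close> in the ball a term is nonzero only if
    \<open>fst (z - w)\<close> has norm at most \<open>2 * R\<close>, so that \<open>z\<close> is
    subject to \<open>hole\<close>. As \<open>w\<close> is within 1 of \<open>w0\<close>, the
    margins of 1 in time and in frequency leave \<open>snd (z - w)\<close> of norm above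
    \<open>n\<close>.\<close>
  also have "\<dots> \<le> (\<integral>\<^sup>+z. (\<integral>\<^sup>+w. G (z - w) * indicator (ball w0 \<delta>) w \<partial>lborel) \<partial>count_space Z)"
  proof (intro nn_integral_mono)
    fix z w assume "z \<in> space (count_space Z)"
    then have z: "z \<in> Z" by simp
    show "ennreal ((cmod (ambiguity P (z - w)))\<^sup>2) * indicator (ball w0 \<delta>) w \<le> G (z - w) * indicator (ball w0 \<delta>) w"
    proof (cases "w \<in> ball w0 \<delta> \<and> ambiguity P (z - w) \<noteq> 0")
      case True
      then have w: "dist w0 w < \<delta>" "norm (fst (z - w)) \<le> 2 * R" using ambiguity_eq_0[of "z - w"] not_less by auto
      have w': "norm (fst w) < \<delta>" "norm (snd w - \<xi>) < \<delta>"
        using w(1) dist_fst_le[of w0 w] dist_snd_le[of w0 w] by (auto simp: w0_def dist_norm norm_minus_commute)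
      have "norm (fst z) \<le> norm (fst (z - w)) + norm (fst w)" using norm_triangle_ineq[of "fst (z - w)" "fst w"] by simp
      then have "norm (snd z - \<xi>) > real n + 1" using w w' \<delta> by (intro hole z) linarith
      moreover have "norm (snd z - \<xi>) \<le> norm (snd (z - w)) + norm (snd w - \<xi>)"
        using norm_triangle_ineq[of "snd (z - w)" "snd w - \<xi>"] by simp
      ultimately have "norm (snd (z - w)) > real n" using w' \<delta> by linarith
      then show ?thesis by (simp add: G_def)
    qed auto
  qed
  also have "\<dots> = (\<integral>\<^sup>+z. (\<integral>\<^sup>+y. G y * indicator (ball (z - w0) \<delta>) y \<partial>lborel) \<partial>count_space Z)"
  proof (rule nn_integral_cong)
    fix z
    have "(\<integral>\<^sup>+w. G (z - w) * indicator (ball w0 \<delta>) w \<partial>lborel)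
      = (\<integral>\<^sup>+w. G (z - w) * indicator (ball (z - w0) \<delta>) (z - w) \<partial>lborel)"
      by (intro nn_integral_cong) (simp add: indicator_def dist_norm norm_minus_commute)
    also have "\<dots> = (\<integral>\<^sup>+y. G y * indicator (ball (z - w0) \<delta>) y \<partial>lborel)"
      by (rule nn_integral_lborel_reflect) measurable
    finally show "(\<integral>\<^sup>+w. G (z - w) * indicator (ball w0 \<delta>) w \<partial>lborel) = (\<integral>\<^sup>+y. G y * indicator (ball (z - w0) \<delta>) y \<partial>lborel)" .
  qed
  also have "\<dots> = (\<integral>\<^sup>+y. (\<integral>\<^sup>+z. G y * indicator (ball (z - w0) \<delta>) y \<partial>count_space Z) \<partial>lborel)"
    by (rule nn_integral_count_space_nn_integral[OF Z, symmetric]) measurable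
  \<comment> \<open>The balls around the shifted points of \<open>Z\<close> are disjoint, so every
    \<open>y\<close> is counted at most once.\<close>
  also have "\<dots> \<le> (\<integral>\<^sup>+y. G y \<partial>lborel)"
  proof (rule nn_integral_mono)
    fix y
    show "(\<integral>\<^sup>+z. G y * indicator (ball (z - w0) \<delta>) y \<partial>count_space Z) \<le> G y"
    proof (cases "\<exists>z\<in>Z. y \<in> ball (z - w0) \<delta>")
      case True
      then obtain z where z: "z \<in> Z" "y \<in> ball (z - w0) \<delta>" by blast
      have "(\<integral>\<^sup>+z. G y * indicator (ball (z - w0) \<delta>) y \<partial>count_space Z) = (\<Sum>z\<in>{z}. G y * indicator (ball (z - w0) \<delta>) y)"
      proof (rule nn_integral_count_space')
        fix z' assume z': "z' \<in> Z" "z' \<notin> {z}"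
        have "y \<notin> ball (z' - w0) \<delta>"
        proof
          assume "y \<in> ball (z' - w0) \<delta>"
          then have "y + w0 \<in> ball z \<delta> \<inter> ball z' \<delta>" using z by (simp add: dist_norm algebra_simps)
          then show False using disj[OF z(1) z'(1)] z'(2) by blast
        qed
        then show "G y * indicator (ball (z' - w0) \<delta>) y = 0" by simp
      qed (use z in auto)
      also have "\<dots> = G y * indicator (ball (z - w0) \<delta>) y" by (subst sum.insert) simp_all
      finally show ?thesis using z by simp
    next
      case False
      then have "(\<integral>\<^sup>+z. G y * indicator (ball (z - w0) \<delta>) y \<partial>count_space Z) = (\<integral>\<^sup>+z. 0 \<partial>count_space Z)"
        by (intro nn_integral_cong) auto
      then show ?thesis by simp
    qed
  qed
  finally show ?thesis by (simp add: G_def)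
qed

text \<open>The tail is first made smaller than the left side of the averaged Parseval inequality;
  its index \<open>n\<close> then dictates the size of the hole.\<close>

theorem not_gabor_orthonormal_basis_set:
  assumes \<delta>: "\<delta> > 0" and r0: "r0 > 0"
    and tube: "\<And>t l r. norm t < \<delta> \<Longrightarrow> r \<ge> r0 \<Longrightarrow> norm (l - r *\<^sub>R u) < \<delta> \<Longrightarrow>
      ambiguity P (t, l) \<noteq> 0 \<and> cmod (ambiguity P (t, l)) < vol P"
  shows "\<not> gabor_orthonormal_basis_set P"
proof
  assume "gabor_orthonormal_basis_set P"
  then obtain \<Lambda> where B: "L2_orthonormal_basis (gabor_atom ` \<Lambda>)"
    unfolding gabor_orthonormal_basis_set_def gabor_system_eq by blast
  let ?V = "vol P"
  have orth: "ambiguity P (z - w) = 0 \<or> cmod (ambiguity P (z - w)) = ?V" if "z \<in> \<Lambda>" "w \<in> \<Lambda>" for z w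
  proof -
    have "cmod (L2_inner (gabor_atom w) (gabor_atom z)) \<in> {0, 1}"
      using L2_orthonormal_basis_inner[OF B, of "gabor_atom w" "gabor_atom z"] that by auto
    then show ?thesis using pos_P by (auto simp: norm_L2_inner_gabor_atom)
  qed
  \<comment> \<open>\<open>Z\<close> keeps one parameter for each atom, so that on \<open>Z\<close>
    orthogonality forces the ambiguity function to vanish at differences of distinct points.\<close>
  obtain Z where Z: "Z \<subseteq> \<Lambda>" "inj_on gabor_atom Z" "gabor_atom ` \<Lambda> = gabor_atom ` Z"
    using subset_image_inj[of "gabor_atom ` \<Lambda>" gabor_atom \<Lambda>] by auto
  have orthZ: "ambiguity P (z - w) = 0" if "z \<in> Z" "w \<in> Z" "z \<noteq> w" for z w
  proof -
    have "gabor_atom w \<noteq> gabor_atom z" using that Z(2) by (auto dest: inj_onD)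
    then have "L2_inner (gabor_atom w) (gabor_atom z) = 0"
      using L2_orthonormal_basis_inner[OF B, of "gabor_atom w" "gabor_atom z"] that Z(1) by auto
    then have "cmod (ambiguity P (z - w)) / ?V = 0" using norm_L2_inner_gabor_atom[of w z] by simp
    then show ?thesis using pos_P by simp
  qed
  obtain \<epsilon> where \<epsilon>: "\<epsilon> > 0" "\<And>z. norm z < \<epsilon> \<Longrightarrow> ambiguity P z \<noteq> 0" by (rule ambiguity_nonzero_near_0) blast
  \<comment> \<open>The ambiguity function has no zero within \<open>\<epsilon>\<close> of 0, so
    distinct points of \<open>Z\<close> are at least \<open>\<epsilon>\<close> apart; half of it
    makes the balls of radius \<open>\<gamma>\<close> disjoint.\<close>
  define \<gamma> where "\<gamma> = min 1 (\<epsilon> / 2)"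
  have \<gamma>: "0 < \<gamma>" "\<gamma> \<le> 1" "2 * \<gamma> \<le> \<epsilon>" using \<epsilon> by (auto simp: \<gamma>_def)
  have sep: "dist z z' \<ge> 2 * \<gamma>" if "z \<in> Z" "z' \<in> Z" "z \<noteq> z'" for z z'
    using orthZ[OF that] \<epsilon>(2)[of "z - z'"] \<gamma>(3) by (auto simp: dist_norm) (meson le_less_trans not_le)
  have parseval: "ennreal (?V\<^sup>2) \<le> (\<integral>\<^sup>+z. ennreal ((cmod (ambiguity P (z - w)))\<^sup>2) \<partial>count_space Z)" for w
  proof (rule ennreal_le_epsilon)
    fix e :: real assume e: "e > 0"
    then have "e / ?V\<^sup>2 > 0" using pos_P by simp
    from L2_orthonormal_basis_parseval[OF B gabor_atom_L2[of w] this]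
    obtain F where F: "finite F" "F \<subseteq> gabor_atom ` Z" "1 - e / ?V\<^sup>2 < (\<Sum>h\<in>F. (cmod (L2_inner (gabor_atom w) h))\<^sup>2)"
      unfolding gabor_atom_norm Z(3) by auto
    obtain I where I: "I \<subseteq> Z" "F = gabor_atom ` I" using F(2) by (meson subset_imageE)
    have inj: "inj_on gabor_atom I" using Z(2) I(1) by (rule inj_on_subset)
    have finI: "finite I" using F(1) I inj by (simp add: finite_image_iff)
    have "(\<Sum>h\<in>F. (cmod (L2_inner (gabor_atom w) h))\<^sup>2) = (\<Sum>z\<in>I. (cmod (ambiguity P (z - w)))\<^sup>2 / ?V\<^sup>2)"
      unfolding I(2) by (simp add: sum.reindex[OF inj] norm_L2_inner_gabor_atom power_divide)
    also have "\<dots> = (\<Sum>z\<in>I. (cmod (ambiguity P (z - w)))\<^sup>2) / ?V\<^sup>2" by (simp add: sum_divide_distrib)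
    finally have "(1 - e / ?V\<^sup>2) * ?V\<^sup>2 \<le> (\<Sum>z\<in>I. (cmod (ambiguity P (z - w)))\<^sup>2)"
      using F(3) pos_P by (simp add: pos_less_divide_eq)
    then have "?V\<^sup>2 \<le> (\<Sum>z\<in>I. (cmod (ambiguity P (z - w)))\<^sup>2) + e" using pos_P by (simp add: left_diff_distrib)
    then have "ennreal (?V\<^sup>2) \<le> ennreal ((\<Sum>z\<in>I. (cmod (ambiguity P (z - w)))\<^sup>2) + e)" by (rule ennreal_leI)
    also have "\<dots> = (\<Sum>z\<in>I. ennreal ((cmod (ambiguity P (z - w)))\<^sup>2)) + ennreal e"
      using e by (simp add: sum_nonneg sum_ennreal)
    also have "\<dots> \<le> (\<integral>\<^sup>+z. ennreal ((cmod (ambiguity P (z - w)))\<^sup>2) \<partial>count_space Z) + ennreal e"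
      by (intro add_right_mono sum_le_nn_integral_count_space finI I(1))
    finally show "ennreal (?V\<^sup>2) \<le> (\<integral>\<^sup>+z. ennreal ((cmod (ambiguity P (z - w)))\<^sup>2) \<partial>count_space Z) + ennreal e" .
  qed
  have "0 < ennreal (?V\<^sup>2) * emeasure lborel (ball (0 :: 'a \<times> 'a) \<gamma>)"
  proof -
    have "emeasure lborel (ball (0 :: 'a \<times> 'a) \<gamma>) \<noteq> 0"
      using \<gamma>(1) open_not_negligible[of "ball (0 :: 'a \<times> 'a) \<gamma>"] by (auto simp: negligible_iff_emeasure0)
    then show ?thesis using pos_P by (simp add: zero_less_iff_neq_zero)
  qed
  then obtain n where n: "(\<integral>\<^sup>+z. ennreal ((cmod (ambiguity P z))\<^sup>2) * indicator {z. norm (snd z) > real n} z \<partial>lborel)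
      < ennreal (?V\<^sup>2) * emeasure lborel (ball (0 :: 'a \<times> 'a) \<gamma>)"
    by (rule ambiguity_tail)
  obtain \<xi> where "\<And>z. z \<in> \<Lambda> \<Longrightarrow> norm (fst z) \<le> 2 * R + 1 \<Longrightarrow> norm (snd z - \<xi>) > real n + 1"
    by (rule hole_exists[OF orth \<delta> r0 tube]) blast+
  with Z(1) have "\<And>z. z \<in> Z \<Longrightarrow> norm (fst z) \<le> 2 * R + 1 \<Longrightarrow> norm (snd z - \<xi>) > real n + 1" by blast
  from parseval_average[OF parseval sep \<gamma>(1,2) this] n show False by (simp add: not_le[symmetric])
qed

end

section \<open>Non-symmetric polytopes\<close>

text \<open>The normals come from any representation by half-spaces, together with their negatives.
  Replacing the given bounds by the support function leaves the set unchanged and makes every bound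
  attained, also for redundant half-spaces.\<close>

lemma polytope_facet_normals:
  fixes \<Omega> :: "'a::euclidean_space set"
  assumes \<Omega>: "polytope \<Omega>" and pos: "emeasure lebesgue \<Omega> > 0"
  obtains U h R where "facet_normals U h R" "\<Omega> = facet_normals.poly U h"
    "\<And>u. u \<in> U \<Longrightarrow> \<exists>x\<in>\<Omega>. u \<bullet> x = h u" "R \<ge> 0"
proof -
  have comp: "compact \<Omega>" and conv: "convex \<Omega>"
    using \<Omega> by (auto simp: polytope_imp_compact polytope_imp_convex)
  have ne: "\<Omega> \<noteq> {}" using pos by auto
  have int: "interior \<Omega> \<noteq> {}"
    using negligible_convex_interior[OF conv] pos by (auto simp: negligible_iff_emeasure0 fmeasurableD lmeasurable_compact comp)
  obtain F where F: "finite F" "\<Omega> = \<Inter>F" "\<forall>H\<in>F. \<exists>a b. a \<noteq> 0 \<and> H = {x. a \<bullet> x \<le> b}"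
    using polytope_imp_polyhedron[OF \<Omega>] unfolding polyhedron_def by blast
  then obtain a b where ab: "\<And>H. H \<in> F \<Longrightarrow> a H \<noteq> 0 \<and> H = {x. a H \<bullet> x \<le> b H}" by metis
  define U where "U = sgn ` a ` F \<union> (\<lambda>H. - sgn (a H)) ` F"
  define h where "h u = Sup ((\<lambda>x. u \<bullet> x) ` \<Omega>)" for u
  have sup: "\<exists>x\<in>\<Omega>. u \<bullet> x = h u \<and> (\<forall>y\<in>\<Omega>. u \<bullet> y \<le> h u)" for u
  proof -
    have "continuous_on \<Omega> (\<lambda>x. u \<bullet> x)" by (intro continuous_intros)
    then obtain x where x: "x \<in> \<Omega>" "\<forall>y\<in>\<Omega>. u \<bullet> y \<le> u \<bullet> x"
      using continuous_attains_sup[OF comp ne] by blast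
    then have "h u = u \<bullet> x" unfolding h_def by (intro cSup_eq_maximum) auto
    then show ?thesis using x by auto
  qed
  obtain R where R: "R > 0" "\<Omega> \<subseteq> cball 0 R" using compact_imp_bounded[OF comp] by (auto simp: bounded_pos subset_eq)
  have eq: "\<Omega> = {x. \<forall>u\<in>U. u \<bullet> x \<le> h u}"
  proof
    show "\<Omega> \<subseteq> {x. \<forall>u\<in>U. u \<bullet> x \<le> h u}" using sup by blast
    show "{x. \<forall>u\<in>U. u \<bullet> x \<le> h u} \<subseteq> \<Omega>"
    proof
      fix x assume x: "x \<in> {x. \<forall>u\<in>U. u \<bullet> x \<le> h u}"
      have "x \<in> H" if H: "H \<in> F" for H
      proof -
        let ?u = "sgn (a H)"
        have n: "norm (a H) > 0" using ab[OF H] by simp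
        have uU: "?u \<in> U" using H by (auto simp: U_def)
        obtain y where y: "y \<in> \<Omega>" "?u \<bullet> y = h ?u" using sup by blast
        have "a H \<bullet> y \<le> b H" using y(1) F(2) H ab[OF H] by blast
        moreover have "?u \<bullet> x \<le> ?u \<bullet> y" using x uU y by auto
        then have "a H \<bullet> x \<le> a H \<bullet> y" using n by (simp add: sgn_div_norm divide_inverse[symmetric] divide_le_cancel)
        ultimately have "a H \<bullet> x \<le> b H" by linarith
        then show ?thesis using ab[OF H] by blast
      qed
      then show "x \<in> \<Omega>" using F(2) by blast
    qed
  qed
  have loc: "facet_normals U h R"
  proof
    show "finite U" using F(1) by (simp add: U_def)
    show "norm u = 1" if "u \<in> U" for u using that ab by (auto simp: U_def norm_sgn)
    show "- u \<in> U" if "u \<in> U" for u using that by (auto simp: U_def)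
    show "{x. \<forall>u\<in>U. u \<bullet> x \<le> h u} \<subseteq> cball 0 R" "interior {x. \<forall>u\<in>U. u \<bullet> x \<le> h u} \<noteq> {}"
      using R int eq by auto
  qed
  show thesis
  proof (rule that[OF loc])
    show "\<Omega> = facet_normals.poly U h" unfolding facet_normals.poly_def[OF loc] by (rule eq)
    show "\<exists>x\<in>\<Omega>. u \<bullet> x = h u" for u using sup by blast
  qed (use R in simp)
qed

theorem theorem1p4:
  fixes \<Omega> :: "(real ^ 'd) set"
  assumes "polytope \<Omega>"
    and "emeasure lebesgue \<Omega> > 0"
    and "\<not> centrally_symmetric \<Omega>"
  shows "\<not> gabor_orthonormal_basis_set \<Omega>"
proof -
  obtain U h R where loc: "facet_normals U h R" and eq: "\<Omega> = facet_normals.poly U h"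
    and sharp: "\<And>u. u \<in> U \<Longrightarrow> \<exists>x\<in>\<Omega>. u \<bullet> x = h u" and R: "R \<ge> 0"
    by (rule polytope_facet_normals[OF assms(1,2)]) blast
  interpret facet_normals U h R by (rule loc)
  obtain C where C: "C \<ge> 0"
    "\<And>u p \<alpha>. u \<in> U \<Longrightarrow> \<alpha> \<ge> 0 \<Longrightarrow> vol {x \<in> cball 0 R. p < u \<bullet> x \<and> u \<bullet> x \<le> p + \<alpha>} \<le> C * \<alpha>"
    by (rule rim_measure_le) blast
  interpret lipschitz_body \<Omega> R "real (card U) * C"
  proof
    show "\<Omega> \<in> sets borel" unfolding eq by (rule poly_borel)
    show "\<Omega> \<subseteq> cball 0 R" unfolding eq by (rule poly_h_subset)
    show "vol \<Omega> > 0" unfolding eq by (rule poly_h_measure_pos)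
    show "vol (\<Omega> - (+) s ` \<Omega>) \<le> real (card U) * C * norm s" for s
      unfolding eq using poly_shift_measure_le[OF C poly_h_subset, of s] by (simp add: mult.assoc)
  qed (use R C in auto)
  obtain u \<delta> r0 where tube: "norm u = 1" "\<delta> > 0" "r0 > 0"
    "\<And>t l r. norm t < \<delta> \<Longrightarrow> r \<ge> r0 \<Longrightarrow> norm (l - r *\<^sub>R u) < \<delta> \<Longrightarrow>
      fourier_set (\<Omega> \<inter> (+) t ` \<Omega>) l \<noteq> 0 \<and> norm (fourier_set (\<Omega> \<inter> (+) t ` \<Omega>) l) < vol \<Omega>"
    using fourier_cut_nonzero_tube sharp assms(3) unfolding eq by blast
  show ?thesis
  proof (rule not_gabor_orthonormal_basis_set[OF tube(2,3)])
    \<comment> \<open>The ambiguity function at frequency \<open>l\<close> is the transform at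
      \<open>- l\<close>, so its tube runs along \<open>- u\<close>.\<close>
    fix t l :: "real ^ 'd" and r :: real
    assume "norm t < \<delta>" "r0 \<le> r" "norm (l - r *\<^sub>R (- u)) < \<delta>"
    moreover have "norm (- l - r *\<^sub>R u) = norm (l - r *\<^sub>R (- u))" by (metis add.commute minus_add_distrib norm_minus_cancel scaleR_minus_right diff_conv_add_uminus minus_minus)
    ultimately show "ambiguity \<Omega> (t, l) \<noteq> 0 \<and> cmod (ambiguity \<Omega> (t, l)) < vol \<Omega>"
      unfolding ambiguity_def using tube(4)[of t r "- l"] by simp
  qed
qed

end
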